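(* Work in $\mathbf{CZF}$. Full NID follows from the axiom of dependent choice for W-types together with the presentation axiom $\mathbf{PA}$ and $\mathbf{usREA}$.
   Context: For $f:B\to A$ write $B_a=f^{-1}(a)$; the W-type $W_f$ is the initial algebra for the functor $X\mapsto\{(a,t):a\in A,t:B_a\to X\}$, whose elements are of the form $\sup_a t$ with $a\in A$, $t:B_a\to W_f$. A set is a base if every surjection onto it from a set has a section; $\mathbf{PA}$ says every set is a surjective image of a base; $f:B\to A$ is a base map if $A$ and all fibres $B_a$ are bases. The axiom of dependent choice for W-types: for every base map $f:B\to A$ the W-type $W_f$ exists, and for every set $X$ and every family of relations $R_a\subseteq X^{B_a}\times X$ ($a\in A$) that are total (for every $s:B_a\to X$ there is $x$ with $(s,x)\in R_a$), there is a function $h:W_f\to X$ with $(h\circ t,h(\sup_a t))\in R_a$ for every $\sup_a t\in W_f$. A set $U$ is regular if it is transitive and for each $a\in U$ and each total relation $R$ from $a$ to $U$ there is $b\in U$ with $\forall x\in a\,\exists y\in b\,R(x,y)$ and $\forall y\in b\,\exists x\in a\,R(x,y)$; union-closed if $x\in U$ implies $\bigcup x\in U$; separative if for $a,b\in U$ also $\{\emptyset: a\subseteq b\}\in U$. $\mathbf{usREA}$: every set is a subset of a union-closed, regular, separative set. Full NID: for every set $X$ and every set $\mathcal R$ of rules on $X$ (pairs $(a,b)$ of subsets of $X$), the class of $Y\subseteq X$ closed under all rules ($a\subseteq Y$ implies $b\cap Y$ inhabited) is set-generated, i.e. there is a set $G$ of such closed sets such that for every closed $Y$ and $y\in Y$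 some $\beta\in G$ satisfies $y\in\beta\subseteq Y$. *)

theory Defs
  imports Main
begin

section \<open>Intuitionistic first-order logic over \<open>\<in>\<close> and \<open>=\<close>\<close>

text \<open>
  The metatheory is classical, so the claim is stated as derivability in a deeply embedded
  intuitionistic calculus. Variables are de Bruijn indices: index 0 refers to the innermost
  quantifier, and an index pointing beyond all quantifiers is a free variable. The language has
  no function symbols, so substitutions are renamings of variables.
\<close>

datatype fm =
    Mem nat nat  (infix \<open>\<^bold>\<in>\<close> 60)
  | Equal nat nat  (infix \<open>\<^bold>=\<close> 60)
  | Falsity  (\<open>\<^bold>\<bottom>\<close>)
  | Conj fm fm  (infixr \<open>\<^bold>\<and>\<close> 45)
  | Disj fm fm  (infixr \<open>\<^bold>\<or>\<close> 40)
  | Impl fm fm  (infixr \<open>\<^bold>\<longrightarrow>\<close> 35)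
  | Forall fm
  | Exists fm

abbreviation Neg :: "fm \<Rightarrow> fm"  (\<open>\<^bold>\<not> _\<close> [50] 50) where
  "\<^bold>\<not> \<phi> \<equiv> \<phi> \<^bold>\<longrightarrow> \<^bold>\<bottom>"

abbreviation Iff :: "fm \<Rightarrow> fm \<Rightarrow> fm"  (infixr \<open>\<^bold>\<longleftrightarrow>\<close> 30) where
  "\<phi> \<^bold>\<longleftrightarrow> \<psi> \<equiv> (\<phi> \<^bold>\<longrightarrow> \<psi>) \<^bold>\<and> (\<psi> \<^bold>\<longrightarrow> \<phi>)"

text \<open>Bounded quantifiers: \<open>x\<close> is the index of the bound as seen from outside the quantifier.\<close>

abbreviation BForall :: "nat \<Rightarrow> fm \<Rightarrow> fm" where
  "BForall x \<phi> \<equiv> Forall (0 \<^bold>\<in> Suc x \<^bold>\<longrightarrow> \<phi>)"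

abbreviation BExists :: "nat \<Rightarrow> fm \<Rightarrow> fm" where
  "BExists x \<phi> \<equiv> Exists (0 \<^bold>\<in> Suc x \<^bold>\<and> \<phi>)"

primrec lift :: "(nat \<Rightarrow> nat) \<Rightarrow> nat \<Rightarrow> nat" where
  "lift f 0 = 0"
| "lift f (Suc n) = Suc (f n)"

primrec rename :: "(nat \<Rightarrow> nat) \<Rightarrow> fm \<Rightarrow> fm" where
  "rename f (x \<^bold>\<in> y) = (f x \<^bold>\<in> f y)"
| "rename f (x \<^bold>= y) = (f x \<^bold>= f y)"
| "rename f \<^bold>\<bottom> = \<^bold>\<bottom>"
| "rename f (\<phi> \<^bold>\<and> \<psi>) = (rename f \<phi> \<^bold>\<and> rename f \<psi>)"
| "rename f (\<phi> \<^bold>\<or> \<psi>) = (rename f \<phi> \<^bold>\<or> rename f \<psi>)"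
| "rename f (\<phi> \<^bold>\<longrightarrow> \<psi>) = (rename f \<phi> \<^bold>\<longrightarrow> rename f \<psi>)"
| "rename f (Forall \<phi>) = Forall (rename (lift f) \<phi>)"
| "rename f (Exists \<phi>) = Exists (rename (lift f) \<phi>)"

text \<open>\<open>\<phi>[t/0]\<close>, with the remaining free variables lowered by one.\<close>

definition inst :: "nat \<Rightarrow> fm \<Rightarrow> fm" where
  "inst t \<phi> = rename (case_nat t id) \<phi>"

text \<open>
  Natural deduction from axioms \<open>T\<close> and open hypotheses \<open>\<Gamma>\<close>. The eigenvariable conditions
  (expressed by shifting) concern \<open>\<Gamma>\<close> only: free variables of formulas in \<open>T\<close> are implicitly
  universally quantified, so an axiom scheme with parameters stands for its universal closures.
\<close>

inductive deriv :: "fm set \<Rightarrow> fm set \<Rightarrow> fm \<Rightarrow> bool" for T :: "fm set" where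
  ax: "\<phi> \<in> T \<Longrightarrow> deriv T \<Gamma> \<phi>"
| hyp: "\<phi> \<in> \<Gamma> \<Longrightarrow> deriv T \<Gamma> \<phi>"
| falsityE: "deriv T \<Gamma> \<^bold>\<bottom> \<Longrightarrow> deriv T \<Gamma> \<phi>"
| conjI: "deriv T \<Gamma> \<phi> \<Longrightarrow> deriv T \<Gamma> \<psi> \<Longrightarrow> deriv T \<Gamma> (\<phi> \<^bold>\<and> \<psi>)"
| conjE1: "deriv T \<Gamma> (\<phi> \<^bold>\<and> \<psi>) \<Longrightarrow> deriv T \<Gamma> \<phi>"
| conjE2: "deriv T \<Gamma> (\<phi> \<^bold>\<and> \<psi>) \<Longrightarrow> deriv T \<Gamma> \<psi>"
| disjI1: "deriv T \<Gamma> \<phi> \<Longrightarrow> deriv T \<Gamma> (\<phi> \<^bold>\<or> \<psi>)"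
| disjI2: "deriv T \<Gamma> \<psi> \<Longrightarrow> deriv T \<Gamma> (\<phi> \<^bold>\<or> \<psi>)"
| disjE: "deriv T \<Gamma> (\<phi> \<^bold>\<or> \<psi>) \<Longrightarrow> deriv T (insert \<phi> \<Gamma>) \<chi> \<Longrightarrow> deriv T (insert \<psi> \<Gamma>) \<chi>
    \<Longrightarrow> deriv T \<Gamma> \<chi>"
| implI: "deriv T (insert \<phi> \<Gamma>) \<psi> \<Longrightarrow> deriv T \<Gamma> (\<phi> \<^bold>\<longrightarrow> \<psi>)"
| implE: "deriv T \<Gamma> (\<phi> \<^bold>\<longrightarrow> \<psi>) \<Longrightarrow> deriv T \<Gamma> \<phi> \<Longrightarrow> deriv T \<Gamma> \<psi>"
| forallI: "deriv T (rename Suc ` \<Gamma>) \<phi> \<Longrightarrow> deriv T \<Gamma> (Forall \<phi>)"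
| forallE: "deriv T \<Gamma> (Forall \<phi>) \<Longrightarrow> deriv T \<Gamma> (inst t \<phi>)"
| existsI: "deriv T \<Gamma> (inst t \<phi>) \<Longrightarrow> deriv T \<Gamma> (Exists \<phi>)"
| existsE: "deriv T \<Gamma> (Exists \<phi>) \<Longrightarrow> deriv T (insert \<phi> (rename Suc ` \<Gamma>)) (rename Suc \<psi>)
    \<Longrightarrow> deriv T \<Gamma> \<psi>"
| equalI: "deriv T \<Gamma> (t \<^bold>= t)"
| equalE: "deriv T \<Gamma> (s \<^bold>= t) \<Longrightarrow> deriv T \<Gamma> (inst s \<phi>) \<Longrightarrow> deriv T \<Gamma> (inst t \<phi>)"

abbreviation provable :: "fm set \<Rightarrow> fm \<Rightarrow> bool"  (infix \<open>\<turnstile>\<close> 25) where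
  "T \<turnstile> \<phi> \<equiv> deriv T {} \<phi>"


section \<open>Basic set-theoretic vocabulary\<close>

text \<open>
  The arguments of these formula builders are variable indices; beneath \<open>k\<close> further quantifiers
  an argument \<open>x\<close> becomes \<open>x + k\<close>. The indices are cross-checked at the end of this theory.
\<close>

definition is_subset :: "nat \<Rightarrow> nat \<Rightarrow> fm" where
  "is_subset x y = BForall x (0 \<^bold>\<in> y+1)"

definition is_empty :: "nat \<Rightarrow> fm" where
  "is_empty x = Forall (\<^bold>\<not> 0 \<^bold>\<in> x+1)"

text \<open>\<open>z = {x, y}\<close>\<close>
definition is_upair :: "nat \<Rightarrow> nat \<Rightarrow> nat \<Rightarrow> fm" where
  "is_upair z x y = Forall (0 \<^bold>\<in> z+1 \<^bold>\<longleftrightarrow> 0 \<^bold>= x+1 \<^bold>\<or> 0 \<^bold>= y+1)"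

text \<open>\<open>z = (x, y) = {{x}, {x, y}}\<close>\<close>
definition is_opair :: "nat \<Rightarrow> nat \<Rightarrow> nat \<Rightarrow> fm" where
  "is_opair z x y = Exists (Exists
     (is_upair 1 (x+2) (x+2) \<^bold>\<and> is_upair 0 (x+2) (y+2) \<^bold>\<and> is_upair (z+2) 1 0))"

text \<open>\<open>(x, y) \<in> r\<close>\<close>
definition rel :: "nat \<Rightarrow> nat \<Rightarrow> nat \<Rightarrow> fm" where
  "rel r x y = BExists r (is_opair 0 (x+1) (y+1))"

text \<open>\<open>r \<subseteq> x \<times> y\<close>\<close>
definition is_relation :: "nat \<Rightarrow> nat \<Rightarrow> nat \<Rightarrow> fm" where
  "is_relation r x y = BForall r (BExists (x+1) (BExists (y+2) (is_opair 2 1 0)))"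

text \<open>\<open>f : x \<rightarrow> y\<close>\<close>
definition is_func :: "nat \<Rightarrow> nat \<Rightarrow> nat \<Rightarrow> fm" where
  "is_func f x y = (is_relation f x y
     \<^bold>\<and> BForall x (BExists (y+1) (rel (f+2) 1 0))
     \<^bold>\<and> BForall x (BForall (y+1) (BForall (y+2)
         (rel (f+3) 2 1 \<^bold>\<and> rel (f+3) 2 0 \<^bold>\<longrightarrow> 1 \<^bold>= 0))))"

definition is_surj :: "nat \<Rightarrow> nat \<Rightarrow> nat \<Rightarrow> fm" where
  "is_surj f x y = (is_func f x y \<^bold>\<and> BForall y (BExists (x+1) (rel (f+2) 0 1)))"

text \<open>\<open>r = h \<circ> t\<close>\<close>
definition is_comp :: "nat \<Rightarrow> nat \<Rightarrow> nat \<Rightarrow> fm" where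
  "is_comp r h t = Forall (0 \<^bold>\<in> r+1 \<^bold>\<longleftrightarrow>
     Exists (Exists (Exists (rel (t+4) 2 1 \<^bold>\<and> rel (h+4) 1 0 \<^bold>\<and> is_opair 3 2 0))))"


section \<open>Constructive Zermelo-Fraenkel set theory\<close>

text \<open>
  \<open>place xs d \<phi>\<close>: the first variables of \<open>\<phi>\<close> become \<open>xs\<close>; the remaining ones (the parameters)
  are numbered from \<open>d\<close> on, where \<open>d\<close> is the number of quantifiers in whose scope it is placed.
\<close>

definition place :: "nat list \<Rightarrow> nat \<Rightarrow> fm \<Rightarrow> fm" where
  "place xs d \<phi> = rename (\<lambda>i. if i < length xs then xs ! i else i - length xs + d) \<phi>"

inductive bounded_fm :: "fm \<Rightarrow> bool" where
  "bounded_fm (x \<^bold>\<in> y)"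
| "bounded_fm (x \<^bold>= y)"
| "bounded_fm \<^bold>\<bottom>"
| "bounded_fm \<phi> \<Longrightarrow> bounded_fm \<psi> \<Longrightarrow> bounded_fm (\<phi> \<^bold>\<and> \<psi>)"
| "bounded_fm \<phi> \<Longrightarrow> bounded_fm \<psi> \<Longrightarrow> bounded_fm (\<phi> \<^bold>\<or> \<psi>)"
| "bounded_fm \<phi> \<Longrightarrow> bounded_fm \<psi> \<Longrightarrow> bounded_fm (\<phi> \<^bold>\<longrightarrow> \<psi>)"
| "bounded_fm \<phi> \<Longrightarrow> bounded_fm (BForall x \<phi>)"
| "bounded_fm \<phi> \<Longrightarrow> bounded_fm (BExists x \<phi>)"

definition extensionality_ax :: fm where
  "extensionality_ax = Forall (Forall (Forall (0 \<^bold>\<in> 2 \<^bold>\<longleftrightarrow> 0 \<^bold>\<in> 1) \<^bold>\<longrightarrow> 1 \<^bold>= 0))"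

definition pairing_ax :: fm where
  "pairing_ax = Forall (Forall (Exists (is_upair 0 2 1)))"

definition union_ax :: fm where
  "union_ax = Forall (Exists (Forall (0 \<^bold>\<in> 1 \<^bold>\<longleftrightarrow> BExists 2 (1 \<^bold>\<in> 0))))"

text \<open>\<open>\<exists>w. \<forall>x. x \<in> w \<longleftrightarrow> x = \<emptyset> \<or> (\<exists>y\<in>w. x = y \<union> {y})\<close>\<close>
definition infinity_ax :: fm where
  "infinity_ax = Exists (Forall (0 \<^bold>\<in> 1 \<^bold>\<longleftrightarrow>
     is_empty 0 \<^bold>\<or> BExists 1 (Forall (0 \<^bold>\<in> 2 \<^bold>\<longleftrightarrow> 0 \<^bold>\<in> 1 \<^bold>\<or> 0 \<^bold>= 1))))"

text \<open>\<open>\<forall>a. \<exists>b. \<forall>x. x \<in> b \<longleftrightarrow> x \<in> a \<and> \<phi> x\<close>\<close>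
definition separation_ax :: "fm \<Rightarrow> fm" where
  "separation_ax \<phi> = Forall (Exists (Forall (0 \<^bold>\<in> 1 \<^bold>\<longleftrightarrow> 0 \<^bold>\<in> 2 \<^bold>\<and> place [0] 3 \<phi>)))"

text \<open>\<open>\<forall>a. (\<forall>x\<in>a. \<exists>y. \<phi> x y) \<longrightarrow> (\<exists>b. (\<forall>x\<in>a. \<exists>y\<in>b. \<phi> x y) \<and> (\<forall>y\<in>b. \<exists>x\<in>a. \<phi> x y))\<close>\<close>
definition strong_collection_ax :: "fm \<Rightarrow> fm" where
  "strong_collection_ax \<phi> = Forall
     (BForall 0 (Exists (place [1,0] 3 \<phi>)) \<^bold>\<longrightarrow>
      Exists (BForall 1 (BExists 1 (place [1,0] 4 \<phi>)) \<^bold>\<and>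
              BForall 0 (BExists 2 (place [0,1] 4 \<phi>))))"

text \<open>\<open>\<forall>a b. \<exists>c. \<forall>u. (\<forall>x\<in>a. \<exists>y\<in>b. \<phi> x y u) \<longrightarrow>
  (\<exists>d\<in>c. (\<forall>x\<in>a. \<exists>y\<in>d. \<phi> x y u) \<and> (\<forall>y\<in>d. \<exists>x\<in>a. \<phi> x y u))\<close>\<close>
definition subset_collection_ax :: "fm \<Rightarrow> fm" where
  "subset_collection_ax \<phi> = Forall (Forall (Exists (Forall
     (BForall 3 (BExists 3 (place [1,0,2] 6 \<phi>)) \<^bold>\<longrightarrow>
      BExists 1 (BForall 4 (BExists 1 (place [1,0,3] 7 \<phi>)) \<^bold>\<and>
                 BForall 0 (BExists 5 (place [0,1,3] 7 \<phi>)))))))"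

text \<open>\<open>(\<forall>a. (\<forall>x\<in>a. \<phi> x) \<longrightarrow> \<phi> a) \<longrightarrow> (\<forall>a. \<phi> a)\<close>\<close>
definition set_induction_ax :: "fm \<Rightarrow> fm" where
  "set_induction_ax \<phi> = (Forall (BForall 0 (place [0] 2 \<phi>) \<^bold>\<longrightarrow> \<phi>) \<^bold>\<longrightarrow> Forall \<phi>)"

definition CZF :: "fm set" where
  "CZF = {extensionality_ax, pairing_ax, union_ax, infinity_ax}
     \<union> {separation_ax \<phi> |\<phi>. bounded_fm \<phi>}
     \<union> range strong_collection_ax \<union> range subset_collection_ax \<union> range set_induction_ax"


section \<open>The presentation axiom\<close>

definition is_base :: "nat \<Rightarrow> fm" where
  "is_base p = Forall (Forall (is_surj 0 1 (p+2) \<^bold>\<longrightarrow>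
     Exists (is_func 0 (p+3) 2 \<^bold>\<and> BForall (p+3) (BExists 3 (rel 2 1 0 \<^bold>\<and> rel 3 0 1)))))"

definition PA :: fm where
  "PA = Forall (Exists (Exists (is_base 1 \<^bold>\<and> is_surj 0 1 2)))"


section \<open>Dependent choice for W-types\<close>

text \<open>\<open>z = B\<^sub>a = f\<inverse>(a)\<close>\<close>
definition is_fibre :: "nat \<Rightarrow> nat \<Rightarrow> nat \<Rightarrow> fm" where
  "is_fibre z f a = Forall (0 \<^bold>\<in> z+1 \<^bold>\<longleftrightarrow> rel (f+1) 0 (a+1))"

text \<open>\<open>f : B \<rightarrow> A\<close> is a base map\<close>
definition is_base_map :: "nat \<Rightarrow> nat \<Rightarrow> nat \<Rightarrow> fm" where
  "is_base_map f B A = (is_func f B A \<^bold>\<and> is_base A \<^bold>\<and>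
     BForall A (Exists (is_fibre 0 (f+2) 1 \<^bold>\<and> is_base 0)))"

text \<open>\<open>t : B\<^sub>a \<rightarrow> X\<close>\<close>
definition is_fibre_map :: "nat \<Rightarrow> nat \<Rightarrow> nat \<Rightarrow> nat \<Rightarrow> fm" where
  "is_fibre_map t f a X = Exists (is_fibre 0 (f+1) (a+1) \<^bold>\<and> is_func (t+1) 0 (X+1))"

text \<open>\<open>z = {(a, t) : a \<in> A, t : B\<^sub>a \<rightarrow> X}\<close>\<close>
definition is_functor_obj :: "nat \<Rightarrow> nat \<Rightarrow> nat \<Rightarrow> nat \<Rightarrow> fm" where
  "is_functor_obj z f A X = Forall (0 \<^bold>\<in> z+1 \<^bold>\<longleftrightarrow>
     BExists (A+1) (Exists (is_fibre_map 0 (f+3) 1 (X+3) \<^bold>\<and> is_opair 2 1 0)))"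

text \<open>\<open>(X, m)\<close> is an algebra for this functor\<close>
definition is_algebra :: "nat \<Rightarrow> nat \<Rightarrow> nat \<Rightarrow> nat \<Rightarrow> fm" where
  "is_algebra X m f A = Exists (is_functor_obj 0 (f+1) (A+1) (X+1) \<^bold>\<and> is_func (m+1) 0 (X+1))"

text \<open>\<open>m (a, t) = x\<close>\<close>
definition is_app :: "nat \<Rightarrow> nat \<Rightarrow> nat \<Rightarrow> nat \<Rightarrow> fm" where
  "is_app m a t x = Exists (is_opair 0 (a+1) (t+1) \<^bold>\<and> rel (m+1) 0 (x+1))"

text \<open>
  \<open>h : (W, s) \<rightarrow> (X, m)\<close> is an algebra morphism: \<open>h (s (a, t)) = m (a, h \<circ> t)\<close>
\<close>
definition is_morphism :: "nat \<Rightarrow> nat \<Rightarrow> nat \<Rightarrow> nat \<Rightarrow> nat \<Rightarrow> nat \<Rightarrow> nat \<Rightarrow> fm" where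
  "is_morphism h W s X m f A = (is_func h W X \<^bold>\<and>
     BForall A (Forall (is_fibre_map 0 (f+2) 1 (W+2) \<^bold>\<longrightarrow>
       Exists (Exists (Exists
         (is_app (s+5) 4 3 2 \<^bold>\<and> is_comp 1 (h+5) 3 \<^bold>\<and> is_app (m+5) 4 1 0 \<^bold>\<and> rel (h+5) 2 0))))))"

text \<open>\<open>(W, s)\<close> is the W-type of \<open>f\<close>, where \<open>s (a, t) = sup\<^sub>a t\<close>\<close>
definition is_W_type :: "nat \<Rightarrow> nat \<Rightarrow> nat \<Rightarrow> nat \<Rightarrow> fm" where
  "is_W_type W s f A = (is_algebra W s f A \<^bold>\<and>
     Forall (Forall (is_algebra 1 0 (f+2) (A+2) \<^bold>\<longrightarrow>
       Exists (is_morphism 0 (W+3) (s+3) 2 1 (f+3) (A+3) \<^bold>\<and>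
         Forall (is_morphism 0 (W+4) (s+4) 3 2 (f+4) (A+4) \<^bold>\<longrightarrow> 0 \<^bold>= 1)))))"

text \<open>
  \<open>R\<close> is a family, i.e. a function on \<open>A\<close>, of relations \<open>R\<^sub>a \<subseteq> X\<^bsup>B\<^sub>a\<^esup> \<times> X\<close> such that for every
  \<open>q : B\<^sub>a \<rightarrow> X\<close> there is an \<open>x\<close> with \<open>(q, x) \<in> R\<^sub>a\<close>
\<close>
definition is_total_family :: "nat \<Rightarrow> nat \<Rightarrow> nat \<Rightarrow> nat \<Rightarrow> fm" where
  "is_total_family R X f A = (Exists (is_func (R+1) (A+1) 0) \<^bold>\<and>
     BForall A (Forall (rel (R+2) 1 0 \<^bold>\<longrightarrow>
       BForall 0 (Exists (BExists (X+4) (is_fibre_map 1 (f+5) 4 (X+5) \<^bold>\<and> is_opair 2 1 0))) \<^bold>\<and>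
       Forall (is_fibre_map 0 (f+3) 2 (X+3) \<^bold>\<longrightarrow> BExists (X+3) (rel 2 1 0)))))"

text \<open>\<open>(h \<circ> t, h (sup\<^sub>a t)) \<in> R\<^sub>a\<close> for every \<open>sup\<^sub>a t\<close> in \<open>W\<close>\<close>
definition chooses :: "nat \<Rightarrow> nat \<Rightarrow> nat \<Rightarrow> nat \<Rightarrow> nat \<Rightarrow> nat \<Rightarrow> fm" where
  "chooses h R W s f A =
     BForall A (Forall (is_fibre_map 0 (f+2) 1 (W+2) \<^bold>\<longrightarrow>
       Exists (Exists (Exists (Exists
         (is_app (s+6) 5 4 3 \<^bold>\<and> is_comp 2 (h+6) 4 \<^bold>\<and> rel (h+6) 3 1 \<^bold>\<and> rel (R+6) 5 0 \<^bold>\<and> rel 0 2 1))))))"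

definition DC_for_W_types :: fm where
  "DC_for_W_types = Forall (Forall (Forall (is_base_map 0 1 2 \<^bold>\<longrightarrow>
     Exists (Exists (is_W_type 1 0 2 4 \<^bold>\<and>
       Forall (Forall (is_total_family 0 1 4 6 \<^bold>\<longrightarrow>
         Exists (is_func 0 4 2 \<^bold>\<and> chooses 0 1 4 3 5 7))))))))"


section \<open>The regular extension axiom \<open>usREA\<close>\<close>

definition is_transitive :: "nat \<Rightarrow> fm" where
  "is_transitive U = BForall U (is_subset 0 (U+1))"

definition is_regular :: "nat \<Rightarrow> fm" where
  "is_regular U = (is_transitive U \<^bold>\<and>
     BForall U (Forall (is_relation 0 1 (U+2) \<^bold>\<and> BForall 1 (BExists (U+3) (rel 2 1 0)) \<^bold>\<longrightarrow>
       BExists (U+2) (BForall 2 (BExists 1 (rel 3 1 0)) \<^bold>\<and>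
                      BForall 0 (BExists 3 (rel 3 0 1))))))"

text \<open>\<open>x \<in> U\<close> implies \<open>\<Union>x \<in> U\<close>\<close>
definition is_union_closed :: "nat \<Rightarrow> fm" where
  "is_union_closed U = BForall U (BExists (U+1) (Forall (0 \<^bold>\<in> 1 \<^bold>\<longleftrightarrow> BExists 2 (1 \<^bold>\<in> 0))))"

text \<open>\<open>a, b \<in> U\<close> implies \<open>{\<emptyset> : a \<subseteq> b} \<in> U\<close>\<close>
definition is_separative :: "nat \<Rightarrow> fm" where
  "is_separative U = BForall U (BForall (U+1) (BExists (U+2)
     (Forall (0 \<^bold>\<in> 1 \<^bold>\<longleftrightarrow> is_empty 0 \<^bold>\<and> is_subset 3 2))))"

definition usREA :: fm where
  "usREA = Forall (Exists (is_subset 1 0 \<^bold>\<and> is_union_closed 0 \<^bold>\<and> is_regular 0 \<^bold>\<and> is_separative 0))"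


section \<open>Non-deterministic inductive definitions\<close>

text \<open>\<open>R\<close> is a set of rules on \<open>X\<close>\<close>
definition are_rules :: "nat \<Rightarrow> nat \<Rightarrow> fm" where
  "are_rules R X = BForall R (Exists (Exists
     (is_subset 1 (X+3) \<^bold>\<and> is_subset 0 (X+3) \<^bold>\<and> is_opair 2 1 0)))"

text \<open>\<open>Y \<subseteq> X\<close> is closed under all rules in \<open>R\<close>\<close>
definition is_closed :: "nat \<Rightarrow> nat \<Rightarrow> nat \<Rightarrow> fm" where
  "is_closed Y X R = (is_subset Y X \<^bold>\<and>
     Forall (Forall (rel (R+2) 1 0 \<^bold>\<longrightarrow> is_subset 1 (Y+2) \<^bold>\<longrightarrow> BExists 0 (0 \<^bold>\<in> Y+3))))"

definition full_NID :: fm where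
  "full_NID = Forall (Forall (are_rules 0 1 \<^bold>\<longrightarrow>
     Exists (BForall 0 (is_closed 0 3 2) \<^bold>\<and>
       Forall (is_closed 0 3 2 \<^bold>\<longrightarrow> BForall 0 (BExists 2 (1 \<^bold>\<in> 0 \<^bold>\<and> is_subset 0 2))))))"


section \<open>Cross-check of the de Bruijn indices\<close>

text \<open>
  Evaluating the formulas in an arbitrary structure \<open>('d, E)\<close> turns them into statements with
  named variables. This (classical) evaluation is only a reading aid; it plays no role in
  the notion of derivability.
\<close>

primrec sat :: "('d \<Rightarrow> 'd \<Rightarrow> bool) \<Rightarrow> (nat \<Rightarrow> 'd) \<Rightarrow> fm \<Rightarrow> bool" where
  "sat E e (x \<^bold>\<in> y) = E (e x) (e y)"
| "sat E e (x \<^bold>= y) = (e x = e y)"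
| "sat E e \<^bold>\<bottom> = False"
| "sat E e (\<phi> \<^bold>\<and> \<psi>) = (sat E e \<phi> \<and> sat E e \<psi>)"
| "sat E e (\<phi> \<^bold>\<or> \<psi>) = (sat E e \<phi> \<or> sat E e \<psi>)"
| "sat E e (\<phi> \<^bold>\<longrightarrow> \<psi>) = (sat E e \<phi> \<longrightarrow> sat E e \<psi>)"
| "sat E e (Forall \<phi>) = (\<forall>d. sat E (case_nat d e) \<phi>)"
| "sat E e (Exists \<phi>) = (\<exists>d. sat E (case_nat d e) \<phi>)"

lemma sat_rename [simp]: "sat E e (rename f \<phi>) \<longleftrightarrow> sat E (\<lambda>i. e (f i)) \<phi>"
proof (induction \<phi> arbitrary: e f)
  have *: "(\<lambda>i. case_nat d e (lift f i)) = case_nat d (\<lambda>i. e (f i))" for d :: 'd and e f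
    by (rule ext) (simp split: nat.split)
  {
    case (Forall \<phi>) show ?case by (simp only: rename.simps sat.simps Forall.IH *)
  next
    case (Exists \<phi>) show ?case by (simp only: rename.simps sat.simps Exists.IH *)
  }
qed simp_all

lemma sat_place [simp]:
  "sat E e (place [i] d \<phi>) \<longleftrightarrow> sat E (case_nat (e i) (\<lambda>k. e (k+d))) \<phi>"
  "sat E e (place [i,j] d \<phi>) \<longleftrightarrow>
     sat E (case_nat (e i) (case_nat (e j) (\<lambda>k. e (k+d)))) \<phi>"
  "sat E e (place [i,j,l] d \<phi>) \<longleftrightarrow>
     sat E (case_nat (e i) (case_nat (e j) (case_nat (e l) (\<lambda>k. e (k+d))))) \<phi>"
  unfolding place_def sat_rename
  by (rule arg_cong[where f = "\<lambda>e. sat E e \<phi>"], rule ext,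
      simp add: nth_Cons split: nat.split)+

locale reading =
  fixes E :: "'d \<Rightarrow> 'd \<Rightarrow> bool"  (infix \<open>\<epsilon>\<close> 50)
begin

definition "Subset x y \<longleftrightarrow> (\<forall>z. z \<epsilon> x \<longrightarrow> z \<epsilon> y)"
definition "Empty x \<longleftrightarrow> (\<forall>z. \<not> z \<epsilon> x)"
definition "Upair z x y \<longleftrightarrow> (\<forall>w. w \<epsilon> z \<longleftrightarrow> w = x \<or> w = y)"
definition "Opair z x y \<longleftrightarrow> (\<exists>u v. Upair u x x \<and> Upair v x y \<and> Upair z u v)"
definition "Rel r x y \<longleftrightarrow> (\<exists>p. p \<epsilon> r \<and> Opair p x y)"
definition "Relation r x y \<longleftrightarrow> (\<forall>p. p \<epsilon> r \<longrightarrow> (\<exists>u. u \<epsilon> x \<and> (\<exists>v. v \<epsilon> y \<and> Opair p u v)))"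
definition "Function f x y \<longleftrightarrow> Relation f x y \<and> (\<forall>u. u \<epsilon> x \<longrightarrow> (\<exists>v. v \<epsilon> y \<and> Rel f u v))
  \<and> (\<forall>u. u \<epsilon> x \<longrightarrow> (\<forall>v. v \<epsilon> y \<longrightarrow> (\<forall>w. w \<epsilon> y \<longrightarrow> Rel f u v \<and> Rel f u w \<longrightarrow> v = w)))"
definition "Surj f x y \<longleftrightarrow> Function f x y \<and> (\<forall>v. v \<epsilon> y \<longrightarrow> (\<exists>u. u \<epsilon> x \<and> Rel f u v))"
definition "Comp r h t \<longleftrightarrow> (\<forall>q. q \<epsilon> r \<longleftrightarrow> (\<exists>u v w. Rel t u v \<and> Rel h v w \<and> Opair q u w))"
definition "Base p \<longleftrightarrow> (\<forall>x f. Surj f x p \<longrightarrow>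
  (\<exists>s. Function s p x \<and> (\<forall>u. u \<epsilon> p \<longrightarrow> (\<exists>v. v \<epsilon> x \<and> Rel s u v \<and> Rel f v u))))"
definition "Fibre z f a \<longleftrightarrow> (\<forall>b. b \<epsilon> z \<longleftrightarrow> Rel f b a)"
definition "Base_map f B A \<longleftrightarrow> Function f B A \<and> Base A \<and>
  (\<forall>a. a \<epsilon> A \<longrightarrow> (\<exists>z. Fibre z f a \<and> Base z))"
definition "Fibre_map t f a X \<longleftrightarrow> (\<exists>z. Fibre z f a \<and> Function t z X)"
definition "Functor_obj z f A X \<longleftrightarrow>
  (\<forall>p. p \<epsilon> z \<longleftrightarrow> (\<exists>a. a \<epsilon> A \<and> (\<exists>t. Fibre_map t f a X \<and> Opair p a t)))"
definition "Algebra X m f A \<longleftrightarrow> (\<exists>z. Functor_obj z f A X \<and> Function m z X)"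
definition "App m a t x \<longleftrightarrow> (\<exists>p. Opair p a t \<and> Rel m p x)"
definition "Morphism h W s X m f A \<longleftrightarrow> Function h W X \<and>
  (\<forall>a. a \<epsilon> A \<longrightarrow> (\<forall>t. Fibre_map t f a W \<longrightarrow>
    (\<exists>w r x. App s a t w \<and> Comp r h t \<and> App m a r x \<and> Rel h w x)))"
definition "W_type W s f A \<longleftrightarrow> Algebra W s f A \<and>
  (\<forall>X m. Algebra X m f A \<longrightarrow>
    (\<exists>h. Morphism h W s X m f A \<and> (\<forall>k. Morphism k W s X m f A \<longrightarrow> k = h)))"
definition "Total_family R X f A \<longleftrightarrow> (\<exists>C. Function R A C) \<and>
  (\<forall>a. a \<epsilon> A \<longrightarrow> (\<forall>Ra. Rel R a Ra \<longrightarrow>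
    (\<forall>p. p \<epsilon> Ra \<longrightarrow> (\<exists>q x. x \<epsilon> X \<and> Fibre_map q f a X \<and> Opair p q x)) \<and>
    (\<forall>q. Fibre_map q f a X \<longrightarrow> (\<exists>x. x \<epsilon> X \<and> Rel Ra q x))))"
definition "Chooses h R W s f A \<longleftrightarrow> (\<forall>a. a \<epsilon> A \<longrightarrow> (\<forall>t. Fibre_map t f a W \<longrightarrow>
  (\<exists>w q x Ra. App s a t w \<and> Comp q h t \<and> Rel h w x \<and> Rel R a Ra \<and> Rel Ra q x)))"
definition "Transitive U \<longleftrightarrow> (\<forall>x. x \<epsilon> U \<longrightarrow> Subset x U)"
definition "Regular U \<longleftrightarrow> Transitive U \<and>
  (\<forall>a. a \<epsilon> U \<longrightarrow> (\<forall>R. Relation R a U \<and> (\<forall>x. x \<epsilon> a \<longrightarrow> (\<exists>y. y \<epsilon> U \<and> Rel R x y)) \<longrightarrow>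
    (\<exists>b. b \<epsilon> U \<and> (\<forall>x. x \<epsilon> a \<longrightarrow> (\<exists>y. y \<epsilon> b \<and> Rel R x y))
              \<and> (\<forall>y. y \<epsilon> b \<longrightarrow> (\<exists>x. x \<epsilon> a \<and> Rel R x y)))))"
definition "Union_closed U \<longleftrightarrow>
  (\<forall>x. x \<epsilon> U \<longrightarrow> (\<exists>u. u \<epsilon> U \<and> (\<forall>z. z \<epsilon> u \<longleftrightarrow> (\<exists>y. y \<epsilon> x \<and> z \<epsilon> y))))"
definition "Separative U \<longleftrightarrow> (\<forall>a. a \<epsilon> U \<longrightarrow> (\<forall>b. b \<epsilon> U \<longrightarrow>
  (\<exists>c. c \<epsilon> U \<and> (\<forall>x. x \<epsilon> c \<longleftrightarrow> Empty x \<and> Subset a b))))"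
definition "Rules R X \<longleftrightarrow> (\<forall>p. p \<epsilon> R \<longrightarrow> (\<exists>a b. Subset a X \<and> Subset b X \<and> Opair p a b))"
definition "Closed Y X R \<longleftrightarrow> Subset Y X \<and>
  (\<forall>a b. Rel R a b \<longrightarrow> Subset a Y \<longrightarrow> (\<exists>z. z \<epsilon> b \<and> z \<epsilon> Y))"

abbreviation holds :: "(nat \<Rightarrow> 'd) \<Rightarrow> fm \<Rightarrow> bool" where
  "holds \<equiv> sat (\<epsilon>)"

lemma holds_vocabulary [simp]:
  "holds e (is_subset x y) \<longleftrightarrow> Subset (e x) (e y)"
  "holds e (is_empty x) \<longleftrightarrow> Empty (e x)"
  "holds e (is_upair z x y) \<longleftrightarrow> Upair (e z) (e x) (e y)"
  by (simp_all add: is_subset_def Subset_def is_empty_def Empty_def is_upair_def Upair_def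
      iff_conv_conj_imp)

lemma holds_opair [simp]: "holds e (is_opair z x y) \<longleftrightarrow> Opair (e z) (e x) (e y)"
  by (simp add: is_opair_def Opair_def)

lemma holds_rel [simp]: "holds e (rel r x y) \<longleftrightarrow> Rel (e r) (e x) (e y)"
  by (simp add: rel_def Rel_def)

lemma holds_relation [simp]: "holds e (is_relation r x y) \<longleftrightarrow> Relation (e r) (e x) (e y)"
  by (simp add: is_relation_def Relation_def numeral_eq_Suc)

lemma holds_func [simp]: "holds e (is_func f x y) \<longleftrightarrow> Function (e f) (e x) (e y)"
  by (simp add: is_func_def Function_def numeral_eq_Suc)

lemma holds_surj [simp]: "holds e (is_surj f x y) \<longleftrightarrow> Surj (e f) (e x) (e y)"
  by (simp add: is_surj_def Surj_def)

lemma holds_comp [simp]: "holds e (is_comp r h t) \<longleftrightarrow> Comp (e r) (e h) (e t)"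
  by (simp add: is_comp_def Comp_def numeral_eq_Suc iff_conv_conj_imp)

lemma holds_base [simp]: "holds e (is_base p) \<longleftrightarrow> Base (e p)"
  by (simp add: is_base_def Base_def numeral_eq_Suc)

lemma holds_fibre [simp]: "holds e (is_fibre z f a) \<longleftrightarrow> Fibre (e z) (e f) (e a)"
  by (simp add: is_fibre_def Fibre_def iff_conv_conj_imp)

lemma holds_base_map [simp]: "holds e (is_base_map f B A) \<longleftrightarrow> Base_map (e f) (e B) (e A)"
  by (simp add: is_base_map_def Base_map_def)

lemma holds_fibre_map [simp]:
  "holds e (is_fibre_map t f a X) \<longleftrightarrow> Fibre_map (e t) (e f) (e a) (e X)"
  by (simp add: is_fibre_map_def Fibre_map_def)

lemma holds_functor_obj [simp]:
  "holds e (is_functor_obj z f A X) \<longleftrightarrow> Functor_obj (e z) (e f) (e A) (e X)"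
  by (simp add: is_functor_obj_def Functor_obj_def numeral_eq_Suc iff_conv_conj_imp)

lemma holds_algebra [simp]: "holds e (is_algebra X m f A) \<longleftrightarrow> Algebra (e X) (e m) (e f) (e A)"
  by (simp add: is_algebra_def Algebra_def)

lemma holds_app [simp]: "holds e (is_app m a t x) \<longleftrightarrow> App (e m) (e a) (e t) (e x)"
  by (simp add: is_app_def App_def)

lemma holds_morphism [simp]:
  "holds e (is_morphism h W s X m f A) \<longleftrightarrow>
     Morphism (e h) (e W) (e s) (e X) (e m) (e f) (e A)"
  by (simp add: is_morphism_def Morphism_def numeral_eq_Suc)

lemma holds_W_type [simp]: "holds e (is_W_type W s f A) \<longleftrightarrow> W_type (e W) (e s) (e f) (e A)"
  by (simp add: is_W_type_def W_type_def numeral_eq_Suc)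

lemma holds_total_family [simp]:
  "holds e (is_total_family R X f A) \<longleftrightarrow> Total_family (e R) (e X) (e f) (e A)"
  by (simp add: is_total_family_def Total_family_def numeral_eq_Suc)

lemma holds_chooses [simp]:
  "holds e (chooses h R W s f A) \<longleftrightarrow> Chooses (e h) (e R) (e W) (e s) (e f) (e A)"
  by (simp add: chooses_def Chooses_def numeral_eq_Suc)

lemma holds_regularity [simp]:
  "holds e (is_transitive U) \<longleftrightarrow> Transitive (e U)"
  "holds e (is_regular U) \<longleftrightarrow> Regular (e U)"
  "holds e (is_union_closed U) \<longleftrightarrow> Union_closed (e U)"
  "holds e (is_separative U) \<longleftrightarrow> Separative (e U)"
  by (simp_all add: is_transitive_def Transitive_def is_regular_def Regular_def
      is_union_closed_def Union_closed_def is_separative_def Separative_def numeral_eq_Suc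
      iff_conv_conj_imp)

lemma holds_rules [simp]:
  "holds e (are_rules R X) \<longleftrightarrow> Rules (e R) (e X)"
  "holds e (is_closed Y X R) \<longleftrightarrow> Closed (e Y) (e X) (e R)"
  by (simp_all add: are_rules_def Rules_def is_closed_def Closed_def numeral_eq_Suc)

lemma holds_PA: "holds e PA \<longleftrightarrow> (\<forall>X. \<exists>P f. Base P \<and> Surj f P X)"
  by (simp add: PA_def numeral_eq_Suc)

lemma holds_DC_for_W_types:
  "holds e DC_for_W_types \<longleftrightarrow> (\<forall>A B f. Base_map f B A \<longrightarrow>
     (\<exists>W s. W_type W s f A \<and>
       (\<forall>X R. Total_family R X f A \<longrightarrow> (\<exists>h. Function h W X \<and> Chooses h R W s f A))))"
  by (simp add: DC_for_W_types_def numeral_eq_Suc)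

lemma holds_usREA:
  "holds e usREA \<longleftrightarrow> (\<forall>x. \<exists>U. Subset x U \<and> Union_closed U \<and> Regular U \<and> Separative U)"
  by (simp add: usREA_def numeral_eq_Suc)

lemma holds_full_NID:
  "holds e full_NID \<longleftrightarrow> (\<forall>X R. Rules R X \<longrightarrow>
     (\<exists>G. (\<forall>\<beta>. \<beta> \<epsilon> G \<longrightarrow> Closed \<beta> X R) \<and>
       (\<forall>Y. Closed Y X R \<longrightarrow> (\<forall>y. y \<epsilon> Y \<longrightarrow> (\<exists>\<beta>. \<beta> \<epsilon> G \<and> y \<epsilon> \<beta> \<and> Subset \<beta> Y)))))"
  by (simp add: full_NID_def numeral_eq_Suc)

lemma holds_CZF_axioms:
  "holds e extensionality_ax \<longleftrightarrow> (\<forall>a b. (\<forall>x. x \<epsilon> a \<longleftrightarrow> x \<epsilon> b) \<longrightarrow> a = b)"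
  "holds e pairing_ax \<longleftrightarrow> (\<forall>a b. \<exists>c. Upair c a b)"
  "holds e union_ax \<longleftrightarrow> (\<forall>a. \<exists>b. \<forall>x. x \<epsilon> b \<longleftrightarrow> (\<exists>y. y \<epsilon> a \<and> x \<epsilon> y))"
  "holds e infinity_ax \<longleftrightarrow> (\<exists>w. \<forall>x. x \<epsilon> w \<longleftrightarrow>
     Empty x \<or> (\<exists>y. y \<epsilon> w \<and> (\<forall>z. z \<epsilon> x \<longleftrightarrow> z \<epsilon> y \<or> z = y)))"
  by (simp_all add: extensionality_ax_def pairing_ax_def union_ax_def infinity_ax_def
      numeral_eq_Suc iff_conv_conj_imp)

lemma holds_CZF_schemes:
  fixes e :: "nat \<Rightarrow> 'd" and \<phi> :: fm
  defines "\<phi>1 \<equiv> \<lambda>x. holds (case_nat x e) \<phi>"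
    and "\<phi>2 \<equiv> \<lambda>x y. holds (case_nat x (case_nat y e)) \<phi>"
    and "\<phi>3 \<equiv> \<lambda>x y u. holds (case_nat x (case_nat y (case_nat u e))) \<phi>"
  shows
  "holds e (separation_ax \<phi>) \<longleftrightarrow> (\<forall>a. \<exists>b. \<forall>x. x \<epsilon> b \<longleftrightarrow> x \<epsilon> a \<and> \<phi>1 x)"
  "holds e (strong_collection_ax \<phi>) \<longleftrightarrow> (\<forall>a. (\<forall>x. x \<epsilon> a \<longrightarrow> (\<exists>y. \<phi>2 x y)) \<longrightarrow>
     (\<exists>b. (\<forall>x. x \<epsilon> a \<longrightarrow> (\<exists>y. y \<epsilon> b \<and> \<phi>2 x y)) \<and>
          (\<forall>y. y \<epsilon> b \<longrightarrow> (\<exists>x. x \<epsilon> a \<and> \<phi>2 x y))))"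
  "holds e (subset_collection_ax \<phi>) \<longleftrightarrow> (\<forall>a b. \<exists>c. \<forall>u.
     (\<forall>x. x \<epsilon> a \<longrightarrow> (\<exists>y. y \<epsilon> b \<and> \<phi>3 x y u)) \<longrightarrow>
     (\<exists>d. d \<epsilon> c \<and> (\<forall>x. x \<epsilon> a \<longrightarrow> (\<exists>y. y \<epsilon> d \<and> \<phi>3 x y u)) \<and>
                  (\<forall>y. y \<epsilon> d \<longrightarrow> (\<exists>x. x \<epsilon> a \<and> \<phi>3 x y u))))"
  "holds e (set_induction_ax \<phi>) \<longleftrightarrow>
     ((\<forall>a. (\<forall>x. x \<epsilon> a \<longrightarrow> \<phi>1 x) \<longrightarrow> \<phi>1 a) \<longrightarrow> (\<forall>a. \<phi>1 a))"
  by (simp_all add: separation_ax_def strong_collection_ax_def subset_collection_ax_def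
      set_induction_ax_def \<phi>1_def \<phi>2_def \<phi>3_def numeral_eq_Suc iff_conv_conj_imp)

end

end

theory Submission
  imports Defs "HOL-Library.Countable"
begin

text \<open>
  Derivability is decided by the saturated theories extending a finite context (deductively closed,
  prime, with witnessing variables). At such a point conjunction, disjunction and existence are
  read classically, while an implication or a universal statement holds at a point iff its reading
  holds in a whole neighbourhood, so intuitionistic derivations become arguments about points.

  Let \<open>R\<close> be a set of rules on \<open>X\<close>. By \<open>PA\<close> there are a base \<open>A\<close> mapping onto \<open>R\<close> and, choosing over
  \<open>A\<close>, bases \<open>B\<^sub>\<alpha>\<close> covering the premises; this is a base map, with W-type \<open>W\<close>. Given a closed set
  \<open>Y\<close>, dependent choice yields \<open>h\<close> on \<open>W\<close> whose value at \<open>sup\<^sub>\<alpha> t\<close> meets the conclusion of the rule \<open>\<alpha>\<close>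
  as soon as the values of \<open>h \<circ> t\<close> cover its premise. As it is undecidable whether they do, the
  values of \<open>h\<close> are not elements but subsets of \<open>Y\<close> that belong to a regular set \<open>U\<close>; separativity
  and regularity provide one that is inhabited exactly when it has to be. Since \<open>B\<^sub>\<alpha>\<close> is a base,
  \<open>\<Union>ran h\<close> is closed, and it is contained in \<open>Y\<close>. By subset collection the sets \<open>\<Union>ran h\<close> range over
  a set independent of \<open>Y\<close>. Applying this to \<open>R\<close> with the extra rule \<open>(\<emptyset>, {y})\<close> for each \<open>y \<in> X\<close> gives
  the generating set.
\<close>

section \<open>Derivations and saturated theories\<close>

text \<open>The finite set \<open>H\<close> shapes every argument: \<open>forces_implI\<close> and
  \<open>forces_ForallI\<close> demand the claim at each point \<open>G\<close> with
  \<open>G ||= H\<close>, so all facts about fixed sets have to travel as formulas in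
  \<open>H\<close>. Hence each intermediate notion (a collected set, a choice function, a section,
  the choice clause of a W-type) is a formula with its own introduction and elimination rules, and
  membership facts are proved for all \<open>G\<close> with \<open>G ||= ?H\<close> before they are
  used. Finiteness of \<open>H\<close> also guarantees the fresh variables that serve as witnesses.

  On the set-theoretic side the obstacle is the lack of power sets. A closed \<open>Y\<close> is
  arbitrary, yet subset collection needs \<open>W\<close> and a bound for the values of
  \<open>h\<close> before \<open>Y\<close> is given. A single regular \<open>U\<close> containing
  all fibres, premises and conclusions solves this: the truth value of "the premise is covered" and
  the sets that it indexes are found in \<open>U\<close>, so the values of \<open>h\<close> are
  subsets of \<open>X\<close> lying in \<open>U\<close>, whatever \<open>Y\<close> is. Bases are
  used in two places: over \<open>A\<close>, to choose covers and rule relations, and over a fibre,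
  to choose the arguments in \<open>W\<close> whose values cover a premise.\<close>

lemma lift_comp [simp]: "lift f (lift g i) = lift (\<lambda>i. f (g i)) i"
  by (cases i) simp_all

lemma rename_rename [simp]: "rename f (rename g \<phi>) = rename (\<lambda>i. f (g i)) \<phi>"
  by (induction \<phi> arbitrary: f g) simp_all

lemma lift_id [simp]: "lift (\<lambda>i. i) = (\<lambda>i. i)"
  by (rule ext) (case_tac i; simp)

lemma rename_id [simp]: "rename (\<lambda>i. i) \<phi> = \<phi>"
  by (induction \<phi>) simp_all

lemma rename_inst: "rename f (inst t \<phi>) = inst (f t) (rename (lift f) \<phi>)"
  unfolding inst_def rename_rename
  by (rule arg_cong[where f = "\<lambda>g. rename g \<phi>"]) (auto split: nat.split)

text \<open>A formula has finitely many free variables, expressed through renamings so that no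
  free-variable function is needed. The bound may be kept unchanged under a quantifier, since
  agreement below \<open>n\<close> passes to the lifted renamings.\<close>

lemma rename_cong_below:
  "\<exists>n. \<forall>f g. (\<forall>i<n. f i = g i) \<longrightarrow> rename f \<phi> = rename g \<phi>"
proof (induction \<phi>)
  case (Mem x y)
  show ?case by (rule exI[of _ "Suc (max x y)"]) simp
next
  case (Equal x y)
  show ?case by (rule exI[of _ "Suc (max x y)"]) simp
next
  case (Conj \<phi> \<psi>)
  then obtain m n where "\<forall>f g. (\<forall>i<m. f i = g i) \<longrightarrow> rename f \<phi> = rename g \<phi>"
    "\<forall>f g. (\<forall>i<n. f i = g i) \<longrightarrow> rename f \<psi> = rename g \<psi>" by blast
  then show ?case by (intro exI[of _ "max m n"]) (simp only: rename.simps fm.inject less_max_iff_disj, blast)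
next
  case (Disj \<phi> \<psi>)
  then obtain m n where "\<forall>f g. (\<forall>i<m. f i = g i) \<longrightarrow> rename f \<phi> = rename g \<phi>"
    "\<forall>f g. (\<forall>i<n. f i = g i) \<longrightarrow> rename f \<psi> = rename g \<psi>" by blast
  then show ?case by (intro exI[of _ "max m n"]) (simp only: rename.simps fm.inject less_max_iff_disj, blast)
next
  case (Impl \<phi> \<psi>)
  then obtain m n where "\<forall>f g. (\<forall>i<m. f i = g i) \<longrightarrow> rename f \<phi> = rename g \<phi>"
    "\<forall>f g. (\<forall>i<n. f i = g i) \<longrightarrow> rename f \<psi> = rename g \<psi>" by blast
  then show ?case by (intro exI[of _ "max m n"]) (simp only: rename.simps fm.inject less_max_iff_disj, blast)
next
  case (Forall \<phi>)
  then obtain n where n: "\<And>f g. (\<forall>i<n. f i = g i) \<Longrightarrow> rename f \<phi> = rename g \<phi>" by blast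
  have "lift f i = lift g i" if "\<forall>i<n. f i = g i" "i < n" for f g i
    using that by (cases i) simp_all
  then show ?case by (intro exI[of _ n]) (simp, blast intro: n)
next
  case (Exists \<phi>)
  then obtain n where n: "\<And>f g. (\<forall>i<n. f i = g i) \<Longrightarrow> rename f \<phi> = rename g \<phi>" by blast
  have "lift f i = lift g i" if "\<forall>i<n. f i = g i" "i < n" for f g i
    using that by (cases i) simp_all
  then show ?case by (intro exI[of _ n]) (simp, blast intro: n)
qed simp

text \<open>Some bound for the free variables, not necessarily the least; it is only accessed
  through \<open>rename_cong\<close>.\<close>

definition vbound :: "fm \<Rightarrow> nat" where
  "vbound \<phi> = (SOME n. \<forall>f g. (\<forall>i<n. f i = g i) \<longrightarrow> rename f \<phi> = rename g \<phi>)"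

lemma rename_cong: "(\<And>i. i < vbound \<phi> \<Longrightarrow> f i = g i) \<Longrightarrow> rename f \<phi> = rename g \<phi>"
  using someI_ex[OF rename_cong_below[of \<phi>]] unfolding vbound_def by blast

section \<open>Structural properties of derivations\<close>

lemma deriv_mono: "deriv T \<Gamma> \<phi> \<Longrightarrow> \<Gamma> \<subseteq> \<Delta> \<Longrightarrow> deriv T \<Delta> \<phi>"
proof (induction arbitrary: \<Delta> rule: deriv.induct)
  case (disjE \<Gamma> \<phi> \<psi> \<chi>)
  then show ?case by (meson deriv.disjE insert_mono)
next
  case (implI \<phi> \<Gamma> \<psi>)
  then show ?case by (meson deriv.implI insert_mono)
next
  case (forallI \<Gamma> \<phi>)
  then show ?case by (meson deriv.forallI image_mono)
next
  case (existsE \<Gamma> \<phi> \<psi>)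
  then show ?case by (meson deriv.existsE image_mono insert_mono)
qed (blast intro: deriv.intros)+

text \<open>With an empty context the eigenvariable condition is void, so variable 0 can be
  generalised and then instantiated. Each of the \<open>n\<close> rounds lowers the remaining
  variables by one, whence \<open>i - n\<close>.\<close>

lemma deriv_instances:
  assumes "deriv T {} \<phi>"
  shows "deriv T {} (rename (\<lambda>i. if i < n then f i else i - n) \<phi>)"
  using assms
proof (induction n arbitrary: f \<phi>)
  case (Suc n)
  have "deriv T {} (Forall \<phi>)"
    using Suc.prems by (simp add: deriv.forallI)
  from Suc.IH[OF this, of "\<lambda>i. f (Suc i)"]
  have "deriv T {} (inst (f 0) (rename (lift (\<lambda>i. if i < n then f (Suc i) else i - n)) \<phi>))"
    by (auto intro: deriv.forallE)
  moreover have "inst (f 0) (rename (lift (\<lambda>i. if i < n then f (Suc i) else i - n)) \<phi>)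
      = rename (\<lambda>i. if i < Suc n then f i else i - Suc n) \<phi>"
    unfolding inst_def rename_rename
    by (rule arg_cong[where f = "\<lambda>g. rename g \<phi>"], rule ext, case_tac i) auto
  ultimately show ?case by simp
qed simp

text \<open>Taking \<open>n\<close> to be \<open>vbound\<close> makes the substitution of
  \<open>deriv_instances\<close> agree with \<open>f\<close> on every variable that occurs, so the
  lowering branch is never reached.\<close>

lemma deriv_rename_ax:
  assumes "\<phi> \<in> T"
  shows "deriv T \<Gamma> (rename f \<phi>)"
proof -
  have "deriv T {} (rename (\<lambda>i. if i < vbound \<phi> then f i else i - vbound \<phi>) \<phi>)"
    by (rule deriv_instances) (rule deriv.ax[OF assms])
  also have "rename (\<lambda>i. if i < vbound \<phi> then f i else i - vbound \<phi>) \<phi> = rename f \<phi>"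
    by (rule rename_cong) simp
  finally show ?thesis by (rule deriv_mono) simp
qed

text \<open>\<open>T\<close> is not assumed to be closed under renaming; its axioms are covered by
  \<open>deriv_rename_ax\<close>. The quantifier rules use the induction hypothesis for
  \<open>lift f\<close>.\<close>

lemma deriv_rename: "deriv T \<Gamma> \<phi> \<Longrightarrow> deriv T (rename f ` \<Gamma>) (rename f \<phi>)"
proof (induction arbitrary: f rule: deriv.induct)
  case (ax \<phi> \<Gamma>)
  then show ?case by (rule deriv_rename_ax)
next
  case (disjE \<Gamma> \<phi> \<psi> \<chi>)
  from disjE.IH[of f] show ?case
    by (simp, blast intro: deriv.disjE)
next
  case (forallI \<Gamma> \<phi>)
  from forallI.IH[of "lift f"] show ?case
    by (auto intro!: deriv.forallI simp: image_image)
next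
  case (forallE \<Gamma> \<phi> t)
  from forallE.IH[of f] show ?case
    by (simp add: rename_inst deriv.forallE)
next
  case (existsI \<Gamma> t \<phi>)
  from existsI.IH[of f] show ?case
    by (simp, metis rename_inst deriv.existsI)
next
  case (existsE \<Gamma> \<phi> \<psi>)
  show ?case
  proof (rule deriv.existsE)
    show "deriv T (rename f ` \<Gamma>) (Exists (rename (lift f) \<phi>))"
      using existsE.IH(1)[of f] by simp
    show "deriv T (insert (rename (lift f) \<phi>) (rename Suc ` rename f ` \<Gamma>))
        (rename Suc (rename f \<psi>))"
      using existsE.IH(2)[of "lift f"] by (simp add: image_image)
  qed
next
  case (equalE \<Gamma> s t \<phi>)
  from equalE.IH(1)[of f] equalE.IH(2)[of f] show ?case
    by (simp add: rename_inst deriv.equalE[of T _ "f s" "f t"])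
next
  case (implE \<Gamma> \<phi> \<psi>)
  from implE.IH[of f] show ?case by (simp, blast intro: deriv.implE)
next
  case (conjE1 \<Gamma> \<phi> \<psi>)
  from conjE1.IH[of f] show ?case by (simp, blast intro: deriv.conjE1)
next
  case (conjE2 \<Gamma> \<phi> \<psi>)
  from conjE2.IH[of f] show ?case by (simp, blast intro: deriv.conjE2)
next
  case (falsityE \<Gamma> \<phi>)
  from falsityE.IH[of f] show ?case by (simp add: deriv.falsityE)
qed (simp_all add: deriv.hyp deriv.conjI deriv.disjI1 deriv.disjI2 deriv.implI deriv.equalI)

text \<open>Compactness. In the rules that shift the context, a finite part of the shifted context
  is itself the shift of a finite part.\<close>

lemma deriv_finite: "deriv T \<Gamma> \<phi> \<Longrightarrow> \<exists>\<Delta>. finite \<Delta> \<and> \<Delta> \<subseteq> \<Gamma> \<and> deriv T \<Delta> \<phi>"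
proof (induction rule: deriv.induct)
  case (ax \<phi> \<Gamma>)
  then show ?case by (blast intro: deriv.ax)
next
  case (hyp \<phi> \<Gamma>)
  then show ?case by (intro exI[of _ "{\<phi>}"]) (simp add: deriv.hyp)
next
  case (conjI \<Gamma> \<phi> \<psi>)
  then obtain \<Delta>1 \<Delta>2 where "finite \<Delta>1" "\<Delta>1 \<subseteq> \<Gamma>" "deriv T \<Delta>1 \<phi>" "finite \<Delta>2" "\<Delta>2 \<subseteq> \<Gamma>" "deriv T \<Delta>2 \<psi>"
    by blast
  then show ?case
    by (intro exI[of _ "\<Delta>1 \<union> \<Delta>2"]) (auto intro: deriv.conjI deriv_mono)
next
  case (disjE \<Gamma> \<phi> \<psi> \<chi>)
  then obtain \<Delta>1 \<Delta>2 \<Delta>3 where *: "finite \<Delta>1" "\<Delta>1 \<subseteq> \<Gamma>" "deriv T \<Delta>1 (\<phi> \<^bold>\<or> \<psi>)"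
    "finite \<Delta>2" "\<Delta>2 \<subseteq> insert \<phi> \<Gamma>" "deriv T \<Delta>2 \<chi>" "finite \<Delta>3" "\<Delta>3 \<subseteq> insert \<psi> \<Gamma>" "deriv T \<Delta>3 \<chi>"
    by blast
  let ?\<Delta> = "\<Delta>1 \<union> (\<Delta>2 - {\<phi>}) \<union> (\<Delta>3 - {\<psi>})"
  have "deriv T ?\<Delta> \<chi>"
    by (rule deriv.disjE[of T _ \<phi> \<psi>]) (rule deriv_mono, rule *, blast)+
  then show ?case using * by (intro exI[of _ ?\<Delta>]) auto
next
  case (implI \<phi> \<Gamma> \<psi>)
  then obtain \<Delta> where *: "finite \<Delta>" "\<Delta> \<subseteq> insert \<phi> \<Gamma>" "deriv T \<Delta> \<psi>" by blast
  have "deriv T (insert \<phi> (\<Delta> - {\<phi>})) \<psi>" by (rule deriv_mono[OF *(3)]) blast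
  then show ?case using * by (intro exI[of _ "\<Delta> - {\<phi>}"]) (auto intro: deriv.implI)
next
  case (implE \<Gamma> \<phi> \<psi>)
  then obtain \<Delta>1 \<Delta>2 where "finite \<Delta>1" "\<Delta>1 \<subseteq> \<Gamma>" "deriv T \<Delta>1 (\<phi> \<^bold>\<longrightarrow> \<psi>)" "finite \<Delta>2" "\<Delta>2 \<subseteq> \<Gamma>" "deriv T \<Delta>2 \<phi>"
    by blast
  then show ?case
    by (intro exI[of _ "\<Delta>1 \<union> \<Delta>2"]) (auto intro: deriv.implE[of T _ \<phi>] deriv_mono)
next
  case (forallI \<Gamma> \<phi>)
  then obtain \<Delta> where *: "finite \<Delta>" "\<Delta> \<subseteq> rename Suc ` \<Gamma>" "deriv T \<Delta> \<phi>" by blast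
  then obtain \<Delta>' where "finite \<Delta>'" "\<Delta>' \<subseteq> \<Gamma>" "\<Delta> = rename Suc ` \<Delta>'"
    by (meson finite_subset_image)
  with * show ?case by (auto intro: deriv.forallI)
next
  case (existsE \<Gamma> \<phi> \<psi>)
  then obtain \<Delta>1 \<Delta>2 where *: "finite \<Delta>1" "\<Delta>1 \<subseteq> \<Gamma>" "deriv T \<Delta>1 (Exists \<phi>)"
    "finite \<Delta>2" "\<Delta>2 \<subseteq> insert \<phi> (rename Suc ` \<Gamma>)" "deriv T \<Delta>2 (rename Suc \<psi>)"
    by blast
  have "finite (\<Delta>2 - {\<phi>})" "\<Delta>2 - {\<phi>} \<subseteq> rename Suc ` \<Gamma>" using * by auto
  then obtain \<Delta>3 where **: "finite \<Delta>3" "\<Delta>3 \<subseteq> \<Gamma>" "\<Delta>2 - {\<phi>} = rename Suc ` \<Delta>3"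
    by (meson finite_subset_image)
  have "deriv T (\<Delta>1 \<union> \<Delta>3) \<psi>"
  proof (rule deriv.existsE)
    show "deriv T (\<Delta>1 \<union> \<Delta>3) (Exists \<phi>)" by (rule deriv_mono[OF *(3)]) blast
    have "\<Delta>2 \<subseteq> insert \<phi> (rename Suc ` (\<Delta>1 \<union> \<Delta>3))" using **(3) by auto
    with *(6) show "deriv T (insert \<phi> (rename Suc ` (\<Delta>1 \<union> \<Delta>3))) (rename Suc \<psi>)"
      by (rule deriv_mono)
  qed
  then show ?case using * ** by (intro exI[of _ "\<Delta>1 \<union> \<Delta>3"]) auto
next
  case (equalE \<Gamma> s t \<phi>)
  then obtain \<Delta>1 \<Delta>2 where "finite \<Delta>1" "\<Delta>1 \<subseteq> \<Gamma>" "deriv T \<Delta>1 (s \<^bold>= t)" "finite \<Delta>2" "\<Delta>2 \<subseteq> \<Gamma>" "deriv T \<Delta>2 (inst s \<phi>)"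
    by blast
  then show ?case
    by (intro exI[of _ "\<Delta>1 \<union> \<Delta>2"]) (auto intro: deriv.equalE deriv_mono)
qed (blast intro: deriv.intros)+

text \<open>The renaming turns the variable \<open>t\<close> into the variable about to be bound and
  makes room for it. For fresh \<open>t\<close> it undoes \<open>inst t\<close> (next lemma) and
  acts as the plain shift on everything else.\<close>

lemma rename_fresh:
  assumes "vbound \<phi> \<le> t"
  shows "rename (\<lambda>i. if i = t then 0 else Suc i) \<phi> = rename Suc \<phi>"
  using assms by (intro rename_cong) auto

lemma rename_fresh_inst:
  assumes "vbound \<phi> \<le> t"
  shows "rename (\<lambda>i. if i = t then 0 else Suc i) (inst t \<phi>) = \<phi>"
proof -
  have "rename (\<lambda>i. if case_nat t id i = t then 0 else Suc (case_nat t id i)) \<phi> = rename (\<lambda>i. i) \<phi>"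
    by (rule rename_cong) (use assms in \<open>auto split: nat.split\<close>)
  then show ?thesis by (simp add: inst_def)
qed

lemma ex_fresh: "finite \<Gamma> \<Longrightarrow> \<exists>t. \<forall>\<phi>\<in>\<Gamma>. vbound \<phi> \<le> t"
  by (metis bdd_above.E bdd_above_finite finite_imageI imageI)

text \<open>One instance with a fresh \<open>t\<close> is enough, and a finite context leaves one.
  Asking for all \<open>t\<close> gives the rule a shape that suits pointwise arguments, where no
  eigenvariable is singled out.\<close>

lemma deriv_forallI_all:
  assumes "finite \<Gamma>" and "\<And>t. deriv T \<Gamma> (inst t \<phi>)"
  shows "deriv T \<Gamma> (Forall \<phi>)"
proof -
  obtain t where t: "\<forall>\<psi>\<in>insert \<phi> \<Gamma>. vbound \<psi> \<le> t"
    using ex_fresh[of "insert \<phi> \<Gamma>"] assms(1) by auto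
  from deriv_rename[OF assms(2)[of t], of "\<lambda>i. if i = t then 0 else Suc i"]
  have "deriv T (rename (\<lambda>i. if i = t then 0 else Suc i) ` \<Gamma>) \<phi>"
    using t by (simp add: rename_fresh_inst)
  also have "rename (\<lambda>i. if i = t then 0 else Suc i) ` \<Gamma> = rename Suc ` \<Gamma>"
    using t by (intro image_cong refl) (simp add: rename_fresh)
  finally show ?thesis by (rule deriv.forallI)
qed

text \<open>The same device for existential elimination; read contrapositively, it finds a witness
  that keeps \<open>\<psi>\<close> underivable.\<close>

lemma deriv_existsE_all:
  assumes "finite \<Gamma>" and "deriv T \<Gamma> (Exists \<phi>)" and "\<And>t. deriv T (insert (inst t \<phi>) \<Gamma>) \<psi>"
  shows "deriv T \<Gamma> \<psi>"
proof -
  obtain t where t: "\<forall>\<chi>\<in>insert \<psi> (insert \<phi> \<Gamma>). vbound \<chi> \<le> t"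
    using ex_fresh[of "insert \<psi> (insert \<phi> \<Gamma>)"] assms(1) by auto
  from deriv_rename[OF assms(3)[of t], of "\<lambda>i. if i = t then 0 else Suc i"]
  have "deriv T (insert \<phi> (rename (\<lambda>i. if i = t then 0 else Suc i) ` \<Gamma>)) (rename Suc \<psi>)"
    using t by (simp add: rename_fresh_inst rename_fresh)
  also have "rename (\<lambda>i. if i = t then 0 else Suc i) ` \<Gamma> = rename Suc ` \<Gamma>"
    using t by (intro image_cong refl) (simp add: rename_fresh)
  finally show ?thesis using assms(2) by (rule deriv.existsE[rotated])
qed

section \<open>Saturated theories and completeness for finite contexts\<close>

definition saturated :: "fm set \<Rightarrow> fm set \<Rightarrow> bool" where
  "saturated T F \<longleftrightarrow> (\<forall>\<phi>. deriv T F \<phi> \<longrightarrow> \<phi> \<in> F) \<and>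
     (\<forall>\<phi> \<psi>. (\<phi> \<^bold>\<or> \<psi>) \<in> F \<longrightarrow> \<phi> \<in> F \<or> \<psi> \<in> F) \<and>
     (\<forall>\<phi>. Exists \<phi> \<in> F \<longrightarrow> (\<exists>t. inst t \<phi> \<in> F))"

instance fm :: countable
  by countable_datatype

context
  fixes T \<Gamma> :: "fm set" and \<chi> :: fm
begin

primrec henkin :: "nat \<Rightarrow> fm set" where
  "henkin 0 = \<Gamma>"
| "henkin (Suc n) = (let \<psi> = from_nat n in
     if deriv T (insert \<psi> (henkin n)) \<chi> then henkin n
     else case \<psi> of
       Exists \<phi> \<Rightarrow> insert (SOME \<theta>. (\<exists>t. \<theta> = inst t \<phi>) \<and>
           \<not> deriv T (insert \<theta> (insert \<psi> (henkin n))) \<chi>) (insert \<psi> (henkin n))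
     | _ \<Rightarrow> insert \<psi> (henkin n))"

text \<open>If every instance made \<open>\<chi>\<close> derivable, \<open>deriv_existsE_all\<close>
  would derive it from the existential formula alone; so the \<open>SOME\<close> is well
  defined.\<close>

lemma henkin_Exists:
  assumes "finite (henkin n)" "from_nat n = Exists \<phi>"
    "\<not> deriv T (insert (Exists \<phi>) (henkin n)) \<chi>"
  shows "\<exists>t. henkin (Suc n) = insert (inst t \<phi>) (insert (Exists \<phi>) (henkin n)) \<and>
    \<not> deriv T (henkin (Suc n)) \<chi>"
proof -
  let ?P = "\<lambda>\<theta>. (\<exists>t. \<theta> = inst t \<phi>) \<and>
    \<not> deriv T (insert \<theta> (insert (Exists \<phi>) (henkin n))) \<chi>"
  have "\<exists>\<theta>. ?P \<theta>"
    using deriv_existsE_all[of "insert (Exists \<phi>) (henkin n)" T \<phi> \<chi>] assms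
    by (auto intro: deriv.hyp)
  then have "?P (SOME \<theta>. ?P \<theta>)" by (rule someI_ex)
  then show ?thesis using assms by (auto simp: Let_def)
qed

lemma henkin_Suc:
  assumes "finite (henkin n)" "\<not> deriv T (henkin n) \<chi>"
  shows "finite (henkin (Suc n)) \<and> \<not> deriv T (henkin (Suc n)) \<chi> \<and> henkin n \<subseteq> henkin (Suc n)"
proof (cases "deriv T (insert (from_nat n) (henkin n)) \<chi>")
  case True
  then show ?thesis using assms by (simp add: Let_def)
next
  case False
  show ?thesis
  proof (cases "\<exists>\<phi>. from_nat n = Exists \<phi>")
    case True
    then obtain \<phi> where "from_nat n = Exists \<phi>" by blast
    with henkin_Exists[of n \<phi>] False assms show ?thesis by auto
  next
    case nex: False
    then have "henkin (Suc n) = insert (from_nat n) (henkin n)"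
      using False by (auto simp: Let_def split: fm.split)
    then show ?thesis using assms False by auto
  qed
qed

lemma ex_saturated:
  assumes "finite \<Gamma>" "\<not> deriv T \<Gamma> \<chi>"
  shows "\<exists>F. saturated T F \<and> \<Gamma> \<subseteq> F \<and> \<chi> \<notin> F"
proof -
  have h: "finite (henkin n) \<and> \<not> deriv T (henkin n) \<chi>" for n
    by (induction n) (use assms henkin_Suc in \<open>auto simp del: henkin.simps(2)\<close>)
  have mono: "henkin m \<subseteq> henkin n" if "m \<le> n" for m n
    using that by (rule lift_Suc_mono_le[rotated]) (use h henkin_Suc in blast)
  define F where "F = (\<Union>n. henkin n)"
  have sub: "\<exists>n. \<Delta> \<subseteq> henkin n" if "finite \<Delta>" "\<Delta> \<subseteq> F" for \<Delta>
    using that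
  proof (induction \<Delta>)
    case (insert \<phi> \<Delta>)
    then obtain n m where "\<Delta> \<subseteq> henkin n" "\<phi> \<in> henkin m" by (auto simp: F_def)
    then have "insert \<phi> \<Delta> \<subseteq> henkin (max m n)"
      using mono[of m "max m n"] mono[of n "max m n"] by auto
    then show ?case by blast
  qed simp
  have F: "\<not> deriv T F \<chi>"
  proof
    assume "deriv T F \<chi>"
    then obtain \<Delta> where \<Delta>: "finite \<Delta>" "\<Delta> \<subseteq> F" "deriv T \<Delta> \<chi>" using deriv_finite by meson
    from sub[OF \<Delta>(1,2)] obtain n where "\<Delta> \<subseteq> henkin n" by (rule exE)
    from deriv_mono[OF \<Delta>(3) this] show False using h by simp
  qed
  have stage: "\<psi> \<in> F" if "\<not> deriv T (insert \<psi> F) \<chi>" for \<psi>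
  proof -
    have "\<not> deriv T (insert \<psi> (henkin (to_nat \<psi>))) \<chi>"
      using that deriv_mono[of T "insert \<psi> (henkin (to_nat \<psi>))" \<chi> "insert \<psi> F"]
      by (auto simp: F_def)
    then have "\<psi> \<in> henkin (Suc (to_nat \<psi>))"
      by (auto simp: Let_def split: fm.split)
    then show ?thesis unfolding F_def by blast
  qed
  have cut: "deriv T F \<chi>" if "deriv T F \<psi>" "deriv T (insert \<psi> F) \<chi>" for \<psi>
    using that by (meson deriv.implE deriv.implI)
  \<comment> \<open>By \<open>stage\<close>, a formula outside \<open>F\<close> derives
    \<open>\<chi>\<close> together with \<open>F\<close>. Deductive closure follows by
    \<open>cut\<close>, and primeness because two such formulas would yield \<open>\<chi>\<close> by
    disjunction elimination.\<close>
  have "saturated T F"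
    unfolding saturated_def
  proof (intro HOL.conjI allI impI)
    fix \<phi> assume "deriv T F \<phi>"
    then show "\<phi> \<in> F" using cut stage F by metis
  next
    fix \<phi> \<psi> assume "(\<phi> \<^bold>\<or> \<psi>) \<in> F"
    then show "\<phi> \<in> F \<or> \<psi> \<in> F"
      using stage F deriv.disjE[of T F \<phi> \<psi> \<chi>] deriv.hyp by metis
  next
    fix \<phi> assume *: "Exists \<phi> \<in> F"
    let ?n = "to_nat (Exists \<phi>)"
    have "insert (Exists \<phi>) (henkin ?n) \<subseteq> F" using * by (auto simp: F_def)
    then have "\<not> deriv T (insert (Exists \<phi>) (henkin ?n)) \<chi>" using F deriv_mono by metis
    then obtain t where "inst t \<phi> \<in> henkin (Suc ?n)"
      using henkin_Exists[of ?n \<phi>] h by auto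
    then show "\<exists>t. inst t \<phi> \<in> F" unfolding F_def by blast
  qed
  moreover have "\<Gamma> \<subseteq> F" unfolding F_def using henkin.simps(1) by blast
  moreover have "\<chi> \<notin> F" using F deriv.hyp by metis
  ultimately show ?thesis by blast
qed

end

text \<open>The converse direction of soundness is \<open>ex_saturated\<close>; finiteness of the
  context is what leaves room for the Henkin witnesses.\<close>

lemma deriv_iff_saturated:
  assumes "finite \<Gamma>"
  shows "deriv T \<Gamma> \<phi> \<longleftrightarrow> (\<forall>F. saturated T F \<longrightarrow> \<Gamma> \<subseteq> F \<longrightarrow> \<phi> \<in> F)"
  using ex_saturated[OF assms, of T \<phi>] deriv_mono[of T \<Gamma> \<phi>] unfolding saturated_def by metis

section \<open>Forcing at the points\<close>

definition ZT :: "fm set" where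
  "ZT = CZF \<union> {DC_for_W_types, PA, usREA}"

text \<open>
  The inconsistent theory is admitted as a point, so no consistency assumption enters.
\<close>

typedef point = "{F. saturated ZT F}"
proof
  show "UNIV \<in> {F. saturated ZT F}" by (simp add: saturated_def)
qed

definition forces :: "point \<Rightarrow> fm \<Rightarrow> bool"  (infix \<open>|=\<close> 52) where
  "F |= \<phi> \<longleftrightarrow> \<phi> \<in> Rep_point F"

abbreviation forces_all :: "point \<Rightarrow> fm set \<Rightarrow> bool"  (infix \<open>||=\<close> 52) where
  "F ||= H \<equiv> \<forall>h\<in>H. F |= h"

lemma deriv_iff_forces:
  assumes "finite H"
  shows "deriv ZT H \<phi> \<longleftrightarrow> (\<forall>F. (F ||= H) \<longrightarrow> F |= \<phi>)"
  unfolding deriv_iff_saturated[OF assms] forces_def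
  by (metis Abs_point_inverse Rep_point mem_Collect_eq subset_iff)

lemma forces_deriv: "deriv ZT H \<phi> \<Longrightarrow> F ||= H \<Longrightarrow> F |= \<phi>"
  using Rep_point[of F] deriv_mono[of ZT H \<phi> "Rep_point F"]
  unfolding forces_def saturated_def by blast

lemma forces_conj [simp]: "F |= (\<phi> \<^bold>\<and> \<psi>) \<longleftrightarrow> F |= \<phi> \<and> F |= \<psi>"
  using forces_deriv[of "{\<phi> \<^bold>\<and> \<psi>}" \<phi> F] forces_deriv[of "{\<phi> \<^bold>\<and> \<psi>}" \<psi> F]
    forces_deriv[of "{\<phi>, \<psi>}" "\<phi> \<^bold>\<and> \<psi>" F]
  by (auto intro: deriv.conjE1[of _ _ \<phi> \<psi>] deriv.conjE2[of _ _ \<phi> \<psi>] deriv.conjI deriv.hyp)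

lemma forces_disj [simp]: "F |= (\<phi> \<^bold>\<or> \<psi>) \<longleftrightarrow> F |= \<phi> \<or> F |= \<psi>"
  using Rep_point[of F] forces_deriv[of "{\<phi>}" "\<phi> \<^bold>\<or> \<psi>" F] forces_deriv[of "{\<psi>}" "\<phi> \<^bold>\<or> \<psi>" F]
  by (auto simp: forces_def saturated_def deriv.disjI1 deriv.disjI2 deriv.hyp)

lemma forces_Exists [simp]: "F |= Exists \<phi> \<longleftrightarrow> (\<exists>t. F |= inst t \<phi>)"
proof
  show "F |= Exists \<phi> \<Longrightarrow> \<exists>t. F |= inst t \<phi>"
    using Rep_point[of F] by (simp add: forces_def saturated_def)
  assume "\<exists>t. F |= inst t \<phi>"
  then obtain t where "F |= inst t \<phi>" by blast
  then show "F |= Exists \<phi>"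
    using forces_deriv[of "{inst t \<phi>}" "Exists \<phi>" F] deriv.existsI[of ZT "{inst t \<phi>}" t \<phi>]
    by (simp add: deriv.hyp)
qed

lemma forces_refl [simp]: "F |= (x \<^bold>= x)"
  using forces_deriv[of "{}"] deriv.equalI by simp

lemma forces_falsityD: "F |= \<^bold>\<bottom> \<Longrightarrow> F |= \<phi>"
  using forces_deriv[of "{\<^bold>\<bottom>}" \<phi> F] by (simp add: deriv.falsityE deriv.hyp)

lemma forces_mp: "F |= (\<phi> \<^bold>\<longrightarrow> \<psi>) \<Longrightarrow> F |= \<phi> \<Longrightarrow> F |= \<psi>"
  using forces_deriv[of "{\<phi> \<^bold>\<longrightarrow> \<psi>, \<phi>}" \<psi> F] deriv.implE[of ZT "{\<phi> \<^bold>\<longrightarrow> \<psi>, \<phi>}" \<phi> \<psi>]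
  by (simp add: deriv.hyp)

lemma forces_spec: "F |= Forall \<phi> \<Longrightarrow> F |= inst t \<phi>"
  using forces_deriv[of "{Forall \<phi>}" "inst t \<phi>" F] deriv.forallE[of ZT "{Forall \<phi>}" \<phi> t]
  by (simp add: deriv.hyp)

lemma forces_subst: "F |= (s \<^bold>= t) \<Longrightarrow> F |= inst s \<phi> \<Longrightarrow> F |= inst t \<phi>"
  using forces_deriv[of "{s \<^bold>= t, inst s \<phi>}" "inst t \<phi>" F]
    deriv.equalE[of ZT "{s \<^bold>= t, inst s \<phi>}" s t \<phi>]
  by (simp add: deriv.hyp)

lemma forces_ax: "\<phi> \<in> ZT \<Longrightarrow> F |= rename f \<phi>"
  using forces_deriv[of "{}" "rename f \<phi>" F] deriv_rename_ax[of \<phi> ZT] by simp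

text \<open>
  An implication or a universal statement holds at \<open>F\<close> if its pointwise reading holds throughout
  a neighbourhood of \<open>F\<close>, which is given by the finitely many formulas \<open>H\<close> forced at \<open>F\<close>.
\<close>

lemma forces_implI:
  assumes "finite H" "F ||= H" "\<And>G. G ||= H \<Longrightarrow> G |= \<phi> \<Longrightarrow> G |= \<psi>"
  shows "F |= (\<phi> \<^bold>\<longrightarrow> \<psi>)"
proof -
  have "deriv ZT (insert \<phi> H) \<psi>" using assms by (simp add: deriv_iff_forces)
  then show ?thesis using forces_deriv assms(2) deriv.implI by blast
qed

lemma forces_ForallI:
  assumes "finite H" "F ||= H" "\<And>G t. G ||= H \<Longrightarrow> G |= inst t \<phi>"
  shows "F |= Forall \<phi>"
proof -
  have "deriv ZT H (inst t \<phi>)" for t using assms by (simp add: deriv_iff_forces)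
  then have "deriv ZT H (Forall \<phi>)" using assms(1) deriv_forallI_all by blast
  then show ?thesis using forces_deriv assms(2) by blast
qed

lemma provable_iff_forces: "(ZT \<turnstile> \<phi>) \<longleftrightarrow> (\<forall>F. F |= \<phi>)"
  by (simp add: deriv_iff_forces)

text \<open>Normal forms for compositions of substitutions: every composite is pushed into a
  \<open>case_nat\<close>, so that instantiating a defined formula becomes a computation of the
  simplifier.\<close>

lemma lift_case [simp]:
  "(\<lambda>i. case_nat t f (lift g i)) = case_nat t (\<lambda>i. f (g i))"
  "(\<lambda>i. case_nat t f (case_nat s g i)) = case_nat (case_nat t f s) (\<lambda>i. case_nat t f (g i))"
  "(\<lambda>i. lift f (case_nat s g i)) = case_nat (lift f s) (\<lambda>i. lift f (g i))"
  "(\<lambda>i. Suc (case_nat s g i)) = case_nat (Suc s) (\<lambda>i. Suc (g i))"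
  "(\<lambda>i. case_nat t f (lift g (lift h i))) = case_nat t (\<lambda>i. f (g (h i)))"
  "(\<lambda>i. case_nat t f (lift g (case_nat s h i)))
     = case_nat (case_nat t f (lift g s)) (\<lambda>i. case_nat t f (lift g (h i)))"
  by (rule ext, simp split: nat.split)+

lemma inst_eq_rename [simp]: "inst t \<phi> = rename (case_nat t (\<lambda>i. i)) \<phi>"
  by (simp add: inst_def id_def)

text \<open>Convention for binary formulas from here on: the argument \<open>x\<close> has index 1
  and the value \<open>y\<close> index 0, as beneath two quantifiers binding \<open>x\<close> and
  then \<open>y\<close>.\<close>

abbreviation inst2 :: "nat \<Rightarrow> nat \<Rightarrow> fm \<Rightarrow> fm" where
  "inst2 x y \<psi> \<equiv> rename (case_nat y (case_nat x (\<lambda>i. i))) \<psi>"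

lemma forces_BForallI:
  assumes "finite H" "F ||= H"
    "\<And>G x. G ||= H \<Longrightarrow> G |= (x \<^bold>\<in> a) \<Longrightarrow> G |= inst x \<phi>"
  shows "F |= BForall a \<phi>"
  using assms(1,2)
proof (rule forces_ForallI)
  fix G t assume "G ||= H"
  with assms(1) show "G |= inst t (0 \<^bold>\<in> Suc a \<^bold>\<longrightarrow> \<phi>)"
    using assms(3) by (simp, intro forces_implI[of H]) simp_all
qed

lemma forces_BForallD: "F |= BForall a \<phi> \<Longrightarrow> F |= (x \<^bold>\<in> a) \<Longrightarrow> F |= inst x \<phi>"
  using forces_spec[of F "0 \<^bold>\<in> Suc a \<^bold>\<longrightarrow> \<phi>" x] forces_mp by simp

lemma forces_IffI:
  assumes "finite H" "F ||= H" "\<And>G. G ||= H \<Longrightarrow> G |= \<phi> \<longleftrightarrow> G |= \<psi>"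
  shows "F |= (\<phi> \<^bold>\<longleftrightarrow> \<psi>)"
  using assms by (simp, intro HOL.conjI forces_implI[of H]) simp_all

lemma forces_IffD: "F |= (\<phi> \<^bold>\<longleftrightarrow> \<psi>) \<Longrightarrow> F |= \<phi> \<longleftrightarrow> F |= \<psi>"
  using forces_mp by auto

definition is_set :: "nat \<Rightarrow> fm \<Rightarrow> fm" where
  "is_set b \<phi> = Forall (0 \<^bold>\<in> Suc b \<^bold>\<longleftrightarrow> \<phi>)"

lemma rename_is_set [simp]: "rename f (is_set b \<phi>) = is_set (f b) (rename (lift f) \<phi>)"
  by (simp add: is_set_def)

lemma forces_is_setI:
  assumes "finite H" "F ||= H" "\<And>G x. G ||= H \<Longrightarrow> G |= (x \<^bold>\<in> b) \<longleftrightarrow> G |= inst x \<phi>"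
  shows "F |= is_set b \<phi>"
  unfolding is_set_def
proof (rule forces_ForallI[OF assms(1,2)])
  fix G t assume "G ||= H"
  then have "G |= ((t \<^bold>\<in> b) \<^bold>\<longleftrightarrow> inst t \<phi>)" using assms by (intro forces_IffI[of H])
  then show "G |= inst t (0 \<^bold>\<in> Suc b \<^bold>\<longleftrightarrow> \<phi>)" by simp
qed

lemma forces_is_setD: "F |= is_set b \<phi> \<Longrightarrow> F |= (x \<^bold>\<in> b) \<longleftrightarrow> F |= inst x \<phi>"
  using forces_spec[of F "0 \<^bold>\<in> Suc b \<^bold>\<longleftrightarrow> \<phi>" x] forces_IffD[of F "x \<^bold>\<in> b"] by (simp add: is_set_def)

section \<open>Renaming commutes with the vocabulary\<close>

lemma rename_vocabulary [simp]:
  "rename f (is_subset x y) = is_subset (f x) (f y)"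
  "rename f (is_empty x) = is_empty (f x)"
  "rename f (is_upair z x y) = is_upair (f z) (f x) (f y)"
  by (simp_all add: is_subset_def is_empty_def is_upair_def)

lemma rename_opair [simp]: "rename f (is_opair z x y) = is_opair (f z) (f x) (f y)"
  by (simp add: is_opair_def)

lemma rename_rel [simp]: "rename f (rel r x y) = rel (f r) (f x) (f y)"
  by (simp add: rel_def)

lemma rename_relation [simp]: "rename f (is_relation r x y) = is_relation (f r) (f x) (f y)"
  by (simp add: is_relation_def numeral_eq_Suc)

lemma rename_func [simp]: "rename f (is_func g x y) = is_func (f g) (f x) (f y)"
  by (simp add: is_func_def numeral_eq_Suc)

lemma rename_surj [simp]: "rename f (is_surj g x y) = is_surj (f g) (f x) (f y)"
  by (simp add: is_surj_def numeral_eq_Suc)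

lemma rename_comp [simp]: "rename f (is_comp r h t) = is_comp (f r) (f h) (f t)"
  by (simp add: is_comp_def numeral_eq_Suc)

lemma rename_base [simp]: "rename f (is_base p) = is_base (f p)"
  by (simp add: is_base_def numeral_eq_Suc)

lemma rename_fibre [simp]: "rename f (is_fibre z g a) = is_fibre (f z) (f g) (f a)"
  by (simp add: is_fibre_def numeral_eq_Suc)

lemma rename_base_map [simp]: "rename f (is_base_map g B A) = is_base_map (f g) (f B) (f A)"
  by (simp add: is_base_map_def numeral_eq_Suc)

lemma rename_fibre_map [simp]:
  "rename f (is_fibre_map t g a X) = is_fibre_map (f t) (f g) (f a) (f X)"
  by (simp add: is_fibre_map_def numeral_eq_Suc)

lemma rename_functor_obj [simp]:
  "rename f (is_functor_obj z g A X) = is_functor_obj (f z) (f g) (f A) (f X)"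
  by (simp add: is_functor_obj_def numeral_eq_Suc)

lemma rename_algebra [simp]:
  "rename f (is_algebra X m g A) = is_algebra (f X) (f m) (f g) (f A)"
  by (simp add: is_algebra_def numeral_eq_Suc)

lemma rename_app [simp]: "rename f (is_app m a t x) = is_app (f m) (f a) (f t) (f x)"
  by (simp add: is_app_def numeral_eq_Suc)

lemma rename_morphism [simp]:
  "rename f (is_morphism h W s X m g A) = is_morphism (f h) (f W) (f s) (f X) (f m) (f g) (f A)"
  by (simp add: is_morphism_def numeral_eq_Suc)

lemma rename_W_type [simp]: "rename f (is_W_type W s g A) = is_W_type (f W) (f s) (f g) (f A)"
  by (simp add: is_W_type_def numeral_eq_Suc)

lemma rename_total_family [simp]:
  "rename f (is_total_family R X g A) = is_total_family (f R) (f X) (f g) (f A)"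
  by (simp add: is_total_family_def numeral_eq_Suc)

lemma rename_chooses [simp]:
  "rename f (chooses h R W s g A) = chooses (f h) (f R) (f W) (f s) (f g) (f A)"
  by (simp add: chooses_def numeral_eq_Suc)

lemma rename_regularity [simp]:
  "rename f (is_transitive U) = is_transitive (f U)"
  "rename f (is_regular U) = is_regular (f U)"
  "rename f (is_union_closed U) = is_union_closed (f U)"
  "rename f (is_separative U) = is_separative (f U)"
  by (simp_all add: is_transitive_def is_regular_def is_union_closed_def is_separative_def
      numeral_eq_Suc)

lemma rename_rules [simp]:
  "rename f (are_rules R X) = are_rules (f R) (f X)"
  "rename f (is_closed Y X R) = is_closed (f Y) (f X) (f R)"
  by (simp_all add: are_rules_def is_closed_def numeral_eq_Suc)

section \<open>Elementary set theory\<close>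

lemma case_nat_0_Suc [simp]: "case_nat 0 Suc = (\<lambda>i. i)"
  by (rule ext) (simp split: nat.split)

lemma forces_spec2: "F |= Forall (Forall \<phi>) \<Longrightarrow> F |= inst2 x y \<phi>"
  using forces_spec[of F "Forall \<phi>" x] forces_spec[of F "rename (lift (case_nat x (\<lambda>i. i))) \<phi>" y] by simp

lemma forces_subsetI:
  assumes "finite H" "F ||= H"
    "\<And>G z. G ||= H \<Longrightarrow> G |= (z \<^bold>\<in> x) \<Longrightarrow> G |= (z \<^bold>\<in> y)"
  shows "F |= is_subset x y"
  unfolding is_subset_def by (rule forces_BForallI[OF assms(1,2)]) (simp add: assms(3))

lemma forces_subsetD: "F |= is_subset x y \<Longrightarrow> F |= (z \<^bold>\<in> x) \<Longrightarrow> F |= (z \<^bold>\<in> y)"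
  unfolding is_subset_def using forces_BForallD by fastforce

lemma forces_set_eqI:
  assumes "finite H" "F ||= H"
    "\<And>G x. G ||= H \<Longrightarrow> G |= (x \<^bold>\<in> a) \<longleftrightarrow> G |= (x \<^bold>\<in> b)"
  shows "F |= (a \<^bold>= b)"
proof -
  have "F |= extensionality_ax"
    using forces_ax[of extensionality_ax F "\<lambda>i. i"] by (simp add: ZT_def CZF_def)
  then have "F |= (Forall (0 \<^bold>\<in> Suc a \<^bold>\<longleftrightarrow> 0 \<^bold>\<in> Suc b) \<^bold>\<longrightarrow> a \<^bold>= b)"
    unfolding extensionality_ax_def by - (drule forces_spec2[where x = a and y = b], simp add: numeral_eq_Suc)
  moreover have "F |= is_set a (0 \<^bold>\<in> Suc b)"
    using assms by (intro forces_is_setI[of H]) simp_all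
  ultimately show ?thesis using forces_mp by (simp add: is_set_def)
qed

lemma forces_sym: "F |= (x \<^bold>= y) \<Longrightarrow> F |= (y \<^bold>= x)"
  using forces_subst[of F x y "0 \<^bold>= Suc x"] by simp

lemma forces_trans: "F |= (x \<^bold>= y) \<Longrightarrow> F |= (y \<^bold>= z) \<Longrightarrow> F |= (x \<^bold>= z)"
  using forces_subst[of F y z "Suc x \<^bold>= 0"] by simp

lemma forces_mem_cong:
  assumes "F |= (x \<^bold>= x')" "F |= (a \<^bold>= a')" "F |= (x \<^bold>\<in> a)"
  shows "F |= (x' \<^bold>\<in> a')"
  using forces_subst[OF assms(1), of "0 \<^bold>\<in> Suc a"] forces_subst[OF assms(2), of "Suc x' \<^bold>\<in> 0"]
    assms(3) by simp

lemma forces_upair_ex: "\<exists>c. F |= is_upair c a b"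
proof -
  have "F |= pairing_ax"
    using forces_ax[of pairing_ax F "\<lambda>i. i"] by (simp add: ZT_def CZF_def)
  then show ?thesis unfolding pairing_ax_def
    by - (drule forces_spec2[where x = a and y = b], simp add: numeral_eq_Suc)
qed

lemma forces_upairD: "F |= is_upair z x y \<Longrightarrow> F |= (w \<^bold>\<in> z) \<longleftrightarrow> F |= (w \<^bold>= x) \<or> F |= (w \<^bold>= y)"
  using forces_is_setD[of F z "0 \<^bold>= Suc x \<^bold>\<or> 0 \<^bold>= Suc y" w]
  by (simp add: is_upair_def is_set_def)

lemma forces_upairI:
  assumes "finite H" "F ||= H"
    "\<And>G w. G ||= H \<Longrightarrow> G |= (w \<^bold>\<in> z) \<longleftrightarrow> G |= (w \<^bold>= x) \<or> G |= (w \<^bold>= y)"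
  shows "F |= is_upair z x y"
  using forces_is_setI[OF assms(1,2), of z "0 \<^bold>= Suc x \<^bold>\<or> 0 \<^bold>= Suc y"] assms(3)
  by (simp add: is_upair_def is_set_def)

lemma forces_upair_unique:
  assumes "F |= is_upair z x y" "F |= is_upair z' x y"
  shows "F |= (z \<^bold>= z')"
  by (rule forces_set_eqI[of "{is_upair z x y, is_upair z' x y}"]) (auto simp: assms forces_upairD)

lemma forces_upair_cong:
  assumes "F |= is_upair z x y" "F |= (z \<^bold>= z')" "F |= (x \<^bold>= x')" "F |= (y \<^bold>= y')"
  shows "F |= is_upair z' x' y'"
  using forces_subst[OF assms(2), of "is_upair 0 (Suc x) (Suc y)"]
    forces_subst[OF assms(3), of "is_upair (Suc z') 0 (Suc y)"]
    forces_subst[OF assms(4), of "is_upair (Suc z') (Suc x') 0"] assms(1) by simp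

lemma forces_opair_iff:
  "F |= is_opair z x y \<longleftrightarrow>
     (\<exists>u v. F |= is_upair u x x \<and> F |= is_upair v x y \<and> F |= is_upair z u v)"
  by (simp add: is_opair_def)

lemma forces_opair_ex: "\<exists>c. F |= is_opair c a b"
  using forces_upair_ex unfolding forces_opair_iff by meson

lemma forces_opair_cong:
  assumes "F |= is_opair z x y" "F |= (z \<^bold>= z')" "F |= (x \<^bold>= x')" "F |= (y \<^bold>= y')"
  shows "F |= is_opair z' x' y'"
  using forces_subst[OF assms(2), of "is_opair 0 (Suc x) (Suc y)"]
    forces_subst[OF assms(3), of "is_opair (Suc z') 0 (Suc y)"]
    forces_subst[OF assms(4), of "is_opair (Suc z') (Suc x') 0"] assms(1) by simp

lemma forces_opair_unique:
  assumes "F |= is_opair z x y" "F |= is_opair z' x y"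
  shows "F |= (z \<^bold>= z')"
  using assms unfolding forces_opair_iff
  by (meson forces_refl forces_upair_cong forces_upair_unique)

text \<open>A point decides the disjunctions that come from unordered pairs, so the classical case
  analysis for Kuratowski pairs is available although equality is not decidable in the
  theory.\<close>

lemma forces_opair_inject:
  assumes "F |= is_opair z x y" "F |= is_opair z x' y'"
  shows "F |= (x \<^bold>= x')" "F |= (y \<^bold>= y')"
proof -
  obtain u v where z: "F |= is_upair u x x" "F |= is_upair v x y" "F |= is_upair z u v"
    using assms(1) unfolding forces_opair_iff by blast
  obtain u' v' where z': "F |= is_upair u' x' x'" "F |= is_upair v' x' y'" "F |= is_upair z u' v'"
    using assms(2) unfolding forces_opair_iff by blast
  note mem = z[THEN forces_upairD] z'[THEN forces_upairD]
  have "F |= (u' \<^bold>= u) \<or> F |= (u' \<^bold>= v)" "F |= (v' \<^bold>= u) \<or> F |= (v' \<^bold>= v)"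
    "F |= (v \<^bold>= u') \<or> F |= (v \<^bold>= v')"
    using mem(3,6) forces_refl by blast+
  note eqs = this
  show x: "F |= (x \<^bold>= x')"
    using eqs(1) mem(1,2,4) by (meson forces_mem_cong forces_refl forces_sym)
  show "F |= (y \<^bold>= y')"
    using eqs(2,3) mem(1,2,4,5) x by (meson forces_mem_cong forces_refl forces_sym forces_trans)
qed

lemma forces_rel_iff: "F |= rel r x y \<longleftrightarrow> (\<exists>p. F |= (p \<^bold>\<in> r) \<and> F |= is_opair p x y)"
  by (simp add: rel_def)

lemma forces_rel_cong:
  assumes "F |= rel r x y" "F |= (x \<^bold>= x')" "F |= (y \<^bold>= y')"
  shows "F |= rel r x' y'"
  using assms unfolding forces_rel_iff by (meson forces_opair_cong forces_refl)

section \<open>Restricted formulas and separation\<close>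

lemma forces_Forall_mono:
  assumes "F |= Forall \<phi>" "\<And>G t. G |= inst t \<phi> \<Longrightarrow> G |= inst t \<psi>"
  shows "F |= Forall \<psi>"
  using assms by (intro forces_ForallI[of "{Forall \<phi>}"]) (blast intro: forces_spec)+

lemma forces_impl_mono:
  assumes "F |= (\<phi> \<^bold>\<longrightarrow> \<psi>)" "\<And>G. G |= \<phi>' \<Longrightarrow> G |= \<phi>" "\<And>G. G |= \<psi> \<Longrightarrow> G |= \<psi>'"
  shows "F |= (\<phi>' \<^bold>\<longrightarrow> \<psi>')"
  using assms by (intro forces_implI[of "{\<phi> \<^bold>\<longrightarrow> \<psi>}"]) (auto intro: forces_mp)

text \<open>The vocabulary is not literally bounded: \<open>is_upair\<close> and
  \<open>is_opair\<close> quantify over all sets. Equivalence to a bounded formula suffices for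
  separation; it is required at all points and under all renamings in order to persist below
  implications and quantifiers.\<close>

definition restricted :: "fm \<Rightarrow> bool" where
  "restricted \<phi> \<longleftrightarrow> (\<exists>\<psi>. bounded_fm \<psi> \<and> (\<forall>F f. F |= rename f \<phi> \<longleftrightarrow> F |= rename f \<psi>))"

lemma restricted_bounded: "bounded_fm \<phi> \<Longrightarrow> restricted \<phi>"
  unfolding restricted_def by blast

lemma restricted_cong:
  "restricted \<psi> \<Longrightarrow> (\<And>F f. F |= rename f \<phi> \<longleftrightarrow> F |= rename f \<psi>) \<Longrightarrow> restricted \<phi>"
  unfolding restricted_def by simp

lemma restricted_atoms: "restricted (x \<^bold>\<in> y)" "restricted (x \<^bold>= y)" "restricted \<^bold>\<bottom>"
  by (simp_all add: restricted_bounded bounded_fm.intros)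

lemma restricted_conj: "restricted \<phi> \<Longrightarrow> restricted \<psi> \<Longrightarrow> restricted (\<phi> \<^bold>\<and> \<psi>)"
proof -
  assume "restricted \<phi>" "restricted \<psi>"
  then obtain \<phi>' \<psi>' where "bounded_fm \<phi>'" "\<forall>F f. F |= rename f \<phi> \<longleftrightarrow> F |= rename f \<phi>'"
    "bounded_fm \<psi>'" "\<forall>F f. F |= rename f \<psi> \<longleftrightarrow> F |= rename f \<psi>'"
    unfolding restricted_def by blast
  then show ?thesis unfolding restricted_def
    by (intro exI[of _ "\<phi>' \<^bold>\<and> \<psi>'"]) (simp add: bounded_fm.intros)
qed

lemma restricted_disj: "restricted \<phi> \<Longrightarrow> restricted \<psi> \<Longrightarrow> restricted (\<phi> \<^bold>\<or> \<psi>)"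
proof -
  assume "restricted \<phi>" "restricted \<psi>"
  then obtain \<phi>' \<psi>' where "bounded_fm \<phi>'" "\<forall>F f. F |= rename f \<phi> \<longleftrightarrow> F |= rename f \<phi>'"
    "bounded_fm \<psi>'" "\<forall>F f. F |= rename f \<psi> \<longleftrightarrow> F |= rename f \<psi>'"
    unfolding restricted_def by blast
  then show ?thesis unfolding restricted_def
    by (intro exI[of _ "\<phi>' \<^bold>\<or> \<psi>'"]) (simp add: bounded_fm.intros)
qed

lemma restricted_impl: "restricted \<phi> \<Longrightarrow> restricted \<psi> \<Longrightarrow> restricted (\<phi> \<^bold>\<longrightarrow> \<psi>)"
proof -
  assume "restricted \<phi>" "restricted \<psi>"
  then obtain \<phi>' \<psi>' where *: "bounded_fm \<phi>'" "\<forall>F f. F |= rename f \<phi> \<longleftrightarrow> F |= rename f \<phi>'"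
    "bounded_fm \<psi>'" "\<forall>F f. F |= rename f \<psi> \<longleftrightarrow> F |= rename f \<psi>'"
    unfolding restricted_def by blast
  then have "F |= rename f (\<phi> \<^bold>\<longrightarrow> \<psi>) \<longleftrightarrow> F |= rename f (\<phi>' \<^bold>\<longrightarrow> \<psi>')" for F f
    by (auto elim!: forces_impl_mono)
  then show ?thesis unfolding restricted_def using *
    by (intro exI[of _ "\<phi>' \<^bold>\<longrightarrow> \<psi>'"]) (simp add: bounded_fm.intros)
qed

lemma restricted_BForall: "restricted \<phi> \<Longrightarrow> restricted (BForall x \<phi>)"
proof -
  assume "restricted \<phi>"
  then obtain \<phi>' where *: "bounded_fm \<phi>'" "\<forall>F f. F |= rename f \<phi> \<longleftrightarrow> F |= rename f \<phi>'"
    unfolding restricted_def by blast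
  then have "F |= rename f (BForall x \<phi>) \<longleftrightarrow> F |= rename f (BForall x \<phi>')" for F f
    by (auto elim!: forces_Forall_mono forces_impl_mono)
  then show ?thesis unfolding restricted_def using *
    by (intro exI[of _ "BForall x \<phi>'"]) (simp add: bounded_fm.intros)
qed

lemma restricted_BExists: "restricted \<phi> \<Longrightarrow> restricted (BExists x \<phi>)"
proof -
  assume "restricted \<phi>"
  then obtain \<phi>' where *: "bounded_fm \<phi>'" "\<forall>F f. F |= rename f \<phi> \<longleftrightarrow> F |= rename f \<phi>'"
    unfolding restricted_def by blast
  then have "F |= rename f (BExists x \<phi>) \<longleftrightarrow> F |= rename f (BExists x \<phi>')" for F f
    by simp
  then show ?thesis unfolding restricted_def using *
    by (intro exI[of _ "BExists x \<phi>'"]) (simp add: bounded_fm.intros)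
qed

lemma restricted_upair: "restricted (is_upair z x y)"
proof (rule restricted_cong)
  let ?\<psi> = "x \<^bold>\<in> z \<^bold>\<and> y \<^bold>\<in> z \<^bold>\<and> BForall z (0 \<^bold>= Suc x \<^bold>\<or> 0 \<^bold>= Suc y)"
  show "restricted ?\<psi>"
    by (intro restricted_conj restricted_BForall restricted_disj restricted_atoms)
  show "F |= rename f (is_upair z x y) \<longleftrightarrow> F |= rename f ?\<psi>" for F f
  proof
    assume *: "F |= rename f (is_upair z x y)"
    then have "F |= BForall (f z) (0 \<^bold>= Suc (f x) \<^bold>\<or> 0 \<^bold>= Suc (f y))"
      by (intro forces_BForallI[of "{is_upair (f z) (f x) (f y)}"]) (simp_all add: forces_upairD)
    with * show "F |= rename f ?\<psi>" by (simp add: forces_upairD)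
  next
    assume "F |= rename f ?\<psi>"
    then show "F |= rename f (is_upair z x y)"
      by (simp, intro forces_upairI[of "{f x \<^bold>\<in> f z, f y \<^bold>\<in> f z,
          BForall (f z) (0 \<^bold>= Suc (f x) \<^bold>\<or> 0 \<^bold>= Suc (f y))}"])
        (auto dest: forces_BForallD intro: forces_mem_cong[OF forces_sym forces_refl])
  qed
qed

text \<open>The two unordered pairs inside a Kuratowski pair are members of it, which bounds both
  existential quantifiers.\<close>

lemma restricted_opair: "restricted (is_opair z x y)"
proof (rule restricted_cong)
  let ?\<psi> = "BExists z (BExists (Suc z) (is_upair 1 (x+2) (x+2) \<^bold>\<and> is_upair 0 (x+2) (y+2)
    \<^bold>\<and> is_upair (z+2) 1 0))"
  show "restricted ?\<psi>"
    by (intro restricted_conj restricted_BExists restricted_upair)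
  show "F |= rename f (is_opair z x y) \<longleftrightarrow> F |= rename f ?\<psi>" for F f
    using forces_upairD[of F "f z"] by (simp add: forces_opair_iff numeral_eq_Suc) (metis forces_refl)
qed

lemma restricted_rel: "restricted (rel r x y)"
  unfolding rel_def by (intro restricted_BExists restricted_opair)

lemma restricted_subset: "restricted (is_subset x y)"
  unfolding is_subset_def by (intro restricted_BForall restricted_atoms)

lemmas restricted_intros = restricted_atoms restricted_conj restricted_disj restricted_impl
  restricted_BForall restricted_BExists restricted_upair restricted_opair restricted_rel
  restricted_subset

lemma forces_separation:
  assumes "restricted \<phi>"
  shows "\<exists>b. F |= is_set b (0 \<^bold>\<in> Suc a \<^bold>\<and> \<phi>)"
proof -
  obtain \<psi> where \<psi>: "bounded_fm \<psi>" "\<And>F f. F |= rename f \<phi> \<longleftrightarrow> F |= rename f \<psi>"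
    using assms unfolding restricted_def by blast
  have pl: "place [0] 3 \<psi> = rename (case_nat 0 (\<lambda>i. Suc (Suc (Suc i)))) \<psi>"
    unfolding place_def
    by (rule arg_cong[where f = "\<lambda>g. rename g \<psi>"]) (rule ext, simp split: nat.split)
  have "F |= separation_ax \<psi>"
    using forces_ax[of "separation_ax \<psi>" F "\<lambda>i. i"] \<psi>(1) by (auto simp: ZT_def CZF_def)
  then obtain b where b: "F |= is_set b (0 \<^bold>\<in> Suc a \<^bold>\<and> rename (\<lambda>i. i) \<psi>)"
    unfolding separation_ax_def pl
    by - (drule forces_spec[of _ _ a], auto simp: is_set_def numeral_eq_Suc)
  have "F |= is_set b (0 \<^bold>\<in> Suc a \<^bold>\<and> \<phi>)"
    by (rule forces_is_setI[of "{is_set b (0 \<^bold>\<in> Suc a \<^bold>\<and> \<psi>)}"]) (use b in \<open>auto simp: \<psi>(2) forces_is_setD\<close>)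
  then show ?thesis ..
qed

section \<open>Union, collection and replacement\<close>

lemma forces_union_ex: "\<exists>u. F |= is_set u (BExists (Suc a) (1 \<^bold>\<in> 0))"
proof -
  have "F |= union_ax"
    using forces_ax[of union_ax F "\<lambda>i. i"] by (simp add: ZT_def CZF_def)
  then show ?thesis unfolding union_ax_def
    by - (drule forces_spec[of _ _ a], auto simp: is_set_def numeral_eq_Suc)
qed

abbreviation swap01 :: "nat \<Rightarrow> nat" where
  "swap01 \<equiv> case_nat (Suc 0) (case_nat 0 (\<lambda>i. Suc (Suc i)))"

text \<open>The two-sided conclusion common to strong collection, subset collection and regularity,
  so that one pair of elimination rules serves all three. When \<open>\<psi>\<close> is a function
  on \<open>a\<close>, the set \<open>b\<close> is its range.\<close>

definition is_coll :: "nat \<Rightarrow> nat \<Rightarrow> fm \<Rightarrow> fm" where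
  "is_coll b a \<psi> = (BForall a (BExists (Suc b) \<psi>) \<^bold>\<and>
     BForall b (BExists (Suc a) (rename swap01 \<psi>)))"

lemma is_collD1: "F |= is_coll b a \<psi> \<Longrightarrow> F |= (x \<^bold>\<in> a) \<Longrightarrow> \<exists>y. F |= (y \<^bold>\<in> b) \<and> F |= inst2 x y \<psi>"
  using forces_BForallD[of F a "BExists (Suc b) \<psi>" x] by (simp add: is_coll_def)

lemma is_collD2: "F |= is_coll b a \<psi> \<Longrightarrow> F |= (y \<^bold>\<in> b) \<Longrightarrow> \<exists>x. F |= (x \<^bold>\<in> a) \<and> F |= inst2 x y \<psi>"
  using forces_BForallD[of F b "BExists (Suc a) (rename swap01 \<psi>)" y] by (simp add: is_coll_def)

lemma rename_is_coll [simp]: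
  "rename f (is_coll b a \<psi>) = is_coll (f b) (f a) (rename (lift (lift f)) \<psi>)"
proof -
  have "rename (lift (lift f)) (rename swap01 \<psi>) = rename swap01 (rename (lift (lift f)) \<psi>)"
    unfolding rename_rename
    by (rule arg_cong[where f = "\<lambda>g. rename g \<psi>"]) (rule ext, simp split: nat.split)
  then show ?thesis by (simp add: is_coll_def del: rename_rename)
qed

lemma lift_eq_case: "lift f i = case_nat 0 (\<lambda>j. Suc (f j)) i"
  by (simp split: nat.split)

lemma rename_ext: "(\<And>i. f i = g i) \<Longrightarrow> rename f \<phi> = rename g \<phi>"
  by (rule arg_cong[where f = "\<lambda>g. rename g \<phi>"]) (rule ext)

lemma rename_idI: "(\<And>i. f i = i) \<Longrightarrow> rename f \<phi> = \<phi>"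
  using rename_ext[of f "\<lambda>i. i"] by simp

lemma forces_collection:
  assumes "finite H" "F ||= H"
    "\<And>G x. G ||= H \<Longrightarrow> G |= (x \<^bold>\<in> a) \<Longrightarrow> \<exists>y. G |= inst2 x y \<psi>"
  shows "\<exists>b. F |= is_coll b a \<psi>"
proof -
  have 1: "F |= BForall a (Exists \<psi>)"
    using assms by (intro forces_BForallI[of H]) simp_all
  \<comment> \<open>The axiom scheme expects the argument at index 0 and the value at index 1, the
    reverse of the \<open>inst2\<close> convention.\<close>
  let ?\<phi> = "rename swap01 \<psi>"
  have "F |= strong_collection_ax ?\<phi>"
    using forces_ax[of "strong_collection_ax ?\<phi>" F "\<lambda>i. i"]
    by (auto simp: ZT_def CZF_def)
  from forces_spec[OF this[unfolded strong_collection_ax_def], of a]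
  have "F |= inst a (BForall 0 (Exists (place [1,0] 3 ?\<phi>)) \<^bold>\<longrightarrow>
      Exists (BForall 1 (BExists 1 (place [1,0] 4 ?\<phi>)) \<^bold>\<and> BForall 0 (BExists 2 (place [0,1] 4 ?\<phi>))))" .
  also have "inst a (BForall 0 (Exists (place [1,0] 3 ?\<phi>)) \<^bold>\<longrightarrow>
        Exists (BForall 1 (BExists 1 (place [1,0] 4 ?\<phi>)) \<^bold>\<and> BForall 0 (BExists 2 (place [0,1] 4 ?\<phi>))))
      = (BForall a (Exists \<psi>) \<^bold>\<longrightarrow> Exists (is_coll 0 (Suc a) (rename (lift (lift Suc)) \<psi>)))"
      by (simp add: place_def is_coll_def numeral_eq_Suc del: lift_case, intro HOL.conjI rename_ext rename_idI)
        (simp_all add: nth_Cons split: nat.split)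
  finally have "F |= (BForall a (Exists \<psi>) \<^bold>\<longrightarrow> Exists (is_coll 0 (Suc a) (rename (lift (lift Suc)) \<psi>)))" .
  from forces_mp[OF this 1] show ?thesis by simp
qed

text \<open>The parameter over which \<open>c\<close> is uniform has index 2 in
  \<open>\<psi>\<close>. In the conclusion it sits one binder deeper, beneath the bound
  \<open>d\<close>; hence the shift that spares the first two indices.\<close>

definition is_subset_coll :: "nat \<Rightarrow> nat \<Rightarrow> nat \<Rightarrow> fm \<Rightarrow> fm" where
  "is_subset_coll c a b \<psi> = Forall (BForall (Suc a) (BExists (Suc (Suc b)) \<psi>) \<^bold>\<longrightarrow>
     BExists (Suc c) (is_coll 0 (Suc (Suc a)) (rename (lift (lift Suc)) \<psi>)))"

lemma is_subset_collD:
  assumes "F |= is_subset_coll c a b \<psi>"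
    "F |= BForall a (BExists (Suc b) (rename (lift (lift (case_nat u (\<lambda>i. i)))) \<psi>))"
  shows "\<exists>d. F |= (d \<^bold>\<in> c) \<and> F |= is_coll d a (rename (lift (lift (case_nat u (\<lambda>i. i)))) \<psi>)"
proof -
  have eq: "rename (\<lambda>i. lift (lift (case_nat d (\<lambda>i. i))) (lift (lift (lift (case_nat u (\<lambda>i. i)))) (lift (lift Suc) i))) \<psi>
      = rename (lift (lift (case_nat u (\<lambda>i. i)))) \<psi>" for d
    by (rule rename_ext) (simp add: lift_eq_case split: nat.split)
  from assms(1) have "F |= inst u (BForall (Suc a) (BExists (Suc (Suc b)) \<psi>) \<^bold>\<longrightarrow>
     BExists (Suc c) (is_coll 0 (Suc (Suc a)) (rename (lift (lift Suc)) \<psi>)))"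
    unfolding is_subset_coll_def by (rule forces_spec)
  then show ?thesis using assms(2) forces_mp by (force simp: eq simp del: lift_case)
qed

lemma forces_subset_collection: "\<exists>c. F |= is_subset_coll c a b \<psi>"
proof -
  let ?\<phi> = "rename swap01 \<psi>"
  have "F |= subset_collection_ax ?\<phi>"
    using forces_ax[of "subset_collection_ax ?\<phi>" F "\<lambda>i. i"]
    by (auto simp: ZT_def CZF_def)
  from forces_spec2[OF this[unfolded subset_collection_ax_def], where x = a and y = b]
  have "F |= inst2 a b (Exists (Forall
     (BForall 3 (BExists 3 (place [1,0,2] 6 ?\<phi>)) \<^bold>\<longrightarrow>
      BExists 1 (BForall 4 (BExists 1 (place [1,0,3] 7 ?\<phi>)) \<^bold>\<and>
                 BForall 0 (BExists 5 (place [0,1,3] 7 ?\<phi>))))))" .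
  also have "inst2 a b (Exists (Forall
     (BForall 3 (BExists 3 (place [1,0,2] 6 ?\<phi>)) \<^bold>\<longrightarrow>
      BExists 1 (BForall 4 (BExists 1 (place [1,0,3] 7 ?\<phi>)) \<^bold>\<and>
                 BForall 0 (BExists 5 (place [0,1,3] 7 ?\<phi>))))))
    = Exists (is_subset_coll 0 (Suc a) (Suc b) (rename (lift (lift (lift Suc))) \<psi>))"
    by (simp add: place_def is_coll_def is_subset_coll_def numeral_eq_Suc del: lift_case,
        intro HOL.conjI rename_ext rename_idI)
      (simp_all add: nth_Cons lift_eq_case split: nat.split)
  finally obtain c where "F |= inst c (is_subset_coll 0 (Suc a) (Suc b) (rename (lift (lift (lift Suc))) \<psi>))"
    by auto
  also have "inst c (is_subset_coll 0 (Suc a) (Suc b) (rename (lift (lift (lift Suc))) \<psi>))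
    = is_subset_coll c a b \<psi>"
    by (simp add: is_subset_coll_def)
  finally show ?thesis ..
qed

definition is_image :: "nat \<Rightarrow> nat \<Rightarrow> fm \<Rightarrow> fm" where
  "is_image b a \<psi> = is_set b (BExists (Suc a) (rename swap01 \<psi>))"

lemma forces_imageD:
  "F |= is_image b a \<psi> \<Longrightarrow> F |= (y \<^bold>\<in> b) \<longleftrightarrow> (\<exists>x. F |= (x \<^bold>\<in> a) \<and> F |= inst2 x y \<psi>)"
  using forces_is_setD[of F b "BExists (Suc a) (rename swap01 \<psi>)" y] by (simp add: is_image_def)

text \<open>Strong collection supplies a set of values; by uniqueness every value equals a collected
  one, so the set is the exact image.\<close>

lemma forces_replacement:
  assumes H: "finite H" "F ||= H"
    and total: "\<And>G x. G ||= H \<Longrightarrow> G |= (x \<^bold>\<in> a) \<Longrightarrow> \<exists>y. G |= inst2 x y \<psi>"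
    and unique: "\<And>G x y y'. G ||= H \<Longrightarrow> G |= (x \<^bold>\<in> a) \<Longrightarrow> G |= inst2 x y \<psi> \<Longrightarrow>
      G |= inst2 x y' \<psi> \<Longrightarrow> G |= (y \<^bold>= y')"
  shows "\<exists>b. F |= is_image b a \<psi>"
proof -
  obtain b where b: "F |= is_coll b a \<psi>"
    using forces_collection[OF H total] by blast
  have "F |= is_image b a \<psi>"
    unfolding is_image_def
  proof (rule forces_is_setI[of "insert (is_coll b a \<psi>) H"])
    fix G y assume *: "G ||= insert (is_coll b a \<psi>) H"
    then have c: "G |= is_coll b a \<psi>" and H': "G ||= H" by simp_all
    have "G |= (y \<^bold>\<in> b) \<longleftrightarrow> (\<exists>x. G |= (x \<^bold>\<in> a) \<and> G |= inst2 x y \<psi>)"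
      using is_collD1[OF c] is_collD2[OF c] unique[OF H']
      by (meson forces_mem_cong forces_refl)
    then show "G |= (y \<^bold>\<in> b) \<longleftrightarrow> G |= inst y (BExists (Suc a) (rename swap01 \<psi>))" by simp
  qed (use H b in auto)
  then show ?thesis ..
qed

section \<open>Cartesian products\<close>

definition is_prod :: "nat \<Rightarrow> nat \<Rightarrow> nat \<Rightarrow> fm" where
  "is_prod p a b = is_set p (BExists (Suc a) (BExists (Suc (Suc b)) (is_opair 2 1 0)))"

lemma forces_prodD:
  "F |= is_prod p a b \<Longrightarrow> F |= (q \<^bold>\<in> p) \<longleftrightarrow>
     (\<exists>u v. F |= (u \<^bold>\<in> a) \<and> F |= (v \<^bold>\<in> b) \<and> F |= is_opair q u v)"
  unfolding is_prod_def by (drule forces_is_setD[of _ _ _ q]) (simp add: numeral_eq_Suc)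

text \<open>For fixed \<open>x\<close> in \<open>a\<close> the row of pairs \<open>(x, v)\<close>
  exists by replacement; collection over \<open>a\<close> gathers the rows and union flattens
  them.\<close>

lemma forces_prod_ex: "\<exists>p. F |= is_prod p a b"
proof -
  have row: "\<exists>z. G |= is_image z b (is_opair 0 (Suc (Suc x)) 1)" for G x
    by (rule forces_replacement[of "{}"]) (auto simp: forces_opair_ex forces_opair_unique)
  obtain D where D: "F |= is_coll D a (is_image 0 (Suc (Suc b)) (is_opair 0 3 1))"
    using forces_collection[of "{}" F a "is_image 0 (Suc (Suc b)) (is_opair 0 3 1)"] row
    by (auto simp: is_image_def numeral_eq_Suc)
  obtain p where p: "F |= is_set p (BExists (Suc D) (1 \<^bold>\<in> 0))"
    using forces_union_ex by blast
  have "F |= is_prod p a b"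
    unfolding is_prod_def
  proof (rule forces_is_setI[of "{is_coll D a (is_image 0 (Suc (Suc b)) (is_opair 0 3 1)),
        is_set p (BExists (Suc D) (1 \<^bold>\<in> 0))}"])
    fix G q
    assume "G ||= {is_coll D a (is_image 0 (Suc (Suc b)) (is_opair 0 3 1)),
        is_set p (BExists (Suc D) (1 \<^bold>\<in> 0))}"
    then have D: "G |= is_coll D a (is_image 0 (Suc (Suc b)) (is_opair 0 3 1))"
      and p: "G |= is_set p (BExists (Suc D) (1 \<^bold>\<in> 0))" by simp_all
    have 1: "\<exists>z. G |= (z \<^bold>\<in> D) \<and> G |= is_image z b (is_opair 0 (Suc (Suc x)) 1)" if "G |= (x \<^bold>\<in> a)" for x
      using is_collD1[OF D that] by (simp add: is_image_def numeral_eq_Suc)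
    have 2: "\<exists>x. G |= (x \<^bold>\<in> a) \<and> G |= is_image z b (is_opair 0 (Suc (Suc x)) 1)" if "G |= (z \<^bold>\<in> D)" for z
      using is_collD2[OF D that] by (simp add: is_image_def numeral_eq_Suc)
    have "G |= (q \<^bold>\<in> p) \<longleftrightarrow> (\<exists>z. G |= (z \<^bold>\<in> D) \<and> G |= (q \<^bold>\<in> z))"
      using forces_is_setD[OF p, of q] by simp
    also have "\<dots> \<longleftrightarrow> (\<exists>u v. G |= (u \<^bold>\<in> a) \<and> G |= (v \<^bold>\<in> b) \<and> G |= is_opair q u v)"
      (is "?l \<longleftrightarrow> ?r")
    proof
      assume ?l
      then show ?r using 2 by (fastforce dest: forces_imageD)
    next
      assume ?r
      then show ?l using 1 by (fastforce dest: forces_imageD)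
    qed
    finally show "G |= (q \<^bold>\<in> p) \<longleftrightarrow>
        G |= inst q (BExists (Suc a) (BExists (Suc (Suc b)) (is_opair 2 1 0)))"
      by (simp add: numeral_eq_Suc)
  qed (use D p in auto)
  then show ?thesis ..
qed

lemma forces_inst2_cong:
  assumes "F |= (x \<^bold>= x')" "F |= (y \<^bold>= y')" "F |= inst2 x y \<psi>"
  shows "F |= inst2 x' y' \<psi>"
proof -
  have "F |= inst2 x' y \<psi>"
    using forces_subst[OF assms(1), of "rename (case_nat (Suc y) (case_nat 0 Suc)) \<psi>"] assms(3)
    by simp
  then show ?thesis
    using forces_subst[OF assms(2), of "rename (lift (case_nat x' (\<lambda>i. i))) \<psi>"] by simp
qed

section \<open>Relations and functions\<close>

lemma forces_relationI:
  assumes "finite H" "F ||= H"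
    "\<And>G p. G ||= H \<Longrightarrow> G |= (p \<^bold>\<in> r) \<Longrightarrow>
      \<exists>u v. G |= (u \<^bold>\<in> x) \<and> G |= (v \<^bold>\<in> y) \<and> G |= is_opair p u v"
  shows "F |= is_relation r x y"
  unfolding is_relation_def
  by (rule forces_BForallI[OF assms(1,2)]) (use assms(3) in \<open>simp add: numeral_eq_Suc\<close>)

lemma forces_relationD:
  "F |= is_relation r x y \<Longrightarrow> F |= (p \<^bold>\<in> r) \<Longrightarrow>
     \<exists>u v. F |= (u \<^bold>\<in> x) \<and> F |= (v \<^bold>\<in> y) \<and> F |= is_opair p u v"
  unfolding is_relation_def
  by (drule forces_BForallD[of _ _ _ p]) (simp_all add: numeral_eq_Suc)

lemma forces_relation_rel:
  assumes "F |= is_relation r x y" "F |= rel r u v"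
  shows "F |= (u \<^bold>\<in> x)" "F |= (v \<^bold>\<in> y)"
proof -
  obtain p where p: "F |= (p \<^bold>\<in> r)" "F |= is_opair p u v"
    using assms(2) unfolding forces_rel_iff by blast
  obtain u' v' where "F |= (u' \<^bold>\<in> x)" "F |= (v' \<^bold>\<in> y)" "F |= is_opair p u' v'"
    using forces_relationD[OF assms(1) p(1)] by blast
  then show "F |= (u \<^bold>\<in> x)" "F |= (v \<^bold>\<in> y)"
    using p(2) forces_opair_inject forces_mem_cong forces_refl by meson+
qed

lemma forces_funcI:
  assumes H: "finite H" "F ||= H"
    and rel: "\<And>G p. G ||= H \<Longrightarrow> G |= (p \<^bold>\<in> f) \<Longrightarrow>
      \<exists>u v. G |= (u \<^bold>\<in> x) \<and> G |= (v \<^bold>\<in> y) \<and> G |= is_opair p u v"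
    and total: "\<And>G u. G ||= H \<Longrightarrow> G |= (u \<^bold>\<in> x) \<Longrightarrow> \<exists>v. G |= rel f u v"
    and unique: "\<And>G u v w. G ||= H \<Longrightarrow> G |= (u \<^bold>\<in> x) \<Longrightarrow> G |= rel f u v \<Longrightarrow> G |= rel f u w \<Longrightarrow>
      G |= (v \<^bold>= w)"
  shows "F |= is_func f x y"
proof -
  have r: "G |= is_relation f x y" if "G ||= H" for G
    by (rule forces_relationI[OF H(1) that rel])
  have 1: "F |= BForall x (BExists (y+1) (rel (f+2) 1 0))"
    by (rule forces_BForallI[OF H]) (use total r forces_relation_rel in \<open>simp, meson\<close>)
  have 2: "F |= BForall x (BForall (y+1) (BForall (y+2) (rel (f+3) 2 1 \<^bold>\<and> rel (f+3) 2 0 \<^bold>\<longrightarrow> 1 \<^bold>= 0)))"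
  proof (rule forces_BForallI[OF H])
    fix G u assume G: "G ||= H" "G |= (u \<^bold>\<in> x)"
    have "G |= BForall y (BForall (Suc y) (rel (f+2) (u+2) 1 \<^bold>\<and> rel (f+2) (u+2) 0 \<^bold>\<longrightarrow> 1 \<^bold>= 0))"
    proof (rule forces_BForallI[of "insert (u \<^bold>\<in> x) H"])
      fix G v assume G: "G ||= insert (u \<^bold>\<in> x) H"
      have "G |= BForall y (rel (f+1) (u+1) (v+1) \<^bold>\<and> rel (f+1) (u+1) 0 \<^bold>\<longrightarrow> (v+1) \<^bold>= 0)"
      proof (rule forces_BForallI[of "insert (u \<^bold>\<in> x) H"])
        fix G w assume G: "G ||= insert (u \<^bold>\<in> x) H"
        have "G |= (rel f u v \<^bold>\<and> rel f u w \<^bold>\<longrightarrow> v \<^bold>= w)"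
          by (rule forces_implI[of "insert (u \<^bold>\<in> x) H"]) (use H G unique in auto)
        then show "G |= inst w (rel (f+1) (u+1) (v+1) \<^bold>\<and> rel (f+1) (u+1) 0 \<^bold>\<longrightarrow> (v+1) \<^bold>= 0)" by simp
      qed (use H G in auto)
      then show "G |= inst v (BForall (Suc y) (rel (f+2) (u+2) 1 \<^bold>\<and> rel (f+2) (u+2) 0 \<^bold>\<longrightarrow> 1 \<^bold>= 0))"
        by (simp add: numeral_eq_Suc)
    qed (use H G in auto)
    then show "G |= inst u (BForall (y+1) (BForall (y+2) (rel (f+3) 2 1 \<^bold>\<and> rel (f+3) 2 0 \<^bold>\<longrightarrow> 1 \<^bold>= 0)))"
      by (simp add: numeral_eq_Suc)
  qed
  show ?thesis using r[OF H(2)] 1 2 by (simp add: is_func_def)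
qed

lemma forces_func_relation: "F |= is_func f x y \<Longrightarrow> F |= is_relation f x y"
  by (simp add: is_func_def)

lemmas forces_func_rel = forces_relation_rel[OF forces_func_relation]

lemma forces_func_total:
  assumes "F |= is_func f x y" "F |= (u \<^bold>\<in> x)"
  shows "\<exists>v. F |= (v \<^bold>\<in> y) \<and> F |= rel f u v"
  using assms forces_BForallD[of F x "BExists (y+1) (rel (f+2) 1 0)" u]
  by (simp add: is_func_def numeral_eq_Suc)

lemma forces_func_unique:
  assumes "F |= is_func f x y" "F |= rel f u v" "F |= rel f u w"
  shows "F |= (v \<^bold>= w)"
proof -
  have 1: "F |= BForall x (BForall (y+1) (BForall (y+2) (rel (f+3) 2 1 \<^bold>\<and> rel (f+3) 2 0 \<^bold>\<longrightarrow> 1 \<^bold>= 0)))"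
    using assms(1) by (simp add: is_func_def)
  note m = forces_func_rel[OF assms(1,2)] forces_func_rel[OF assms(1,3)]
  have "F |= BForall y (BForall (Suc y) (rel (f+2) (u+2) 1 \<^bold>\<and> rel (f+2) (u+2) 0 \<^bold>\<longrightarrow> 1 \<^bold>= 0))"
    using forces_BForallD[OF 1 m(1)] by (simp add: numeral_eq_Suc)
  from forces_BForallD[OF this m(2)]
  have "F |= BForall y (rel (f+1) (u+1) (v+1) \<^bold>\<and> rel (f+1) (u+1) 0 \<^bold>\<longrightarrow> (v+1) \<^bold>= 0)"
    by (simp add: numeral_eq_Suc)
  from forces_BForallD[OF this m(4)]
  have "F |= (rel f u v \<^bold>\<and> rel f u w \<^bold>\<longrightarrow> v \<^bold>= w)" by simp
  then show ?thesis using assms(2,3) forces_mp by simp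
qed

lemma restricted_func: "restricted (is_func f x y)"
  unfolding is_func_def is_relation_def by (intro restricted_intros)

section \<open>Surjections, sections and bases\<close>

lemma forces_surjI:
  assumes "finite H" "F ||= H" "F |= is_func f x y"
    "\<And>G v. G ||= H \<Longrightarrow> G |= (v \<^bold>\<in> y) \<Longrightarrow> \<exists>u. G |= (u \<^bold>\<in> x) \<and> G |= rel f u v"
  shows "F |= is_surj f x y"
proof -
  have "F |= BForall y (BExists (x+1) (rel (f+2) 0 1))"
    by (rule forces_BForallI[OF assms(1,2)]) (use assms(4) in \<open>simp add: numeral_eq_Suc\<close>)
  then show ?thesis using assms(3) by (simp add: is_surj_def)
qed

lemma forces_surj_func: "F |= is_surj f x y \<Longrightarrow> F |= is_func f x y"
  by (simp add: is_surj_def)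

lemma forces_surjD:
  "F |= is_surj f x y \<Longrightarrow> F |= (v \<^bold>\<in> y) \<Longrightarrow> \<exists>u. F |= (u \<^bold>\<in> x) \<and> F |= rel f u v"
  using forces_BForallD[of F y "BExists (x+1) (rel (f+2) 0 1)" v]
  by (simp add: is_surj_def numeral_eq_Suc)

definition is_section :: "nat \<Rightarrow> nat \<Rightarrow> nat \<Rightarrow> nat \<Rightarrow> fm" where
  "is_section s p x f = (is_func s p x \<^bold>\<and> BForall p (BExists (x+1) (rel (s+2) 1 0 \<^bold>\<and> rel (f+2) 0 1)))"

lemma rename_section [simp]: "rename g (is_section s p x f) = is_section (g s) (g p) (g x) (g f)"
  by (simp add: is_section_def numeral_eq_Suc)

lemma forces_sectionI:
  assumes "finite H" "F ||= H" "F |= is_func s p x"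
    "\<And>G u. G ||= H \<Longrightarrow> G |= (u \<^bold>\<in> p) \<Longrightarrow>
      \<exists>v. G |= (v \<^bold>\<in> x) \<and> G |= rel s u v \<and> G |= rel f v u"
  shows "F |= is_section s p x f"
proof -
  have "F |= BForall p (BExists (x+1) (rel (s+2) 1 0 \<^bold>\<and> rel (f+2) 0 1))"
    by (rule forces_BForallI[OF assms(1,2)]) (use assms(4) in \<open>simp add: numeral_eq_Suc\<close>)
  then show ?thesis using assms(3) by (simp add: is_section_def)
qed

lemma forces_section_func: "F |= is_section s p x f \<Longrightarrow> F |= is_func s p x"
  by (simp add: is_section_def)

lemma forces_sectionD:
  "F |= is_section s p x f \<Longrightarrow> F |= (u \<^bold>\<in> p) \<Longrightarrow>
    \<exists>v. F |= (v \<^bold>\<in> x) \<and> F |= rel s u v \<and> F |= rel f v u"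
  using forces_BForallD[of F p "BExists (x+1) (rel (s+2) 1 0 \<^bold>\<and> rel (f+2) 0 1)" u]
  by (simp add: is_section_def numeral_eq_Suc)

lemma is_base_alt:
  "is_base p = Forall (Forall (is_surj 0 1 (p+2) \<^bold>\<longrightarrow> Exists (is_section 0 (p+3) 2 1)))"
  by (simp add: is_base_def is_section_def numeral_eq_Suc)

lemma forces_baseD:
  assumes "F |= is_base p" "F |= is_surj f x p"
  shows "\<exists>s. F |= is_section s p x f"
proof -
  have "F |= (is_surj f x p \<^bold>\<longrightarrow> Exists (is_section 0 (p+1) (x+1) (f+1)))"
    using forces_spec2[OF assms(1)[unfolded is_base_alt], where x = x and y = f]
    by (simp add: numeral_eq_Suc)
  from forces_mp[OF this assms(2)] show ?thesis by simp
qed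

lemma forces_baseI:
  assumes H: "finite H" "F ||= H"
    and sec: "\<And>G x f. G ||= H \<Longrightarrow> G |= is_surj f x p \<Longrightarrow> \<exists>s. G |= is_section s p x f"
  shows "F |= is_base p"
  unfolding is_base_alt
proof (rule forces_ForallI[OF H])
  fix G x assume G: "G ||= H"
  have "G |= Forall (is_surj 0 (x+1) (p+1) \<^bold>\<longrightarrow> Exists (is_section 0 (p+2) (x+2) 1))"
  proof (rule forces_ForallI[OF H(1) G])
    fix G f assume G: "G ||= H"
    have "G |= (is_surj f x p \<^bold>\<longrightarrow> Exists (is_section 0 (p+1) (x+1) (f+1)))"
      by (rule forces_implI[OF H(1) G]) (use sec in simp)
    then show "G |= inst f (is_surj 0 (x+1) (p+1) \<^bold>\<longrightarrow> Exists (is_section 0 (p+2) (x+2) 1))"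
      by (simp add: numeral_eq_Suc)
  qed
  then show "G |= inst x (Forall (is_surj 0 1 (p+2) \<^bold>\<longrightarrow> Exists (is_section 0 (p+3) 2 1)))"
    by (simp add: numeral_eq_Suc)
qed

lemma forces_PA: "\<exists>P f. F |= is_base P \<and> F |= is_surj f P x"
proof -
  have "F |= PA" using forces_ax[of PA F "\<lambda>i. i"] by (simp add: ZT_def)
  then show ?thesis unfolding PA_def
    by - (drule forces_spec[of _ _ x], simp add: numeral_eq_Suc)
qed

section \<open>Bases\<close>

text \<open>The second clause speaks of every value related to the argument, which allows it to be
  applied to any value already at hand.\<close>

definition is_choice :: "nat \<Rightarrow> nat \<Rightarrow> nat \<Rightarrow> fm \<Rightarrow> fm" where
  "is_choice g x y \<psi> = (is_func g x y \<^bold>\<and> BForall x (Forall (rel (g+2) 1 0 \<^bold>\<longrightarrow> \<psi>)))"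

lemma forces_choice_func: "F |= is_choice g x y \<psi> \<Longrightarrow> F |= is_func g x y"
  by (simp add: is_choice_def)

lemma forces_choiceD:
  assumes "F |= is_choice g x y \<psi>" "F |= rel g u v"
  shows "F |= inst2 u v \<psi>"
proof -
  have u: "F |= (u \<^bold>\<in> x)"
    using assms forces_func_rel(1) forces_choice_func by blast
  have "F |= Forall (rel (g+1) (u+1) 0 \<^bold>\<longrightarrow> rename (lift (case_nat u (\<lambda>i. i))) \<psi>)"
    using assms(1) forces_BForallD[OF _ u, of "Forall (rel (g+2) 1 0 \<^bold>\<longrightarrow> \<psi>)"]
    by (simp add: is_choice_def numeral_eq_Suc)
  from forces_spec[OF this, of v] show ?thesis
    using assms(2) forces_mp by simp
qed

lemma forces_choiceI:
  assumes H: "finite H" "F ||= H" "F |= is_func g x y"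
    and \<psi>: "\<And>G u v. G ||= H \<Longrightarrow> G |= (u \<^bold>\<in> x) \<Longrightarrow> G |= rel g u v \<Longrightarrow> G |= inst2 u v \<psi>"
  shows "F |= is_choice g x y \<psi>"
proof -
  have "F |= BForall x (Forall (rel (g+2) 1 0 \<^bold>\<longrightarrow> \<psi>))"
  proof (rule forces_BForallI[OF H(1,2)])
    fix G u assume G: "G ||= H" "G |= (u \<^bold>\<in> x)"
    have "G |= Forall (rel (g+1) (u+1) 0 \<^bold>\<longrightarrow> rename (lift (case_nat u (\<lambda>i. i))) \<psi>)"
    proof (rule forces_ForallI[of "insert (u \<^bold>\<in> x) H"])
      fix G v assume G: "G ||= insert (u \<^bold>\<in> x) H"
      have "G |= (rel g u v \<^bold>\<longrightarrow> inst2 u v \<psi>)"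
        by (rule forces_implI[of "insert (u \<^bold>\<in> x) H"]) (use H G \<psi> in auto)
      then show "G |= inst v (rel (g+1) (u+1) 0 \<^bold>\<longrightarrow> rename (lift (case_nat u (\<lambda>i. i))) \<psi>)" by simp
    qed (use H G in auto)
    then show "G |= inst u (Forall (rel (g+2) 1 0 \<^bold>\<longrightarrow> \<psi>))" by (simp add: numeral_eq_Suc)
  qed
  then show ?thesis using H(3) by (simp add: is_choice_def)
qed

text \<open>
  The section of the projection from a set of pairs \<open>(x, y)\<close> with \<open>\<psi> x y\<close>, supplied by strong
  collection, is a choice function for \<open>\<psi>\<close>; hence \<open>\<psi>\<close> need not be restricted.
\<close>

lemma forces_base_choice:
  assumes H: "finite H" "F ||= H" and base: "F |= is_base P"
    and total: "\<And>G x. G ||= H \<Longrightarrow> G |= (x \<^bold>\<in> P) \<Longrightarrow> \<exists>y. G |= (y \<^bold>\<in> V) \<and> G |= inst2 x y \<psi>"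
  shows "\<exists>g. F |= is_choice g P V \<psi>"
proof -
  \<comment> \<open>\<open>p\<close> is a pair \<open>(x, y)\<close> with \<open>y\<close> in
    \<open>V\<close> and \<open>\<psi> x y\<close>; collecting such pairs over \<open>P\<close>
    gives the total space \<open>r\<close>.\<close>
  define \<theta> where "\<theta> = Exists (0 \<^bold>\<in> V+3 \<^bold>\<and> is_opair 1 2 0 \<^bold>\<and> rename (case_nat 0 (\<lambda>i. Suc (Suc i))) \<psi>)"
  have \<theta>: "G |= inst2 x p \<theta> \<longleftrightarrow> (\<exists>y. G |= (y \<^bold>\<in> V) \<and> G |= is_opair p x y \<and> G |= inst2 x y \<psi>)" for G x p
    by (simp add: \<theta>_def numeral_eq_Suc)
  \<comment> \<open>\<open>q = (e, x)\<close> where \<open>e\<close> is a pair with first component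
    \<open>x\<close>: the graph of the first projection from \<open>r\<close> to
    \<open>P\<close>.\<close>
  define \<pi> where "\<pi> = Exists (0 \<^bold>\<in> P+3 \<^bold>\<and> Exists (is_opair 3 1 0) \<^bold>\<and> is_opair 1 2 0)"
  have \<pi>: "G |= inst2 e q \<pi> \<longleftrightarrow>
      (\<exists>x. G |= (x \<^bold>\<in> P) \<and> (\<exists>y. G |= is_opair e x y) \<and> G |= is_opair q e x)" for G e q
    by (simp add: \<pi>_def numeral_eq_Suc)
  have "\<exists>r. F |= is_coll r P \<theta>"
    by (rule forces_collection[OF H]) (use total forces_opair_ex in \<open>simp only: \<theta>, meson\<close>)
  then obtain r where r: "F |= is_coll r P \<theta>" ..
  have r1: "\<exists>e y. G |= (e \<^bold>\<in> r) \<and> G |= (y \<^bold>\<in> V) \<and> G |= is_opair e x y \<and> G |= inst2 x y \<psi>"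
    if "G |= is_coll r P \<theta>" "G |= (x \<^bold>\<in> P)" for G x
    using is_collD1[OF that] unfolding \<theta> by blast
  have r2: "\<exists>x y. G |= (x \<^bold>\<in> P) \<and> G |= (y \<^bold>\<in> V) \<and> G |= is_opair e x y \<and> G |= inst2 x y \<psi>"
    if "G |= is_coll r P \<theta>" "G |= (e \<^bold>\<in> r)" for G e
    using is_collD2[OF that] unfolding \<theta> by blast
  have "\<exists>f. F |= is_image f r \<pi>"
  proof (rule forces_replacement[of "{is_coll r P \<theta>}"])
    fix G e assume "G ||= {is_coll r P \<theta>}" "G |= (e \<^bold>\<in> r)"
    then show "\<exists>q. G |= inst2 e q \<pi>" unfolding \<pi> using r2 forces_opair_ex by (simp, meson)
  next
    fix G e q q' assume "G |= inst2 e q \<pi>" "G |= inst2 e q' \<pi>"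
    then show "G |= (q \<^bold>= q')" unfolding \<pi>
      by (meson forces_opair_cong forces_opair_inject(1) forces_opair_unique forces_refl)
  qed (use r in simp_all)
  then obtain f where f: "F |= is_image f r \<pi>" ..
  have f1: "G |= rel f e x \<longleftrightarrow> G |= (e \<^bold>\<in> r) \<and> G |= (x \<^bold>\<in> P) \<and> (\<exists>y. G |= is_opair e x y)"
    if "G |= is_image f r \<pi>" for G e x
  proof -
    have "G |= rel f e x \<longleftrightarrow> (\<exists>q e' x'. G |= (e' \<^bold>\<in> r) \<and> G |= (x' \<^bold>\<in> P) \<and>
        (\<exists>y. G |= is_opair e' x' y) \<and> G |= is_opair q e' x' \<and> G |= is_opair q e x)"
      unfolding forces_rel_iff forces_imageD[OF that] \<pi> by blast
    also have "\<dots> \<longleftrightarrow> G |= (e \<^bold>\<in> r) \<and> G |= (x \<^bold>\<in> P) \<and> (\<exists>y. G |= is_opair e x y)"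
      by (meson forces_opair_cong forces_opair_inject forces_opair_ex forces_mem_cong forces_refl)
    finally show ?thesis .
  qed
  have ff: "F |= is_func f r P"
  proof (rule forces_funcI[of "{is_coll r P \<theta>, is_image f r \<pi>}"])
    fix G q assume "G ||= {is_coll r P \<theta>, is_image f r \<pi>}" "G |= (q \<^bold>\<in> f)"
    then show "\<exists>u v. G |= (u \<^bold>\<in> r) \<and> G |= (v \<^bold>\<in> P) \<and> G |= is_opair q u v"
      using forces_imageD[of G f r \<pi> q] unfolding \<pi> by auto
  next
    fix G e assume "G ||= {is_coll r P \<theta>, is_image f r \<pi>}" "G |= (e \<^bold>\<in> r)"
    then show "\<exists>x. G |= rel f e x" using f1 r2 by (simp, meson)
  next
    fix G e x x' assume "G ||= {is_coll r P \<theta>, is_image f r \<pi>}" "G |= rel f e x" "G |= rel f e x'"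
    then show "G |= (x \<^bold>= x')" using f1 by (simp, meson forces_opair_inject)
  qed (use r f in simp_all)
  have "F |= is_surj f r P"
    by (rule forces_surjI[of "{is_coll r P \<theta>, is_image f r \<pi>}"])
      (use r f ff f1 r1 in \<open>simp_all, meson\<close>)
  then obtain s where s: "F |= is_section s P r f" using forces_baseD base by blast
  \<comment> \<open>The section sends \<open>x\<close> to a pair \<open>(x, y)\<close>, and
    \<open>q\<close> is that same pair: as a set, the choice function \<open>g\<close> consists of
    the values of the section.\<close>
  define \<gamma> where "\<gamma> = Exists (is_opair 1 2 0 \<^bold>\<and> Exists (rel (s+4) 3 0 \<^bold>\<and> is_opair 0 3 1))"
  have \<gamma>: "G |= inst2 x q \<gamma> \<longleftrightarrow>
      (\<exists>y. G |= is_opair q x y \<and> (\<exists>e. G |= rel s x e \<and> G |= is_opair e x y))" for G x q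
    by (simp add: \<gamma>_def numeral_eq_Suc)
  let ?H = "{is_coll r P \<theta>, is_image f r \<pi>, is_section s P r f}"
  have s1: "\<exists>e y. G |= rel s x e \<and> G |= is_opair e x y" if "G ||= ?H" "G |= (x \<^bold>\<in> P)" for G x
    using that forces_sectionD[of G s P r f x] f1 by (simp, meson)
  have s2: "G |= (e \<^bold>= e')" if "G ||= ?H" "G |= rel s x e" "G |= rel s x e'" for G x e e'
    using that forces_func_unique[OF forces_section_func] by (simp, meson)
  have "\<exists>g. F |= is_image g P \<gamma>"
  proof (rule forces_replacement[of ?H])
    fix G x assume "G ||= ?H" "G |= (x \<^bold>\<in> P)"
    then show "\<exists>q. G |= inst2 x q \<gamma>" unfolding \<gamma> using s1 forces_opair_ex by meson
  next
    fix G x q q' assume "G ||= ?H" "G |= inst2 x q \<gamma>" "G |= inst2 x q' \<gamma>"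
    then show "G |= (q \<^bold>= q')" unfolding \<gamma> using s2[of G x]
      by (meson forces_opair_cong forces_opair_inject(2) forces_opair_unique forces_refl)
  qed (use r f s in simp_all)
  then obtain g where g: "F |= is_image g P \<gamma>" ..
  let ?H' = "insert (is_image g P \<gamma>) ?H"
  have g1: "G |= rel g x y \<longleftrightarrow> G |= (x \<^bold>\<in> P) \<and> (\<exists>e. G |= rel s x e \<and> G |= is_opair e x y)"
    if "G |= is_image g P \<gamma>" for G x y
  proof -
    have "G |= rel g x y \<longleftrightarrow> (\<exists>q x' y'. G |= (x' \<^bold>\<in> P) \<and> G |= is_opair q x' y' \<and>
        (\<exists>e. G |= rel s x' e \<and> G |= is_opair e x' y') \<and> G |= is_opair q x y)"
      unfolding forces_rel_iff[of G g] forces_imageD[OF that] \<gamma> by blast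
    also have "\<dots> \<longleftrightarrow> G |= (x \<^bold>\<in> P) \<and> (\<exists>e. G |= rel s x e \<and> G |= is_opair e x y)"
      by (meson forces_opair_cong forces_opair_inject forces_opair_ex forces_mem_cong forces_refl
          forces_rel_cong)
    finally show ?thesis .
  qed
  have g2: "G |= (y \<^bold>\<in> V) \<and> G |= inst2 x y \<psi>" if *: "G ||= ?H'" "G |= rel g x y" for G x y
  proof -
    obtain e where e: "G |= rel s x e" "G |= is_opair e x y" using * g1[of G x y] by auto
    then have "G |= (e \<^bold>\<in> r)" using * forces_func_rel(2)[OF forces_section_func] by (simp, meson)
    then obtain x' y' where "G |= (y' \<^bold>\<in> V)" "G |= is_opair e x' y'" "G |= inst2 x' y' \<psi>"
      using r2 * by (simp, meson)
    then show ?thesis using e(2) forces_inst2_cong[of G x' x y' y \<psi>]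
      by (meson forces_opair_inject forces_mem_cong forces_refl)
  qed
  have "F |= is_func g P V"
  proof (rule forces_funcI[of ?H'])
    fix G q assume *: "G ||= ?H'" "G |= (q \<^bold>\<in> g)"
    then obtain x y where xy: "G |= (x \<^bold>\<in> P)" "G |= is_opair q x y"
      using forces_imageD[of G g P \<gamma> q] unfolding \<gamma> by auto
    then have "G |= rel g x y" using *(2) unfolding forces_rel_iff by blast
    then show "\<exists>u v. G |= (u \<^bold>\<in> P) \<and> G |= (v \<^bold>\<in> V) \<and> G |= is_opair q u v"
      using xy g2[OF *(1)] by blast
  next
    fix G x assume "G ||= ?H'" "G |= (x \<^bold>\<in> P)"
    then show "\<exists>y. G |= rel g x y" using g1[of G x] s1[of G x] by (simp, meson)
  next
    fix G x y y' assume "G ||= ?H'" "G |= rel g x y" "G |= rel g x y'"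
    then show "G |= (y \<^bold>= y')" using g1[of G x] s2[of G x]
      by (simp, meson forces_opair_cong forces_opair_inject forces_refl)
  qed (use r f s g in simp_all)
  then have "F |= is_choice g P V \<psi>"
    by (rule forces_choiceI[of ?H', rotated 2]) (use r f s g g2 in auto)
  then show ?thesis ..
qed

section \<open>Exponentiation\<close>

definition is_exp :: "nat \<Rightarrow> nat \<Rightarrow> nat \<Rightarrow> fm" where
  "is_exp e a b = is_set e (is_func 0 (a+1) (b+1))"

lemma forces_expD: "F |= is_exp e a b \<Longrightarrow> F |= (u \<^bold>\<in> e) \<longleftrightarrow> F |= is_func u a b"
  unfolding is_exp_def by (drule forces_is_setD[of _ _ _ u]) simp

text \<open>
  A function \<open>u : a \<rightarrow> b\<close> equals the set of pairs collected from \<open>a\<close> along \<open>y \<in> u \<and> y = (x, _)\<close>.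
\<close>

lemma forces_exp_ex: "\<exists>e. F |= is_exp e a b"
proof -
  obtain N where N: "F |= is_prod N a b" using forces_prod_ex by blast
  let ?\<psi> = "0 \<^bold>\<in> 2 \<^bold>\<and> Exists (is_opair 1 2 0)"
  obtain c where c: "F |= is_subset_coll c a N ?\<psi>" using forces_subset_collection by blast
  \<comment> \<open>\<open>c\<close> contains every function from \<open>a\<close> to
    \<open>b\<close> but possibly other sets too; being such a function is a restricted condition,
    so separation removes the rest.\<close>
  obtain e where e: "F |= is_set e (0 \<^bold>\<in> Suc c \<^bold>\<and> is_func 0 (a+1) (b+1))"
    using forces_separation restricted_func by blast
  let ?H = "{is_prod N a b, is_subset_coll c a N ?\<psi>, is_set e (0 \<^bold>\<in> Suc c \<^bold>\<and> is_func 0 (a+1) (b+1))}"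
  have "F |= is_exp e a b"
    unfolding is_exp_def
  proof (rule forces_is_setI[of ?H])
    fix G u assume "G ||= ?H"
    then have N: "G |= is_prod N a b" and c: "G |= is_subset_coll c a N ?\<psi>"
      and e: "G |= is_set e (0 \<^bold>\<in> Suc c \<^bold>\<and> is_func 0 (a+1) (b+1))" by simp_all
    have "G |= (u \<^bold>\<in> c)" if u: "G |= is_func u a b"
    proof -
      let ?\<chi> = "0 \<^bold>\<in> u+2 \<^bold>\<and> Exists (is_opair 1 2 0)"
      have "G |= BForall a (BExists (Suc N) ?\<chi>)"
      proof (rule forces_BForallI[of "{is_prod N a b, is_func u a b}"])
        fix G x assume *: "G ||= {is_prod N a b, is_func u a b}" "G |= (x \<^bold>\<in> a)"
        then obtain v p where "G |= (v \<^bold>\<in> b)" "G |= (p \<^bold>\<in> u)" "G |= is_opair p x v"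
          using forces_func_total[of G u a b x] forces_rel_iff by auto
        then show "G |= inst x (BExists (Suc N) ?\<chi>)"
          using * forces_prodD[of G N a b p] by (auto simp: numeral_eq_Suc)
      qed (use u N in auto)
      then obtain d where d: "G |= (d \<^bold>\<in> c)" "G |= is_coll d a ?\<chi>"
        using is_subset_collD[OF c, of u] by (auto simp: numeral_eq_Suc)
      have "G |= (d \<^bold>= u)"
      proof (rule forces_set_eqI[of "{is_coll d a ?\<chi>, is_func u a b}"])
        fix G y assume "G ||= {is_coll d a ?\<chi>, is_func u a b}"
        then have d: "G |= is_coll d a ?\<chi>" and u: "G |= is_func u a b" by simp_all
        show "G |= (y \<^bold>\<in> d) \<longleftrightarrow> G |= (y \<^bold>\<in> u)"
        proof
          assume "G |= (y \<^bold>\<in> d)"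
          from is_collD2[OF d this] show "G |= (y \<^bold>\<in> u)" by auto
        next
          assume y: "G |= (y \<^bold>\<in> u)"
          then obtain x v where x: "G |= (x \<^bold>\<in> a)" "G |= is_opair y x v"
            using forces_relationD forces_func_relation u by blast
          from is_collD1[OF d x(1)] obtain y' v' where
            y': "G |= (y' \<^bold>\<in> d)" "G |= (y' \<^bold>\<in> u)" "G |= is_opair y' x v'"
            by (auto simp: numeral_eq_Suc)
          have "G |= (v' \<^bold>= v)"
            using forces_func_unique[OF u] x y y' unfolding forces_rel_iff by blast
          then have "G |= (y' \<^bold>= y)"
            using x y' by (meson forces_opair_cong forces_opair_unique forces_refl)
          then show "G |= (y \<^bold>\<in> d)" using y'(1) by (meson forces_mem_cong forces_refl)
        qed
      qed (use d u in auto)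
      then show ?thesis using d(1) by (meson forces_mem_cong forces_refl)
    qed
    then show "G |= (u \<^bold>\<in> e) \<longleftrightarrow> G |= inst u (is_func 0 (a+1) (b+1))"
      using forces_is_setD[OF e, of u] by auto
  qed (use N c e in auto)
  then show ?thesis ..
qed

text \<open>Tagging makes covers that belong to different \<open>\<alpha>\<close> disjoint. An
  element then determines its \<open>\<alpha>\<close>, and the chosen covers become the fibres of
  one map.\<close>

definition is_tagged :: "nat \<Rightarrow> nat \<Rightarrow> fm" where
  "is_tagged Z \<alpha> = BForall Z (Exists (is_opair 1 (\<alpha>+2) 0))"

lemma rename_tagged [simp]: "rename f (is_tagged Z \<alpha>) = is_tagged (f Z) (f \<alpha>)"
  by (simp add: is_tagged_def numeral_eq_Suc)

lemma forces_taggedD: "F |= is_tagged Z \<alpha> \<Longrightarrow> F |= (z \<^bold>\<in> Z) \<Longrightarrow> \<exists>p. F |= is_opair z \<alpha> p"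
  unfolding is_tagged_def by (drule forces_BForallD) (simp_all add: numeral_eq_Suc)

text \<open>\<open>(\<alpha>, p) \<mapsto> x\<close> whenever \<open>g : p \<mapsto> x\<close>\<close>

definition is_tag_map :: "nat \<Rightarrow> nat \<Rightarrow> nat \<Rightarrow> fm" where
  "is_tag_map k g \<alpha> = is_image k g (Exists (Exists (Exists
     (is_opair 4 2 1 \<^bold>\<and> is_opair 0 (\<alpha>+5) 2 \<^bold>\<and> is_opair 3 0 1))))"

lemma forces_tag_mapD:
  assumes "F |= is_tag_map k g \<alpha>"
  shows "F |= (q \<^bold>\<in> k) \<longleftrightarrow> (\<exists>p x z. F |= rel g p x \<and> F |= is_opair z \<alpha> p \<and> F |= is_opair q z x)"
  using forces_imageD[OF assms[unfolded is_tag_map_def], of q]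
  by (auto simp: numeral_eq_Suc forces_rel_iff)

lemma forces_tag_map_rel:
  assumes "F |= is_tag_map k g \<alpha>"
  shows "F |= rel k z x \<longleftrightarrow> (\<exists>p. F |= is_opair z \<alpha> p \<and> F |= rel g p x)"
proof
  assume "F |= rel k z x"
  then obtain q p x' z' where *: "F |= is_opair q z x" "F |= rel g p x'" "F |= is_opair z' \<alpha> p"
    "F |= is_opair q z' x'"
    unfolding forces_rel_iff[of F k] forces_tag_mapD[OF assms] by blast
  then have "F |= (z' \<^bold>= z)" "F |= (x' \<^bold>= x)" using forces_opair_inject by blast+
  then show "\<exists>p. F |= is_opair z \<alpha> p \<and> F |= rel g p x"
    using * by (meson forces_opair_cong forces_rel_cong forces_refl)
next
  assume "\<exists>p. F |= is_opair z \<alpha> p \<and> F |= rel g p x"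
  then show "F |= rel k z x"
    unfolding forces_rel_iff[of F k] forces_tag_mapD[OF assms] using forces_opair_ex by blast
qed

lemma forces_tag_map_ex:
  assumes "F |= is_func g P X"
  shows "\<exists>k. F |= is_tag_map k g \<alpha>"
  unfolding is_tag_map_def
proof (rule forces_replacement[of "{is_func g P X}"])
  fix G e assume "G ||= {is_func g P X}" "G |= (e \<^bold>\<in> g)"
  then obtain p x where "G |= is_opair e p x"
    using forces_relationD[OF forces_func_relation] by (simp, meson)
  moreover obtain z where z: "G |= is_opair z \<alpha> p" using forces_opair_ex by meson
  moreover obtain q where "G |= is_opair q z x" using forces_opair_ex by meson
  ultimately show "\<exists>y. G |= inst2 e y (Exists (Exists (Exists
     (is_opair 4 2 1 \<^bold>\<and> is_opair 0 (\<alpha>+5) 2 \<^bold>\<and> is_opair 3 0 1))))"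
    by (simp add: numeral_eq_Suc) blast
next
  fix G e q q' assume "G |= inst2 e q (Exists (Exists (Exists
     (is_opair 4 2 1 \<^bold>\<and> is_opair 0 (\<alpha>+5) 2 \<^bold>\<and> is_opair 3 0 1))))"
   "G |= inst2 e q' (Exists (Exists (Exists
     (is_opair 4 2 1 \<^bold>\<and> is_opair 0 (\<alpha>+5) 2 \<^bold>\<and> is_opair 3 0 1))))"
  then obtain p x z p' x' z' where "G |= is_opair e p x" "G |= is_opair z \<alpha> p" "G |= is_opair q z x"
    "G |= is_opair e p' x'" "G |= is_opair z' \<alpha> p'" "G |= is_opair q' z' x'"
    by (simp add: numeral_eq_Suc) blast
  then show "G |= (q \<^bold>= q')"
    by (meson forces_opair_cong forces_opair_inject forces_opair_unique forces_refl)
qed (use assms in auto)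

lemma forces_tag_map_func:
  assumes g: "F |= is_func g P X" and Z: "F |= is_image Z P (is_opair 0 (\<alpha>+2) 1)"
    and k: "F |= is_tag_map k g \<alpha>"
  shows "F |= is_func k Z X"
proof -
  let ?H = "{is_func g P X, is_image Z P (is_opair 0 (\<alpha>+2) 1), is_tag_map k g \<alpha>}"
  have ZD: "G |= (z \<^bold>\<in> Z) \<longleftrightarrow> (\<exists>p. G |= (p \<^bold>\<in> P) \<and> G |= is_opair z \<alpha> p)" if "G ||= ?H" for G z
    using that forces_imageD[of G Z P "is_opair 0 (\<alpha>+2) 1" z] by (simp add: numeral_eq_Suc)
  show ?thesis
  proof (rule forces_funcI[of ?H])
    fix G q assume *: "G ||= ?H" "G |= (q \<^bold>\<in> k)"
    then obtain p x z where "G |= rel g p x" "G |= is_opair z \<alpha> p" "G |= is_opair q z x"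
      using forces_tag_mapD by auto
    then show "\<exists>u v. G |= (u \<^bold>\<in> Z) \<and> G |= (v \<^bold>\<in> X) \<and> G |= is_opair q u v"
      using ZD[OF *(1)] * forces_func_rel[of G g P X] by (simp, meson)
  next
    fix G z assume *: "G ||= ?H" "G |= (z \<^bold>\<in> Z)"
    then obtain p where "G |= (p \<^bold>\<in> P)" "G |= is_opair z \<alpha> p" using ZD by blast
    then show "\<exists>x. G |= rel k z x"
      using * forces_func_total[of G g P X p] forces_tag_map_rel by (simp, meson)
  next
    fix G z x x' assume *: "G ||= ?H" "G |= rel k z x" "G |= rel k z x'"
    then have k: "G |= is_tag_map k g \<alpha>" and g: "G |= is_func g P X" by simp_all
    obtain p p' where "G |= is_opair z \<alpha> p" "G |= rel g p x" "G |= is_opair z \<alpha> p'" "G |= rel g p' x'"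
      using *(2,3) unfolding forces_tag_map_rel[OF k] by blast
    then show "G |= (x \<^bold>= x')"
      using forces_func_unique[OF g] by (meson forces_opair_inject forces_rel_cong forces_refl)
  qed (use assms in auto)
qed

text \<open>Being a base is transported along the bijection sending \<open>p\<close> to
  \<open>(\<alpha>, p)\<close>: for a surjection \<open>k\<close> onto \<open>Z\<close>, an
  \<open>x\<close> with \<open>k x = (\<alpha>, p)\<close> is chosen over the base \<open>P\<close>,
  and the choice function is tagged to give a section.\<close>

lemma forces_base_tag:
  assumes P: "F |= is_base P" and Z: "F |= is_image Z P (is_opair 0 (\<alpha>+2) 1)"
  shows "F |= is_base Z"
proof (rule forces_baseI[of "{is_base P, is_image Z P (is_opair 0 (\<alpha>+2) 1)}"])
  fix G X k assume *: "G ||= {is_base P, is_image Z P (is_opair 0 (\<alpha>+2) 1)}" "G |= is_surj k X Z"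
  then have P: "G |= is_base P" and Z: "G |= is_image Z P (is_opair 0 (\<alpha>+2) 1)" by simp_all
  define \<psi> where "\<psi> = Exists (is_opair 0 (\<alpha>+3) 2 \<^bold>\<and> rel (k+3) 1 0)"
  have \<psi>: "G |= inst2 p x \<psi> \<longleftrightarrow> (\<exists>z. G |= is_opair z \<alpha> p \<and> G |= rel k x z)" for G p x
    by (simp add: \<psi>_def numeral_eq_Suc)
  have ZD: "G |= (z \<^bold>\<in> Z) \<longleftrightarrow> (\<exists>p. G |= (p \<^bold>\<in> P) \<and> G |= is_opair z \<alpha> p)"
    if "G |= is_image Z P (is_opair 0 (\<alpha>+2) 1)" for G z
    using that forces_imageD[of G Z P "is_opair 0 (\<alpha>+2) 1" z] by (simp add: numeral_eq_Suc)
  let ?H = "{is_image Z P (is_opair 0 (\<alpha>+2) 1), is_surj k X Z}"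
  have "\<exists>g. G |= is_choice g P X \<psi>"
  proof (rule forces_base_choice[of ?H])
    fix G p assume "G ||= ?H" "G |= (p \<^bold>\<in> P)"
    then show "\<exists>x. G |= (x \<^bold>\<in> X) \<and> G |= inst2 p x \<psi>"
      unfolding \<psi> using ZD[of G] forces_opair_ex[of G \<alpha> p] forces_surjD[of G k X Z] by (simp, meson)
  qed (use P * in auto)
  then obtain g where g: "G |= is_choice g P X \<psi>" ..
  note gf = forces_choice_func[OF g]
  obtain s where s: "G |= is_tag_map s g \<alpha>" using forces_tag_map_ex[OF gf] by blast
  have "G |= is_section s Z X k"
  proof (rule forces_sectionI[of "insert (is_choice g P X \<psi>) (insert (is_tag_map s g \<alpha>) ?H)"])
    show "G |= is_func s Z X" by (rule forces_tag_map_func[OF gf Z s])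
    fix G z assume *: "G ||= insert (is_choice g P X \<psi>) (insert (is_tag_map s g \<alpha>) ?H)" "G |= (z \<^bold>\<in> Z)"
    then obtain p where p: "G |= (p \<^bold>\<in> P)" "G |= is_opair z \<alpha> p" using ZD by auto
    obtain x where x: "G |= (x \<^bold>\<in> X)" "G |= rel g p x"
      using forces_func_total[OF forces_choice_func p(1)] * by (simp, meson)
    then have "G |= inst2 p x \<psi>" using forces_choiceD * by (simp, meson)
    then obtain z' where "G |= is_opair z' \<alpha> p" "G |= rel k x z'" unfolding \<psi> by blast
    then have "G |= rel k x z" using p(2) by (meson forces_opair_unique forces_rel_cong forces_refl)
    then show "\<exists>x. G |= (x \<^bold>\<in> X) \<and> G |= rel s z x \<and> G |= rel k x z"
      using x p * forces_tag_map_rel by (simp, meson)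
  qed (use g s * Z in auto)
  then show "\<exists>s. G |= is_section s Z X k" ..
qed (use assms in auto)

lemma forces_tagged_cover:
  "\<exists>Z \<pi>. F |= is_base Z \<and> F |= is_tagged Z \<alpha> \<and> F |= is_surj \<pi> Z a"
proof -
  obtain P f where P: "F |= is_base P" and f: "F |= is_surj f P a" using forces_PA by blast
  have "\<exists>Z. F |= is_image Z P (is_opair 0 (\<alpha>+2) 1)"
    by (rule forces_replacement[of "{}"])
      (simp_all add: numeral_eq_Suc forces_opair_ex forces_opair_unique)
  then obtain Z where Z: "F |= is_image Z P (is_opair 0 (\<alpha>+2) 1)" ..
  obtain k where k: "F |= is_tag_map k f \<alpha>"
    using forces_tag_map_ex[OF forces_surj_func[OF f]] by blast
  have ZD: "G |= (z \<^bold>\<in> Z) \<longleftrightarrow> (\<exists>p. G |= (p \<^bold>\<in> P) \<and> G |= is_opair z \<alpha> p)"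
    if "G |= is_image Z P (is_opair 0 (\<alpha>+2) 1)" for G z
    using that forces_imageD[of G Z P "is_opair 0 (\<alpha>+2) 1" z] by (simp add: numeral_eq_Suc)
  let ?H = "{is_image Z P (is_opair 0 (\<alpha>+2) 1), is_tag_map k f \<alpha>, is_surj f P a}"
  have "F |= is_tagged Z \<alpha>"
    unfolding is_tagged_def
    by (rule forces_BForallI[of ?H]) (use ZD Z k f in \<open>auto simp: numeral_eq_Suc\<close>)
  moreover have "F |= is_surj k Z a"
  proof (rule forces_surjI[of ?H])
    show "F |= is_func k Z a" by (rule forces_tag_map_func[OF forces_surj_func[OF f] Z k])
    fix G v assume *: "G ||= ?H" "G |= (v \<^bold>\<in> a)"
    then obtain p where "G |= (p \<^bold>\<in> P)" "G |= rel f p v" using forces_surjD[of G f P a v] by auto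
    then show "\<exists>z. G |= (z \<^bold>\<in> Z) \<and> G |= rel k z v"
      using * ZD[of G] forces_tag_map_rel[of G k f \<alpha>] forces_opair_ex[of G \<alpha> p] by (simp, meson)
  qed (use Z k f in auto)
  ultimately show ?thesis using forces_base_tag[OF P Z] by blast
qed

section \<open>Rules presented by a base map\<close>

lemma forces_rulesD:
  assumes "F |= are_rules R X" "F |= (p \<^bold>\<in> R)"
  shows "\<exists>a b. F |= is_subset a X \<and> F |= is_subset b X \<and> F |= is_opair p a b"
  using forces_BForallD[OF assms(1)[unfolded are_rules_def] assms(2)] by (simp add: numeral_eq_Suc)

lemma forces_rulesI:
  assumes "finite H" "F ||= H"
    "\<And>G p. G ||= H \<Longrightarrow> G |= (p \<^bold>\<in> R) \<Longrightarrow>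
      \<exists>a b. G |= is_subset a X \<and> G |= is_subset b X \<and> G |= is_opair p a b"
  shows "F |= are_rules R X"
  unfolding are_rules_def
  by (rule forces_BForallI[OF assms(1,2)]) (use assms(3) in \<open>simp add: numeral_eq_Suc\<close>)

lemma forces_closed_subset: "F |= is_closed Y X R \<Longrightarrow> F |= is_subset Y X"
  by (simp add: is_closed_def)

lemma forces_closedD:
  assumes "F |= is_closed Y X R" "F |= rel R a b" "F |= is_subset a Y"
  shows "\<exists>z. F |= (z \<^bold>\<in> b) \<and> F |= (z \<^bold>\<in> Y)"
proof -
  have "F |= Forall (Forall (rel (R+2) 1 0 \<^bold>\<longrightarrow> is_subset 1 (Y+2) \<^bold>\<longrightarrow> BExists 0 (0 \<^bold>\<in> Y+3)))"
    using assms(1) by (simp add: is_closed_def)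
  from forces_spec2[OF this, where x = a and y = b]
  have "F |= (rel R a b \<^bold>\<longrightarrow> is_subset a Y \<^bold>\<longrightarrow> BExists b (0 \<^bold>\<in> Y+1))"
    by (simp add: numeral_eq_Suc)
  from forces_mp[OF forces_mp[OF this assms(2)] assms(3)] show ?thesis by simp
qed

lemma forces_closedI:
  assumes H: "finite H" "F ||= H" and sub: "F |= is_subset Y X"
    and cl: "\<And>G a b. G ||= H \<Longrightarrow> G |= rel R a b \<Longrightarrow> G |= is_subset a Y \<Longrightarrow>
      \<exists>z. G |= (z \<^bold>\<in> b) \<and> G |= (z \<^bold>\<in> Y)"
  shows "F |= is_closed Y X R"
proof -
  have "F |= Forall (Forall (rel (R+2) 1 0 \<^bold>\<longrightarrow> is_subset 1 (Y+2) \<^bold>\<longrightarrow> BExists 0 (0 \<^bold>\<in> Y+3)))"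
  proof (rule forces_ForallI[OF H])
    fix G a assume G: "G ||= H"
    have "G |= Forall (rel (R+1) (a+1) 0 \<^bold>\<longrightarrow> is_subset (a+1) (Y+1) \<^bold>\<longrightarrow> BExists 0 (0 \<^bold>\<in> Y+2))"
    proof (rule forces_ForallI[OF H(1) G])
      fix G b assume G: "G ||= H"
      have "G |= (rel R a b \<^bold>\<longrightarrow> is_subset a Y \<^bold>\<longrightarrow> BExists b (0 \<^bold>\<in> Y+1))"
      proof (rule forces_implI[OF H(1) G])
        fix G assume "G ||= H" "G |= rel R a b"
        then show "G |= (is_subset a Y \<^bold>\<longrightarrow> BExists b (0 \<^bold>\<in> Y+1))"
          by (intro forces_implI[of "insert (rel R a b) H"]) (use H cl in auto)
      qed
      then show "G |= inst b (rel (R+1) (a+1) 0 \<^bold>\<longrightarrow> is_subset (a+1) (Y+1) \<^bold>\<longrightarrow> BExists 0 (0 \<^bold>\<in> Y+2))"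
        by (simp add: numeral_eq_Suc)
    qed
    then show "G |= inst a (Forall (rel (R+2) 1 0 \<^bold>\<longrightarrow> is_subset 1 (Y+2) \<^bold>\<longrightarrow> BExists 0 (0 \<^bold>\<in> Y+3)))"
      by (simp add: numeral_eq_Suc)
  qed
  then show ?thesis using sub by (simp add: is_closed_def)
qed

lemma forces_fibreD: "F |= is_fibre z f a \<Longrightarrow> F |= (b \<^bold>\<in> z) \<longleftrightarrow> F |= rel f b a"
  using forces_is_setD[of F z "rel (f+1) 0 (a+1)" b] by (simp add: is_fibre_def is_set_def)

lemma forces_fibreI:
  assumes "finite H" "F ||= H"
    "\<And>G b. G ||= H \<Longrightarrow> G |= (b \<^bold>\<in> z) \<longleftrightarrow> G |= rel f b a"
  shows "F |= is_fibre z f a"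
  using forces_is_setI[OF assms(1,2), of z "rel (f+1) 0 (a+1)"] assms(3)
  by (simp add: is_fibre_def is_set_def)

text \<open>\<open>(a, b)\<close> is the rule attached to \<open>\<alpha>\<close> by \<open>g\<close>, and the base \<open>Z\<close> covers its premise.\<close>

definition is_premise_cover :: "nat \<Rightarrow> nat \<Rightarrow> nat \<Rightarrow> nat \<Rightarrow> nat \<Rightarrow> fm" where
  "is_premise_cover Z a b g \<alpha> = (is_base Z \<^bold>\<and> Exists (is_surj 0 (Z+1) (a+1)) \<^bold>\<and>
     Exists (rel (g+1) (\<alpha>+1) 0 \<^bold>\<and> is_opair 0 (a+1) (b+1)))"

lemma rename_premise_cover [simp]: "rename f (is_premise_cover Z a b g \<alpha>) =
    is_premise_cover (f Z) (f a) (f b) (f g) (f \<alpha>)"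
  by (simp add: is_premise_cover_def)

text \<open>\<open>D\<close> is a set having all fibres as members. A transitive \<open>U\<close>
  with \<open>D\<close> as an element then has every fibre as an element.\<close>

definition is_presentation :: "nat \<Rightarrow> nat \<Rightarrow> nat \<Rightarrow> nat \<Rightarrow> fm" where
  "is_presentation f A g D = BForall A (Exists (Exists (Exists
     (is_fibre 2 (f+4) 3 \<^bold>\<and> 2 \<^bold>\<in> D+4 \<^bold>\<and> is_premise_cover 2 1 0 (g+4) 3))))"

lemma forces_presentationD:
  assumes "F |= is_presentation f A g D" "F |= (\<alpha> \<^bold>\<in> A)"
  shows "\<exists>Z a b. F |= is_fibre Z f \<alpha> \<and> F |= (Z \<^bold>\<in> D) \<and> F |= is_premise_cover Z a b g \<alpha>"
  using forces_BForallD[OF assms(1)[unfolded is_presentation_def] assms(2)]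
  by (simp add: numeral_eq_Suc)

text \<open>\<open>PA\<close> only says that covers of a premise exist, so one has to be picked for
  each \<open>\<alpha>\<close>; this is possible because \<open>A\<close> is a base.
  \<open>B\<close> is the union of the chosen covers, and \<open>f\<close> sends the elements of the
  cover chosen for \<open>\<alpha>\<close> to \<open>\<alpha>\<close>.\<close>

lemma forces_presentation_ex:
  assumes rules: "F |= are_rules R X"
  shows "\<exists>A g B f D. F |= is_base_map f B A \<and> F |= is_surj g A R \<and> F |= is_presentation f A g D"
proof -
  obtain A g where A: "F |= is_base A" and g: "F |= is_surj g A R" using forces_PA by blast
  define \<psi> where "\<psi> = (is_tagged 0 1 \<^bold>\<and> Exists (Exists (is_premise_cover 2 1 0 (g+4) 3)))"
  have \<psi>: "G |= inst2 \<alpha> Z \<psi> \<longleftrightarrow> G |= is_tagged Z \<alpha> \<and> (\<exists>a b. G |= is_premise_cover Z a b g \<alpha>)"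
    for G \<alpha> Z
    by (simp add: \<psi>_def numeral_eq_Suc)
  have "\<exists>C. F |= is_coll C A \<psi>"
  proof (rule forces_collection[of "{are_rules R X, is_surj g A R}"])
    fix G \<alpha> assume *: "G ||= {are_rules R X, is_surj g A R}" "G |= (\<alpha> \<^bold>\<in> A)"
    then obtain r where r: "G |= (r \<^bold>\<in> R)" "G |= rel g \<alpha> r"
      using forces_func_total[OF forces_surj_func] by (simp, meson)
    then obtain a b where "G |= is_opair r a b" using * forces_rulesD by (simp, meson)
    then show "\<exists>Z. G |= inst2 \<alpha> Z \<psi>"
      unfolding \<psi> is_premise_cover_def using r forces_tagged_cover[of G \<alpha> a] by auto
  qed (use rules g in auto)
  then obtain C where C: "F |= is_coll C A \<psi>" ..
  have "\<exists>c. F |= is_choice c A C \<psi>"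
    by (rule forces_base_choice[of "{is_coll C A \<psi>}"]) (use A C in \<open>auto dest: is_collD1\<close>)
  then obtain c where c: "F |= is_choice c A C \<psi>" ..
  obtain V where V: "F |= is_set V (BExists (Suc C) (1 \<^bold>\<in> 0))" using forces_union_ex by blast
  \<comment> \<open>The collected \<open>C\<close> may contain covers that \<open>c\<close> does not
    choose; leaving out their elements makes \<open>f\<close> total on \<open>B\<close>.\<close>
  define \<beta> where "\<beta> = BExists (A+1) (BExists (C+2) (rel (c+3) 1 0 \<^bold>\<and> 2 \<^bold>\<in> 0))"
  have "restricted \<beta>" unfolding \<beta>_def by (intro restricted_intros)
  then obtain B where B: "F |= is_set B (0 \<^bold>\<in> Suc V \<^bold>\<and> \<beta>)" using forces_separation by blast
  obtain N where N: "F |= is_prod N B A" using forces_prod_ex by blast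
  define \<phi> where "\<phi> = BExists (A+1) (BExists (B+2) (BExists (C+3)
    (is_opair 3 1 2 \<^bold>\<and> rel (c+4) 2 0 \<^bold>\<and> 1 \<^bold>\<in> 0)))"
  have "restricted \<phi>" unfolding \<phi>_def by (intro restricted_intros)
  then obtain f where f: "F |= is_set f (0 \<^bold>\<in> Suc N \<^bold>\<and> \<phi>)" using forces_separation by blast
  let ?H = "{is_choice c A C \<psi>, is_set V (BExists (Suc C) (1 \<^bold>\<in> 0)), is_set B (0 \<^bold>\<in> Suc V \<^bold>\<and> \<beta>),
    is_prod N B A, is_set f (0 \<^bold>\<in> Suc N \<^bold>\<and> \<phi>)}"
  have H: "F ||= ?H" using c V B N f by simp
  have cD: "G |= (\<alpha> \<^bold>\<in> A) \<and> G |= (Z \<^bold>\<in> C) \<and> G |= is_tagged Z \<alpha> \<and> (\<exists>a b. G |= is_premise_cover Z a b g \<alpha>)"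
    if "G ||= ?H" "G |= rel c \<alpha> Z" for G \<alpha> Z
    using that forces_choiceD[of G c A C \<psi> \<alpha> Z] forces_func_rel[OF forces_choice_func, of G c A C \<psi>]
    unfolding \<psi> by auto
  have BD: "G |= (z \<^bold>\<in> B) \<longleftrightarrow> (\<exists>\<alpha> Z. G |= rel c \<alpha> Z \<and> G |= (z \<^bold>\<in> Z))" if H: "G ||= ?H" for G z
  proof -
    have "G |= (z \<^bold>\<in> B) \<longleftrightarrow> G |= (z \<^bold>\<in> V) \<and> G |= inst z \<beta>"
      using H forces_is_setD[of G B "0 \<^bold>\<in> Suc V \<^bold>\<and> \<beta>" z] by simp
    also have "G |= (z \<^bold>\<in> V) \<longleftrightarrow> (\<exists>Z. G |= (Z \<^bold>\<in> C) \<and> G |= (z \<^bold>\<in> Z))"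
      using H forces_is_setD[of G V "BExists (Suc C) (1 \<^bold>\<in> 0)" z] by simp
    also have "G |= inst z \<beta> \<longleftrightarrow> (\<exists>\<alpha>. G |= (\<alpha> \<^bold>\<in> A) \<and> (\<exists>Z. G |= (Z \<^bold>\<in> C) \<and> G |= rel c \<alpha> Z \<and> G |= (z \<^bold>\<in> Z)))"
      by (simp add: \<beta>_def numeral_eq_Suc)
    finally show ?thesis using cD[OF H] by blast
  qed
  have fD: "G |= (q \<^bold>\<in> f) \<longleftrightarrow> (\<exists>\<alpha> z Z. G |= is_opair q z \<alpha> \<and> G |= rel c \<alpha> Z \<and> G |= (z \<^bold>\<in> Z))"
    if H: "G ||= ?H" for G q
  proof -
    have "G |= (q \<^bold>\<in> f) \<longleftrightarrow> G |= (q \<^bold>\<in> N) \<and> G |= inst q \<phi>"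
      using H forces_is_setD[of G f "0 \<^bold>\<in> Suc N \<^bold>\<and> \<phi>" q] by simp
    also have "G |= (q \<^bold>\<in> N) \<longleftrightarrow> (\<exists>u v. G |= (u \<^bold>\<in> B) \<and> G |= (v \<^bold>\<in> A) \<and> G |= is_opair q u v)"
      using H forces_prodD by simp
    also have "G |= inst q \<phi> \<longleftrightarrow> (\<exists>\<alpha>. G |= (\<alpha> \<^bold>\<in> A) \<and> (\<exists>z. G |= (z \<^bold>\<in> B) \<and> (\<exists>Z. G |= (Z \<^bold>\<in> C) \<and>
        G |= is_opair q z \<alpha> \<and> G |= rel c \<alpha> Z \<and> G |= (z \<^bold>\<in> Z))))"
      by (simp add: \<phi>_def numeral_eq_Suc)
    finally show ?thesis using cD[OF H] BD[OF H] by blast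
  qed
  have frel: "G |= rel f z \<alpha> \<longleftrightarrow> (\<exists>Z. G |= rel c \<alpha> Z \<and> G |= (z \<^bold>\<in> Z))" if H: "G ||= ?H" for G z \<alpha>
  proof
    assume "G |= rel f z \<alpha>"
    then obtain q \<alpha>' z' Z where "G |= is_opair q z \<alpha>" "G |= is_opair q z' \<alpha>'" "G |= rel c \<alpha>' Z" "G |= (z' \<^bold>\<in> Z)"
      unfolding forces_rel_iff[of G f] fD[OF H] by blast
    then show "\<exists>Z. G |= rel c \<alpha> Z \<and> G |= (z \<^bold>\<in> Z)"
      by (meson forces_opair_inject forces_rel_cong forces_mem_cong forces_refl)
  next
    assume "\<exists>Z. G |= rel c \<alpha> Z \<and> G |= (z \<^bold>\<in> Z)"
    then show "G |= rel f z \<alpha>"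
      unfolding forces_rel_iff[of G f] fD[OF H] using forces_opair_ex by blast
  qed
  have ff: "F |= is_func f B A"
  proof (rule forces_funcI[OF _ H])
    fix G q assume *: "G ||= ?H" "G |= (q \<^bold>\<in> f)"
    show "\<exists>u v. G |= (u \<^bold>\<in> B) \<and> G |= (v \<^bold>\<in> A) \<and> G |= is_opair q u v"
      using *(2) BD[OF *(1)] cD[OF *(1)] unfolding fD[OF *(1)] by blast
  next
    fix G z assume *: "G ||= ?H" "G |= (z \<^bold>\<in> B)"
    then show "\<exists>\<alpha>. G |= rel f z \<alpha>" using frel[OF *(1)] BD[OF *(1)] by blast
  next
    \<comment> \<open>The element \<open>z\<close> carries both tags, so injectivity of pairs
      identifies them.\<close>
    fix G z \<alpha> \<alpha>' assume *: "G ||= ?H" "G |= rel f z \<alpha>" "G |= rel f z \<alpha>'"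
    then obtain p p' where "G |= is_opair z \<alpha> p" "G |= is_opair z \<alpha>' p'"
      using frel[OF *(1)] cD[OF *(1)] forces_taggedD by meson
    then show "G |= (\<alpha> \<^bold>= \<alpha>')" using forces_opair_inject by blast
  qed simp
  have fib: "\<exists>Z. G |= is_fibre Z f \<alpha> \<and> G |= (Z \<^bold>\<in> C) \<and> (\<exists>a b. G |= is_premise_cover Z a b g \<alpha>)"
    if H: "G ||= ?H" and \<alpha>: "G |= (\<alpha> \<^bold>\<in> A)" for G \<alpha>
  proof -
    obtain Z where Z: "G |= rel c \<alpha> Z"
      using forces_func_total[OF forces_choice_func \<alpha>] H by (simp, meson)
    have "G |= is_fibre Z f \<alpha>"
    proof (rule forces_fibreI[of "insert (rel c \<alpha> Z) ?H"])
      fix G z assume *: "G ||= insert (rel c \<alpha> Z) ?H"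
      then have H: "G ||= ?H" and Z: "G |= rel c \<alpha> Z" by simp_all
      have "G |= (Z' \<^bold>= Z)" if "G |= rel c \<alpha> Z'" for Z'
        using forces_func_unique[OF forces_choice_func that Z] H by (simp, meson)
      then show "G |= (z \<^bold>\<in> Z) \<longleftrightarrow> G |= rel f z \<alpha>"
        unfolding frel[OF H] using Z by (meson forces_mem_cong forces_refl)
    qed (use H Z in auto)
    then show ?thesis using cD[OF H Z] by blast
  qed
  have "F |= BForall A (Exists (is_fibre 0 (f+2) 1 \<^bold>\<and> is_base 0))"
  proof (rule forces_BForallI[OF _ H])
    fix G \<alpha> assume "G ||= ?H" "G |= (\<alpha> \<^bold>\<in> A)"
    from fib[OF this] show "G |= inst \<alpha> (Exists (is_fibre 0 (f+2) 1 \<^bold>\<and> is_base 0))"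
      by (auto simp: is_premise_cover_def numeral_eq_Suc)
  qed simp
  then have "F |= is_base_map f B A" using ff A by (simp add: is_base_map_def)
  moreover have "F |= is_presentation f A g C"
    unfolding is_presentation_def
  proof (rule forces_BForallI[OF _ H])
    fix G \<alpha> assume "G ||= ?H" "G |= (\<alpha> \<^bold>\<in> A)"
    from fib[OF this] show "G |= inst \<alpha> (Exists (Exists (Exists
     (is_fibre 2 (f+4) 3 \<^bold>\<and> 2 \<^bold>\<in> C+4 \<^bold>\<and> is_premise_cover 2 1 0 (g+4) 3))))"
      by (auto simp: numeral_eq_Suc)
  qed simp
  ultimately show ?thesis using g by blast
qed

section \<open>Conditional application of a rule\<close>

lemma forces_empty_ex: "\<exists>e. F |= is_empty e"
proof -
  \<comment> \<open>Every variable denotes a set, so separation can be applied to variable 0,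
    whatever it stands for.\<close>
  obtain e where e: "F |= is_set e (0 \<^bold>\<in> Suc 0 \<^bold>\<and> \<^bold>\<bottom>)"
    using forces_separation restricted_atoms(3) by blast
  have "F |= is_empty e"
    unfolding is_empty_def
  proof (rule forces_ForallI[of "{is_set e (0 \<^bold>\<in> Suc 0 \<^bold>\<and> \<^bold>\<bottom>)}"])
    fix G x assume G: "G ||= {is_set e (0 \<^bold>\<in> Suc 0 \<^bold>\<and> \<^bold>\<bottom>)}"
    have "G |= (x \<^bold>\<in> e \<^bold>\<longrightarrow> \<^bold>\<bottom>)"
      by (rule forces_implI[OF _ G]) (auto dest: forces_is_setD)
    then show "G |= inst x (\<^bold>\<not> 0 \<^bold>\<in> e+1)" by simp
  qed (use e in auto)
  then show ?thesis ..
qed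

lemma forces_emptyD: "F |= is_empty e \<Longrightarrow> F |= (x \<^bold>\<in> e) \<Longrightarrow> F |= \<phi>"
  unfolding is_empty_def
  by (drule forces_spec[of _ _ x]) (auto intro: forces_falsityD forces_mp)

section \<open>Closure properties of the regular set\<close>

definition is_good :: "nat \<Rightarrow> fm" where
  "is_good U = (is_union_closed U \<^bold>\<and> is_regular U \<^bold>\<and> is_separative U)"

lemma forces_usREA: "\<exists>U. F |= is_subset x U \<and> F |= is_good U"
proof -
  have "F |= usREA" using forces_ax[of usREA F "\<lambda>i. i"] by (simp add: ZT_def)
  then show ?thesis unfolding usREA_def is_good_def
    by - (drule forces_spec[of _ _ x], simp)
qed

lemma forces_good_trans:
  assumes "F |= is_good U" "F |= (x \<^bold>\<in> U)" "F |= (y \<^bold>\<in> x)"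
  shows "F |= (y \<^bold>\<in> U)"
proof -
  have "F |= BForall U (is_subset 0 (U+1))"
    using assms(1) by (simp add: is_good_def is_regular_def is_transitive_def)
  from forces_BForallD[OF this assms(2)] show ?thesis
    using forces_subsetD[of F x U y] assms(3) by simp
qed

lemma forces_good_union:
  assumes "F |= is_good U" "F |= (x \<^bold>\<in> U)"
  shows "\<exists>u. F |= (u \<^bold>\<in> U) \<and> F |= is_set u (BExists (Suc x) (1 \<^bold>\<in> 0))"
proof -
  have "F |= BForall U (BExists (U+1) (Forall (0 \<^bold>\<in> 1 \<^bold>\<longleftrightarrow> BExists 2 (1 \<^bold>\<in> 0))))"
    using assms(1) by (simp add: is_good_def is_union_closed_def)
  from forces_BForallD[OF this assms(2)] show ?thesis
    by (simp add: is_set_def numeral_eq_Suc)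
qed

lemma forces_good_separative:
  assumes "F |= is_good U" "F |= (a \<^bold>\<in> U)" "F |= (b \<^bold>\<in> U)"
  shows "\<exists>c. F |= (c \<^bold>\<in> U) \<and> F |= is_set c (is_empty 0 \<^bold>\<and> is_subset (a+1) (b+1))"
proof -
  have "F |= BForall U (BForall (U+1) (BExists (U+2)
     (Forall (0 \<^bold>\<in> 1 \<^bold>\<longleftrightarrow> is_empty 0 \<^bold>\<and> is_subset 3 2))))"
    using assms(1) by (simp add: is_good_def is_separative_def)
  from forces_BForallD[OF this assms(2)]
  have "F |= BForall U (BExists (U+1) (Forall (0 \<^bold>\<in> 1 \<^bold>\<longleftrightarrow> is_empty 0 \<^bold>\<and> is_subset (a+3) 2)))"
    by (simp add: numeral_eq_Suc)
  from forces_BForallD[OF this assms(3)] show ?thesis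
    by (simp add: is_set_def numeral_eq_Suc)
qed

lemma forces_good_regular:
  assumes "F |= is_good U" "F |= (a \<^bold>\<in> U)" "F |= is_relation r a U"
    and "F |= BForall a (BExists (U+1) (rel (r+2) 1 0))"
  shows "\<exists>b. F |= (b \<^bold>\<in> U) \<and> F |= is_coll b a (rel (r+2) 1 0)"
proof -
  have "F |= BForall U (Forall (is_relation 0 1 (U+2) \<^bold>\<and> BForall 1 (BExists (U+3) (rel 2 1 0)) \<^bold>\<longrightarrow>
       BExists (U+2) (BForall 2 (BExists 1 (rel 3 1 0)) \<^bold>\<and>
                      BForall 0 (BExists 3 (rel 3 0 1)))))"
    using assms(1) by (simp add: is_good_def is_regular_def)
  from forces_BForallD[OF this assms(2)]
  have "F |= Forall (is_relation 0 (a+1) (U+1) \<^bold>\<and> BForall (a+1) (BExists (U+2) (rel 2 1 0)) \<^bold>\<longrightarrow>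
       BExists (U+1) (BForall (a+2) (BExists 1 (rel 3 1 0)) \<^bold>\<and> BForall 0 (BExists (a+3) (rel 3 0 1))))"
    by (simp add: numeral_eq_Suc)
  from forces_spec[OF this, of r]
  have "F |= (is_relation r a U \<^bold>\<and> BForall a (BExists (U+1) (rel (r+2) 1 0)) \<^bold>\<longrightarrow>
       BExists U (BForall (a+1) (BExists 1 (rel (r+3) 1 0)) \<^bold>\<and> BForall 0 (BExists (a+2) (rel (r+3) 0 1))))"
    by (simp add: numeral_eq_Suc)
  from forces_mp[OF this] assms(3,4) show ?thesis
    by (simp add: is_coll_def numeral_eq_Suc)
qed

text \<open>\<open>a \<subseteq> \<Union>{q z | z \<in> Z}\<close> for \<open>q : Z \<rightarrow> Q\<close>\<close>

definition covers :: "nat \<Rightarrow> nat \<Rightarrow> nat \<Rightarrow> nat \<Rightarrow> fm" where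
  "covers a q Z Q = BForall a (BExists (Z+1) (BExists (Q+2) (rel (q+3) 1 0 \<^bold>\<and> 2 \<^bold>\<in> 0)))"

lemma rename_covers [simp]: "rename f (covers a q Z Q) = covers (f a) (f q) (f Z) (f Q)"
  by (simp add: covers_def numeral_eq_Suc)

lemma forces_coversD:
  assumes "F |= covers a q Z Q" "F |= (v \<^bold>\<in> a)"
  shows "\<exists>z d. F |= (z \<^bold>\<in> Z) \<and> F |= (d \<^bold>\<in> Q) \<and> F |= rel q z d \<and> F |= (v \<^bold>\<in> d)"
  using forces_BForallD[OF assms(1)[unfolded covers_def] assms(2)] by (auto simp: numeral_eq_Suc)

lemma forces_coversI:
  assumes "finite H" "F ||= H"
    "\<And>G v. G ||= H \<Longrightarrow> G |= (v \<^bold>\<in> a) \<Longrightarrow>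
      \<exists>z d. G |= (z \<^bold>\<in> Z) \<and> G |= (d \<^bold>\<in> Q) \<and> G |= rel q z d \<and> G |= (v \<^bold>\<in> d)"
  shows "F |= covers a q Z Q"
  unfolding covers_def
proof (rule forces_BForallI[OF assms(1,2)])
  fix G v assume "G ||= H" "G |= (v \<^bold>\<in> a)"
  from assms(3)[OF this]
  show "G |= inst v (BExists (Z+1) (BExists (Q+2) (rel (q+3) 1 0 \<^bold>\<and> 2 \<^bold>\<in> 0)))"
    by (auto simp: numeral_eq_Suc)
qed

lemma forces_covers_cong:
  assumes "F |= (q \<^bold>= q')" "F |= covers a q Z Q"
  shows "F |= covers a q' Z Q"
  using forces_subst[OF assms(1), of "covers (Suc a) 0 (Suc Z) (Suc Q)"] assms(2) by simp

text \<open>The explicit bound \<open>Q\<close> for the values of \<open>q\<close> is what makes the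
  cover condition available in separation.\<close>

lemma restricted_covers: "restricted (covers a q Z Q)"
  unfolding covers_def by (intro restricted_intros)

text \<open>A substitute for the power set of \<open>Y\<close>: separating from \<open>U\<close>
  makes it a set, and it is the codomain of the functions obtained by dependent choice.\<close>

definition is_subsets_in :: "nat \<Rightarrow> nat \<Rightarrow> nat \<Rightarrow> fm" where
  "is_subsets_in Q U Y = is_set Q (0 \<^bold>\<in> Suc U \<^bold>\<and> is_subset 0 (Suc Y))"

lemma forces_subsets_inD:
  "F |= is_subsets_in Q U Y \<Longrightarrow> F |= (d \<^bold>\<in> Q) \<longleftrightarrow> F |= (d \<^bold>\<in> U) \<and> F |= is_subset d Y"
  unfolding is_subsets_in_def by (drule forces_is_setD[of _ _ _ d]) simp

lemma forces_subsets_in_ex: "\<exists>Q. F |= is_subsets_in Q U Y"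
  unfolding is_subsets_in_def by (intro forces_separation restricted_intros)

text \<open>
  The rule \<open>(a, b)\<close> is applied without deciding whether its premise is met by \<open>q\<close>: the set \<open>x\<close>
  is an image of the truth value \<open>{\<emptyset> : a \<subseteq> \<Union>ran q}\<close>, so it is inhabited once that truth value is.
\<close>

lemma forces_conditional_witness:
  assumes U: "F |= is_good U" and ZU: "F |= (Z \<^bold>\<in> U)" and aU: "F |= (a \<^bold>\<in> U)" and bU: "F |= (b \<^bold>\<in> U)"
    and Q: "F |= is_subsets_in Q U Y" and Y: "F |= is_closed Y X R" and ab: "F |= rel R a b"
    and q: "F |= is_func q Z Q"
  shows "\<exists>x. F |= (x \<^bold>\<in> Q) \<and> F |= (covers a q Z Q \<^bold>\<longrightarrow> BExists b (0 \<^bold>\<in> x+1))"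
proof -
  have qr: "F |= is_relation q Z U"
  proof (rule forces_relationI[of "{is_func q Z Q, is_subsets_in Q U Y}"])
    fix G p assume "G ||= {is_func q Z Q, is_subsets_in Q U Y}" "G |= (p \<^bold>\<in> q)"
    then show "\<exists>u v. G |= (u \<^bold>\<in> Z) \<and> G |= (v \<^bold>\<in> U) \<and> G |= is_opair p u v"
      using forces_relationD[OF forces_func_relation] forces_subsets_inD by (simp, meson)
  qed (use q Q in auto)
  have qt: "F |= BForall Z (BExists (U+1) (rel (q+2) 1 0))"
  proof (rule forces_BForallI[of "{is_func q Z Q, is_subsets_in Q U Y}"])
    fix G z assume "G ||= {is_func q Z Q, is_subsets_in Q U Y}" "G |= (z \<^bold>\<in> Z)"
    then show "G |= inst z (BExists (U+1) (rel (q+2) 1 0))"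
      using forces_func_total[of G q Z Q z] forces_subsets_inD[of G Q U Y] by (auto simp: numeral_eq_Suc)
  qed (use q Q in auto)
  \<comment> \<open>Regularity puts the range of \<open>q\<close> into \<open>U\<close>; its union
    \<open>u\<close> follows by union-closure, and the truth value \<open>c\<close> of
    \<open>a\<close> being a subset of \<open>u\<close> by separativity.\<close>
  obtain r where rU: "F |= (r \<^bold>\<in> U)" and r: "F |= is_coll r Z (rel (q+2) 1 0)"
    using forces_good_regular[OF U ZU qr qt] by blast
  obtain u where uU: "F |= (u \<^bold>\<in> U)" and u: "F |= is_set u (BExists (Suc r) (1 \<^bold>\<in> 0))"
    using forces_good_union[OF U rU] by blast
  obtain c where cU: "F |= (c \<^bold>\<in> U)" and c: "F |= is_set c (is_empty 0 \<^bold>\<and> is_subset (a+1) (u+1))"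
    using forces_good_separative[OF U aU uU] by blast
  obtain e where e: "F |= is_set e (0 \<^bold>\<in> Suc b \<^bold>\<and> 0 \<^bold>\<in> Suc Y)"
    using forces_separation restricted_atoms(1) by blast
  \<comment> \<open>The full product of \<open>c\<close> with \<open>e\<close>, the intersection of
    \<open>b\<close> and \<open>Y\<close>. It is total on \<open>c\<close>: a member of
    \<open>c\<close> certifies that \<open>a\<close> is a subset of \<open>u\<close>, hence of
    \<open>Y\<close>, so closedness of \<open>Y\<close> inhabits \<open>e\<close>. Regularity then
    yields the image \<open>x\<close> in \<open>U\<close> without deciding whether \<open>c\<close>
    is inhabited.\<close>
  obtain \<rho> where \<rho>: "F |= is_prod \<rho> c e" using forces_prod_ex by blast
  let ?H = "{is_good U, b \<^bold>\<in> U, is_subsets_in Q U Y, is_closed Y X R, rel R a b, is_func q Z Q,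
    is_coll r Z (rel (q+2) 1 0), is_set u (BExists (Suc r) (1 \<^bold>\<in> 0)),
    is_set c (is_empty 0 \<^bold>\<and> is_subset (a+1) (u+1)), is_set e (0 \<^bold>\<in> Suc b \<^bold>\<and> 0 \<^bold>\<in> Suc Y), is_prod \<rho> c e}"
  have H: "F ||= ?H" using U bU Q Y ab q r u c e \<rho> by simp
  have eD: "G |= (v \<^bold>\<in> e) \<longleftrightarrow> G |= (v \<^bold>\<in> b) \<and> G |= (v \<^bold>\<in> Y)" if "G ||= ?H" for G v
    using that forces_is_setD[of G e "0 \<^bold>\<in> Suc b \<^bold>\<and> 0 \<^bold>\<in> Suc Y" v] by simp
  have eU: "G |= (v \<^bold>\<in> U)" if "G ||= ?H" "G |= (v \<^bold>\<in> e)" for G v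
    using that eD[of G v] forces_good_trans[of G U b v] by simp
  have uD: "G |= (v \<^bold>\<in> u) \<longleftrightarrow> (\<exists>d. G |= (d \<^bold>\<in> r) \<and> G |= (v \<^bold>\<in> d))" if "G ||= ?H" for G v
    using that forces_is_setD[of G u "BExists (Suc r) (1 \<^bold>\<in> 0)" v] by simp
  have cD: "G |= (o' \<^bold>\<in> c) \<longleftrightarrow> G |= is_empty o' \<and> G |= is_subset a u" if "G ||= ?H" for G o'
    using that forces_is_setD[of G c "is_empty 0 \<^bold>\<and> is_subset (a+1) (u+1)" o'] by simp
  have uY: "G |= (v \<^bold>\<in> Y)" if H: "G ||= ?H" and v: "G |= (v \<^bold>\<in> u)" for G v
  proof -
    obtain d where d: "G |= (d \<^bold>\<in> r)" "G |= (v \<^bold>\<in> d)" using uD[OF H] v by blast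
    obtain z where "G |= rel q z d"
      using is_collD2[of G r Z "rel (q+2) 1 0" d] H d(1) by (auto simp: numeral_eq_Suc)
    then have "G |= (d \<^bold>\<in> Q)" using H forces_func_rel(2) by (simp, meson)
    then show ?thesis using H d(2) forces_subsets_inD forces_subsetD by (simp, meson)
  qed
  have ce: "\<exists>v. G |= (v \<^bold>\<in> e)" if H: "G ||= ?H" and au: "G |= is_subset a u" for G
  proof -
    have "G |= is_subset a Y"
      by (rule forces_subsetI[of "insert (is_subset a u) ?H"])
        (use H au uY forces_subsetD[of _ a u] in auto)
    then show ?thesis using forces_closedD[of G Y X R a b] H eD[OF H] by simp
  qed
  have \<rho>D: "G |= rel \<rho> o' v \<longleftrightarrow> G |= (o' \<^bold>\<in> c) \<and> G |= (v \<^bold>\<in> e)" if H: "G ||= ?H" for G o' v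
  proof
    assume "G |= rel \<rho> o' v"
    then obtain p u' v' where "G |= is_opair p o' v" "G |= (u' \<^bold>\<in> c)" "G |= (v' \<^bold>\<in> e)" "G |= is_opair p u' v'"
      using H forces_prodD[of G \<rho> c e] unfolding forces_rel_iff by auto
    then show "G |= (o' \<^bold>\<in> c) \<and> G |= (v \<^bold>\<in> e)"
      by (meson forces_opair_inject forces_mem_cong forces_refl)
  next
    assume "G |= (o' \<^bold>\<in> c) \<and> G |= (v \<^bold>\<in> e)"
    moreover obtain p where "G |= is_opair p o' v" using forces_opair_ex by blast
    ultimately show "G |= rel \<rho> o' v"
      using H forces_prodD[of G \<rho> c e p] unfolding forces_rel_iff by auto
  qed
  have "F |= is_relation \<rho> c U"
  proof (rule forces_relationI[OF _ H])
    fix G p assume *: "G ||= ?H" "G |= (p \<^bold>\<in> \<rho>)"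
    then show "\<exists>u v. G |= (u \<^bold>\<in> c) \<and> G |= (v \<^bold>\<in> U) \<and> G |= is_opair p u v"
      using forces_prodD[of G \<rho> c e p] eU[OF *(1)] by auto
  qed simp
  moreover have "F |= BForall c (BExists (U+1) (rel (\<rho>+2) 1 0))"
  proof (rule forces_BForallI[OF _ H])
    fix G o' assume *: "G ||= ?H" "G |= (o' \<^bold>\<in> c)"
    then obtain v where "G |= (v \<^bold>\<in> e)" using cD ce by blast
    then show "G |= inst o' (BExists (U+1) (rel (\<rho>+2) 1 0))"
      using * \<rho>D[OF *(1)] eU[OF *(1)] by (auto simp: numeral_eq_Suc)
  qed simp
  ultimately obtain x where xU: "F |= (x \<^bold>\<in> U)" and x: "F |= is_coll x c (rel (\<rho>+2) 1 0)"
    using forces_good_regular[OF U cU] by blast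
  let ?H' = "insert (is_coll x c (rel (\<rho>+2) 1 0)) ?H"
  have H': "F ||= ?H'" using H x by simp
  have "F |= is_subset x Y"
  proof (rule forces_subsetI[OF _ H'])
    fix G v assume *: "G ||= ?H'" "G |= (v \<^bold>\<in> x)"
    then obtain o' where "G |= rel \<rho> o' v"
      using is_collD2[of G x c "rel (\<rho>+2) 1 0" v] by (auto simp: numeral_eq_Suc)
    then show "G |= (v \<^bold>\<in> Y)" using \<rho>D[of G] eD[of G] * by simp
  qed simp
  then have "F |= (x \<^bold>\<in> Q)" using xU forces_subsets_inD[OF Q] by simp
  moreover have "F |= (covers a q Z Q \<^bold>\<longrightarrow> BExists b (0 \<^bold>\<in> x+1))"
  proof (rule forces_implI[OF _ H'])
    fix G assume *: "G ||= ?H'" "G |= covers a q Z Q"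
    then have HG: "G ||= ?H" by simp
    have "G |= is_subset a u"
    proof (rule forces_subsetI[of "insert (covers a q Z Q) ?H"])
      fix G v assume *: "G ||= insert (covers a q Z Q) ?H" "G |= (v \<^bold>\<in> a)"
      then have HG: "G ||= ?H" by simp
      obtain z d where zd: "G |= (z \<^bold>\<in> Z)" "G |= rel q z d" "G |= (v \<^bold>\<in> d)"
        using forces_coversD[of G a q Z Q v] * by auto
      obtain d' where d': "G |= (d' \<^bold>\<in> r)" "G |= rel q z d'"
        using is_collD1[of G r Z "rel (q+2) 1 0" z] * zd(1) by (auto simp: numeral_eq_Suc)
      have "G |= (d \<^bold>= d')" using forces_func_unique[OF _ zd(2) d'(2)] * by (simp, meson)
      then show "G |= (v \<^bold>\<in> u)" using uD[OF HG] zd(3) d'(1) by (meson forces_mem_cong forces_refl)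
    qed (use * in auto)
    \<comment> \<open>Once the premise is covered, the empty set belongs to \<open>c\<close>; the
      value that \<open>x\<close> has for it lies in \<open>b\<close>.\<close>
    moreover obtain o' where "G |= is_empty o'" using forces_empty_ex by blast
    ultimately have "G |= (o' \<^bold>\<in> c)" using cD[OF HG] by simp
    then obtain v where "G |= (v \<^bold>\<in> x)" "G |= rel \<rho> o' v"
      using is_collD1[of G x c "rel (\<rho>+2) 1 0" o'] * by (auto simp: numeral_eq_Suc)
    then show "G |= BExists b (0 \<^bold>\<in> x+1)" using \<rho>D[OF HG] eD[OF HG] by auto
  qed simp
  ultimately show ?thesis by blast
qed

text \<open>
  \<open>r\<close> is a total relation between \<open>Q\<^bsup>Z\<^esup>\<close> and \<open>Q\<close> whose values meet the conclusion \<open>b\<close> as soon as the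
  premise \<open>a\<close> is covered.
\<close>

definition is_rule_relation :: "nat \<Rightarrow> nat \<Rightarrow> nat \<Rightarrow> nat \<Rightarrow> nat \<Rightarrow> fm" where
  "is_rule_relation r Z Q a b = (BForall r (Exists (BExists (Q+2) (is_func 1 (Z+3) (Q+3) \<^bold>\<and>
       is_opair 2 1 0 \<^bold>\<and> (covers (a+3) 1 (Z+3) (Q+3) \<^bold>\<longrightarrow> BExists (b+3) (0 \<^bold>\<in> 1)))))
     \<^bold>\<and> Forall (is_func 0 (Z+1) (Q+1) \<^bold>\<longrightarrow> BExists (Q+1) (rel (r+2) 1 0)))"

lemma rename_rule_relation [simp]:
  "rename f (is_rule_relation r Z Q a b) = is_rule_relation (f r) (f Z) (f Q) (f a) (f b)"
  by (simp add: is_rule_relation_def numeral_eq_Suc)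

lemma forces_rule_relationD1:
  assumes "F |= is_rule_relation r Z Q a b" "F |= (p \<^bold>\<in> r)"
  shows "\<exists>q x. F |= (x \<^bold>\<in> Q) \<and> F |= is_func q Z Q \<and> F |= is_opair p q x \<and>
    F |= (covers a q Z Q \<^bold>\<longrightarrow> BExists b (0 \<^bold>\<in> x+1))"
proof -
  have "F |= BForall r (Exists (BExists (Q+2) (is_func 1 (Z+3) (Q+3) \<^bold>\<and>
       is_opair 2 1 0 \<^bold>\<and> (covers (a+3) 1 (Z+3) (Q+3) \<^bold>\<longrightarrow> BExists (b+3) (0 \<^bold>\<in> 1)))))"
    using assms(1) by (simp add: is_rule_relation_def)
  from forces_BForallD[OF this assms(2)] show ?thesis by (auto simp: numeral_eq_Suc)
qed

lemma forces_rule_relationD2: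
  assumes "F |= is_rule_relation r Z Q a b" "F |= is_func q Z Q"
  shows "\<exists>x. F |= (x \<^bold>\<in> Q) \<and> F |= rel r q x"
proof -
  have "F |= Forall (is_func 0 (Z+1) (Q+1) \<^bold>\<longrightarrow> BExists (Q+1) (rel (r+2) 1 0))"
    using assms(1) by (simp add: is_rule_relation_def)
  from forces_spec[OF this, of q]
  have "F |= (is_func q Z Q \<^bold>\<longrightarrow> BExists Q (rel (r+1) (q+1) 0))" by (simp add: numeral_eq_Suc)
  from forces_mp[OF this assms(2)] show ?thesis by simp
qed

lemma forces_rule_relation_rel:
  assumes r: "F |= is_rule_relation r Z Q a b" and qx: "F |= rel r q x" and c: "F |= covers a q Z Q"
  shows "\<exists>v. F |= (v \<^bold>\<in> b) \<and> F |= (v \<^bold>\<in> x)"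
proof -
  obtain p where p: "F |= (p \<^bold>\<in> r)" "F |= is_opair p q x"
    using qx unfolding forces_rel_iff by blast
  obtain q' x' where *: "F |= is_opair p q' x'" "F |= (covers a q' Z Q \<^bold>\<longrightarrow> BExists b (0 \<^bold>\<in> x'+1))"
    using forces_rule_relationD1[OF r p(1)] by blast
  have eq: "F |= (q \<^bold>= q')" "F |= (x' \<^bold>= x)" using forces_opair_inject p(2) *(1) by blast+
  have "F |= BExists b (0 \<^bold>\<in> x'+1)"
    using forces_mp[OF *(2) forces_covers_cong[OF eq(1) c]] .
  then show ?thesis using eq(2) by (auto intro: forces_mem_cong[OF forces_refl eq(2)])
qed

text \<open>All admissible pairs are taken. Exponentiation bounds them by the set \<open>N\<close>,
  the admissibility condition is restricted, and totality is
  \<open>forces_conditional_witness\<close>.\<close>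

lemma forces_rule_relation_ex:
  assumes U: "F |= is_good U" and ZU: "F |= (Z \<^bold>\<in> U)" and aU: "F |= (a \<^bold>\<in> U)" and bU: "F |= (b \<^bold>\<in> U)"
    and Q: "F |= is_subsets_in Q U Y" and Y: "F |= is_closed Y X R" and ab: "F |= rel R a b"
  shows "\<exists>r. F |= is_rule_relation r Z Q a b"
proof -
  obtain E where E: "F |= is_exp E Z Q" using forces_exp_ex by blast
  obtain N where N: "F |= is_prod N E Q" using forces_prod_ex by blast
  define \<phi> where "\<phi> = BExists (E+1) (BExists (Q+2) (is_opair 2 1 0 \<^bold>\<and>
    (covers (a+3) 1 (Z+3) (Q+3) \<^bold>\<longrightarrow> BExists (b+3) (0 \<^bold>\<in> 1))))"
  have "restricted \<phi>" unfolding \<phi>_def by (intro restricted_intros restricted_covers)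
  then obtain r where r: "F |= is_set r (0 \<^bold>\<in> Suc N \<^bold>\<and> \<phi>)" using forces_separation by blast
  have \<phi>: "G |= inst p \<phi> \<longleftrightarrow> (\<exists>q. G |= (q \<^bold>\<in> E) \<and> (\<exists>x. G |= (x \<^bold>\<in> Q) \<and> G |= is_opair p q x \<and>
      G |= (covers a q Z Q \<^bold>\<longrightarrow> BExists b (0 \<^bold>\<in> x+1))))" for G p
    by (simp add: \<phi>_def numeral_eq_Suc)
  let ?H = "{is_good U, Z \<^bold>\<in> U, a \<^bold>\<in> U, b \<^bold>\<in> U, is_subsets_in Q U Y, is_closed Y X R, rel R a b,
    is_exp E Z Q, is_prod N E Q, is_set r (0 \<^bold>\<in> Suc N \<^bold>\<and> \<phi>)}"
  have H: "F ||= ?H" using assms E N r by simp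
  have rD: "G |= (p \<^bold>\<in> r) \<longleftrightarrow> (\<exists>q x. G |= (x \<^bold>\<in> Q) \<and> G |= is_func q Z Q \<and> G |= is_opair p q x \<and>
      G |= (covers a q Z Q \<^bold>\<longrightarrow> BExists b (0 \<^bold>\<in> x+1)))" if "G ||= ?H" for G p
  proof -
    have "G |= (p \<^bold>\<in> r) \<longleftrightarrow> G |= (p \<^bold>\<in> N) \<and> G |= inst p \<phi>"
      using that forces_is_setD[of G r "0 \<^bold>\<in> Suc N \<^bold>\<and> \<phi>" p] by simp
    also have "G |= (p \<^bold>\<in> N) \<longleftrightarrow> (\<exists>q x. G |= (q \<^bold>\<in> E) \<and> G |= (x \<^bold>\<in> Q) \<and> G |= is_opair p q x)"
      using that forces_prodD by simp
    finally show ?thesis unfolding \<phi> using that forces_expD[of G E Z Q] by auto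
  qed
  have "F |= BForall r (Exists (BExists (Q+2) (is_func 1 (Z+3) (Q+3) \<^bold>\<and>
       is_opair 2 1 0 \<^bold>\<and> (covers (a+3) 1 (Z+3) (Q+3) \<^bold>\<longrightarrow> BExists (b+3) (0 \<^bold>\<in> 1)))))"
  proof (rule forces_BForallI[OF _ H])
    fix G p assume *: "G ||= ?H" "G |= (p \<^bold>\<in> r)"
    show "G |= inst p (Exists (BExists (Q+2) (is_func 1 (Z+3) (Q+3) \<^bold>\<and>
       is_opair 2 1 0 \<^bold>\<and> (covers (a+3) 1 (Z+3) (Q+3) \<^bold>\<longrightarrow> BExists (b+3) (0 \<^bold>\<in> 1)))))"
      using *(2) unfolding rD[OF *(1)] by (auto simp: numeral_eq_Suc)
  qed simp
  moreover have "F |= Forall (is_func 0 (Z+1) (Q+1) \<^bold>\<longrightarrow> BExists (Q+1) (rel (r+2) 1 0))"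
  proof (rule forces_ForallI[OF _ H])
    fix G q assume *: "G ||= ?H"
    have "G |= (is_func q Z Q \<^bold>\<longrightarrow> BExists Q (rel (r+1) (q+1) 0))"
    proof (rule forces_implI[OF _ *])
      fix G assume *: "G ||= ?H" "G |= is_func q Z Q"
      obtain x where x: "G |= (x \<^bold>\<in> Q)" "G |= (covers a q Z Q \<^bold>\<longrightarrow> BExists b (0 \<^bold>\<in> x+1))"
        using forces_conditional_witness[of G U Z a b Q Y X R q] * by auto
      obtain p where "G |= is_opair p q x" using forces_opair_ex by blast
      then have "G |= rel r q x" unfolding forces_rel_iff rD[OF *(1)] using x *(2) by blast
      then show "G |= BExists Q (rel (r+1) (q+1) 0)" using x(1) by auto
    qed simp
    then show "G |= inst q (is_func 0 (Z+1) (Q+1) \<^bold>\<longrightarrow> BExists (Q+1) (rel (r+2) 1 0))"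
      by (simp add: numeral_eq_Suc)
  qed simp
  ultimately show ?thesis unfolding is_rule_relation_def by auto
qed

section \<open>Dependent choice along the W-type\<close>

lemma forces_fibre_unique:
  assumes "F |= is_fibre z f a" "F |= is_fibre z' f a"
  shows "F |= (z \<^bold>= z')"
  by (rule forces_set_eqI[of "{is_fibre z f a, is_fibre z' f a}"])
    (use assms in \<open>auto simp: forces_fibreD\<close>)

lemma forces_fibre_mapI: "F |= is_fibre z f a \<Longrightarrow> F |= is_func t z X \<Longrightarrow> F |= is_fibre_map t f a X"
  by (auto simp: is_fibre_map_def)

text \<open>\<open>is_fibre_map\<close> hides its fibre behind an existential quantifier;
  extensionality lets a fibre already at hand take its place.\<close>

lemma forces_fibre_mapD:
  assumes "F |= is_fibre z f a" "F |= is_fibre_map t f a X"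
  shows "F |= is_func t z X"
proof -
  obtain z' where z': "F |= is_fibre z' f a" "F |= is_func t z' X"
    using assms(2) by (auto simp: is_fibre_map_def)
  show ?thesis
    using forces_subst[OF forces_fibre_unique[OF z'(1) assms(1)], of "is_func (Suc t) 0 (Suc X)"] z'(2)
    by simp
qed

lemma forces_compD:
  assumes "F |= is_comp r h t" "F |= rel t u v" "F |= rel h v w"
  shows "F |= rel r u w"
proof -
  obtain p where p: "F |= is_opair p u w" using forces_opair_ex by blast
  have "F |= is_set r (Exists (Exists (Exists (rel (t+4) 2 1 \<^bold>\<and> rel (h+4) 1 0 \<^bold>\<and> is_opair 3 2 0))))"
    using assms(1) by (simp add: is_comp_def is_set_def)
  from forces_is_setD[OF this, of p] have "F |= (p \<^bold>\<in> r)"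
    using p assms(2,3) by (auto simp: numeral_eq_Suc)
  then show ?thesis using p unfolding forces_rel_iff by blast
qed

text \<open>The choice clause of \<open>DC_for_W_types\<close> for fixed \<open>W\<close> and
  \<open>s\<close>, as a formula that can be listed in a neighbourhood.\<close>

definition has_DC :: "nat \<Rightarrow> nat \<Rightarrow> nat \<Rightarrow> nat \<Rightarrow> fm" where
  "has_DC W s f A = Forall (Forall (is_total_family 0 1 (f+2) (A+2) \<^bold>\<longrightarrow>
     Exists (is_func 0 (W+3) 2 \<^bold>\<and> chooses 0 1 (W+3) (s+3) (f+3) (A+3))))"

lemma forces_has_DC_ex:
  assumes "F |= is_base_map f B A"
  shows "\<exists>W s. F |= has_DC W s f A"
proof -
  have "F |= DC_for_W_types" using forces_ax[of DC_for_W_types F "\<lambda>i. i"] by (simp add: ZT_def)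
  from forces_spec2[OF this[unfolded DC_for_W_types_def], where x = A and y = B]
  have "F |= Forall (is_base_map 0 (B+1) (A+1) \<^bold>\<longrightarrow>
     Exists (Exists (is_W_type 1 0 2 (A+3) \<^bold>\<and>
       Forall (Forall (is_total_family 0 1 4 (A+5) \<^bold>\<longrightarrow>
         Exists (is_func 0 4 2 \<^bold>\<and> chooses 0 1 4 3 5 (A+6)))))))"
    by (simp add: numeral_eq_Suc)
  from forces_spec[OF this, of f]
  have "F |= (is_base_map f B A \<^bold>\<longrightarrow>
     Exists (Exists (is_W_type 1 0 (f+2) (A+2) \<^bold>\<and>
       Forall (Forall (is_total_family 0 1 (f+4) (A+4) \<^bold>\<longrightarrow>
         Exists (is_func 0 4 2 \<^bold>\<and> chooses 0 1 4 3 (f+5) (A+5)))))))"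
    by (simp add: numeral_eq_Suc)
  from forces_mp[OF this assms] show ?thesis
    by (auto simp: has_DC_def numeral_eq_Suc)
qed

lemma forces_has_DCD:
  assumes "F |= has_DC W s f A" "F |= is_total_family R X f A"
  shows "\<exists>h. F |= is_func h W X \<and> F |= chooses h R W s f A"
proof -
  from forces_spec2[OF assms(1)[unfolded has_DC_def], where x = X and y = R]
  have "F |= (is_total_family R X f A \<^bold>\<longrightarrow>
     Exists (is_func 0 (W+1) (X+1) \<^bold>\<and> chooses 0 (R+1) (W+1) (s+1) (f+1) (A+1)))"
    by (simp add: numeral_eq_Suc)
  from forces_mp[OF this assms(2)] show ?thesis by simp
qed

lemma forces_choosesD:
  assumes "F |= chooses h R W s f A" "F |= (a \<^bold>\<in> A)" "F |= is_fibre_map t f a W"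
  shows "\<exists>w q x r. F |= is_comp q h t \<and> F |= rel h w x \<and> F |= rel R a r \<and> F |= rel r q x"
proof -
  from forces_BForallD[OF assms(1)[unfolded chooses_def] assms(2)]
  have "F |= Forall (is_fibre_map 0 (f+1) (a+1) (W+1) \<^bold>\<longrightarrow>
       Exists (Exists (Exists (Exists
         (is_app (s+5) (a+5) 4 3 \<^bold>\<and> is_comp 2 (h+5) 4 \<^bold>\<and> rel (h+5) 3 1 \<^bold>\<and> rel (R+5) (a+5) 0 \<^bold>\<and> rel 0 2 1)))))"
    by (simp add: numeral_eq_Suc)
  from forces_spec[OF this, of t]
  have "F |= (is_fibre_map t f a W \<^bold>\<longrightarrow>
       Exists (Exists (Exists (Exists
         (is_app (s+4) (a+4) (t+4) 3 \<^bold>\<and> is_comp 2 (h+4) (t+4) \<^bold>\<and> rel (h+4) 3 1 \<^bold>\<and> rel (R+4) (a+4) 0 \<^bold>\<and> rel 0 2 1)))))"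
    by (simp add: numeral_eq_Suc)
  from forces_mp[OF this assms(3)] show ?thesis by (simp add: numeral_eq_Suc) blast
qed

definition rule_family :: "nat \<Rightarrow> nat \<Rightarrow> nat \<Rightarrow> fm" where
  "rule_family f g Q = Exists (Exists (Exists
     (is_fibre 2 (f+5) 4 \<^bold>\<and> is_premise_cover 2 1 0 (g+5) 4 \<^bold>\<and> is_rule_relation 3 2 (Q+5) 1 0)))"

lemma forces_rule_family:
  "F |= inst2 \<alpha> r (rule_family f g Q) \<longleftrightarrow> (\<exists>Z a b. F |= is_fibre Z f \<alpha> \<and>
     F |= is_premise_cover Z a b g \<alpha> \<and> F |= is_rule_relation r Z Q a b)"
  by (simp add: rule_family_def numeral_eq_Suc)

text \<open>The cover \<open>Z\<close> of the premise attached to \<open>\<alpha>\<close> is the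
  fibre of \<open>f\<close> over \<open>\<alpha>\<close>, so functions on \<open>Z\<close> are the
  fibre maps that dependent choice speaks of.\<close>

lemma forces_rule_family_total:
  assumes R: "F |= is_choice R A C (rule_family f g Q)"
  shows "F |= is_total_family R Q f A"
proof -
  let ?c = "is_choice R A C (rule_family f g Q)"
  have "F |= BForall A (Forall (rel (R+2) 1 0 \<^bold>\<longrightarrow>
       BForall 0 (Exists (BExists (Q+4) (is_fibre_map 1 (f+5) 4 (Q+5) \<^bold>\<and> is_opair 2 1 0))) \<^bold>\<and>
       Forall (is_fibre_map 0 (f+3) 2 (Q+3) \<^bold>\<longrightarrow> BExists (Q+3) (rel 2 1 0))))"
  proof (rule forces_BForallI[of "{?c}"])
    fix G \<alpha> assume G: "G ||= {?c}"
    have "G |= Forall (rel (R+1) (\<alpha>+1) 0 \<^bold>\<longrightarrow>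
       BForall 0 (Exists (BExists (Q+3) (is_fibre_map 1 (f+4) (\<alpha>+4) (Q+4) \<^bold>\<and> is_opair 2 1 0))) \<^bold>\<and>
       Forall (is_fibre_map 0 (f+2) (\<alpha>+2) (Q+2) \<^bold>\<longrightarrow> BExists (Q+2) (rel 2 1 0)))"
    proof (rule forces_ForallI[of "{?c}"])
      fix G r assume G: "G ||= {?c}"
      have "G |= (rel R \<alpha> r \<^bold>\<longrightarrow>
         BForall r (Exists (BExists (Q+2) (is_fibre_map 1 (f+3) (\<alpha>+3) (Q+3) \<^bold>\<and> is_opair 2 1 0))) \<^bold>\<and>
         Forall (is_fibre_map 0 (f+1) (\<alpha>+1) (Q+1) \<^bold>\<longrightarrow> BExists (Q+1) (rel (r+2) 1 0)))"
      proof (rule forces_implI[of "{?c}"])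
        fix G assume "G ||= {?c}" "G |= rel R \<alpha> r"
        then obtain Z a b where Z: "G |= is_fibre Z f \<alpha>" and r: "G |= is_rule_relation r Z Q a b"
          using forces_choiceD[of G R A C "rule_family f g Q" \<alpha> r] unfolding forces_rule_family by auto
        let ?H = "{is_fibre Z f \<alpha>, is_rule_relation r Z Q a b}"
        have "G |= BForall r (Exists (BExists (Q+2) (is_fibre_map 1 (f+3) (\<alpha>+3) (Q+3) \<^bold>\<and> is_opair 2 1 0)))"
        proof (rule forces_BForallI[of ?H])
          fix G p assume *: "G ||= ?H" "G |= (p \<^bold>\<in> r)"
          obtain q x where "G |= (x \<^bold>\<in> Q)" "G |= is_func q Z Q" "G |= is_opair p q x"
            using forces_rule_relationD1[of G r Z Q a b p] * by auto
          moreover have "G |= is_fibre_map q f \<alpha> Q"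
            using forces_fibre_mapI[of G Z f \<alpha> q Q] calculation(2) * by simp
          ultimately show "G |= inst p (Exists (BExists (Q+2)
              (is_fibre_map 1 (f+3) (\<alpha>+3) (Q+3) \<^bold>\<and> is_opair 2 1 0)))"
            by (auto simp: numeral_eq_Suc)
        qed (use Z r in auto)
        moreover have "G |= Forall (is_fibre_map 0 (f+1) (\<alpha>+1) (Q+1) \<^bold>\<longrightarrow> BExists (Q+1) (rel (r+2) 1 0))"
        proof (rule forces_ForallI[of ?H])
          fix G q assume G: "G ||= ?H"
          have "G |= (is_fibre_map q f \<alpha> Q \<^bold>\<longrightarrow> BExists Q (rel (r+1) (q+1) 0))"
          proof (rule forces_implI[OF _ G])
            fix G assume "G ||= ?H" "G |= is_fibre_map q f \<alpha> Q"
            then show "G |= BExists Q (rel (r+1) (q+1) 0)"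
              using forces_rule_relationD2[of G r Z Q a b q] forces_fibre_mapD by auto
          qed simp
          then show "G |= inst q (is_fibre_map 0 (f+1) (\<alpha>+1) (Q+1) \<^bold>\<longrightarrow> BExists (Q+1) (rel (r+2) 1 0))"
            by (simp add: numeral_eq_Suc)
        qed (use Z r in auto)
        ultimately show "G |= (BForall r (Exists (BExists (Q+2) (is_fibre_map 1 (f+3) (\<alpha>+3) (Q+3) \<^bold>\<and> is_opair 2 1 0))) \<^bold>\<and>
         Forall (is_fibre_map 0 (f+1) (\<alpha>+1) (Q+1) \<^bold>\<longrightarrow> BExists (Q+1) (rel (r+2) 1 0)))"
          by (rule forces_conj[THEN iffD2, OF HOL.conjI])
      qed (use G in auto)
      then show "G |= inst r (rel (R+1) (\<alpha>+1) 0 \<^bold>\<longrightarrow>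
         BForall 0 (Exists (BExists (Q+3) (is_fibre_map 1 (f+4) (\<alpha>+4) (Q+4) \<^bold>\<and> is_opair 2 1 0))) \<^bold>\<and>
         Forall (is_fibre_map 0 (f+2) (\<alpha>+2) (Q+2) \<^bold>\<longrightarrow> BExists (Q+2) (rel 2 1 0)))"
        by (simp add: numeral_eq_Suc)
    qed (use G in auto)
    then show "G |= inst \<alpha> (Forall (rel (R+2) 1 0 \<^bold>\<longrightarrow>
       BForall 0 (Exists (BExists (Q+4) (is_fibre_map 1 (f+5) 4 (Q+5) \<^bold>\<and> is_opair 2 1 0))) \<^bold>\<and>
       Forall (is_fibre_map 0 (f+3) 2 (Q+3) \<^bold>\<longrightarrow> BExists (Q+3) (rel 2 1 0))))"
      by (simp add: numeral_eq_Suc)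
  qed (use R in auto)
  moreover have "F |= Exists (is_func (R+1) (A+1) 0)"
    using forces_choice_func[OF R] by auto
  ultimately show ?thesis unfolding is_total_family_def by (rule forces_conj[THEN iffD2, OF HOL.conjI, rotated])
qed

text \<open>\<open>M = \<Union>\<Union>R\<close>\<close>

definition is_union2 :: "nat \<Rightarrow> nat \<Rightarrow> fm" where
  "is_union2 M R = Exists (is_set 0 (BExists (R+2) (1 \<^bold>\<in> 0)) \<^bold>\<and> is_set (M+1) (BExists 1 (1 \<^bold>\<in> 0)))"

lemma forces_union2_ex: "\<exists>M. F |= is_union2 M R"
proof -
  obtain u where u: "F |= is_set u (BExists (Suc R) (1 \<^bold>\<in> 0))" using forces_union_ex by blast
  obtain M where "F |= is_set M (BExists (Suc u) (1 \<^bold>\<in> 0))" using forces_union_ex by blast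
  then show ?thesis using u by (auto simp: is_union2_def numeral_eq_Suc)
qed

text \<open>The Kuratowski pair of \<open>a\<close> and \<open>b\<close> contains their unordered
  pair; two unions over \<open>R\<close> therefore reach \<open>a\<close> and
  \<open>b\<close>.\<close>

lemma forces_union2D:
  assumes "F |= is_union2 M R" "F |= rel R a b"
  shows "F |= (a \<^bold>\<in> M)" "F |= (b \<^bold>\<in> M)"
proof -
  obtain u where u: "F |= is_set u (BExists (Suc R) (1 \<^bold>\<in> 0))" "F |= is_set M (BExists (Suc u) (1 \<^bold>\<in> 0))"
    using assms(1) by (auto simp: is_union2_def numeral_eq_Suc)
  obtain p v w where p: "F |= (p \<^bold>\<in> R)" "F |= is_upair w a b" "F |= is_upair p v w"
    using assms(2) unfolding forces_rel_iff forces_opair_iff by blast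
  have "F |= (w \<^bold>\<in> p)" "F |= (a \<^bold>\<in> w)" "F |= (b \<^bold>\<in> w)"
    using forces_upairD p(2,3) by simp_all
  moreover have "F |= (w \<^bold>\<in> u)" using forces_is_setD[OF u(1), of w] p(1) calculation(1) by auto
  ultimately show "F |= (a \<^bold>\<in> M)" "F |= (b \<^bold>\<in> M)"
    using forces_is_setD[OF u(2), of a] forces_is_setD[OF u(2), of b] by auto
qed

lemma forces_premise_cover_rule:
  assumes "F |= is_premise_cover Z a b g \<alpha>" "F |= is_surj g A R"
  shows "F |= rel R a b"
proof -
  obtain r where "F |= rel g \<alpha> r" "F |= is_opair r a b"
    using assms(1) by (auto simp: is_premise_cover_def)
  then show ?thesis
    using forces_func_rel(2)[OF forces_surj_func[OF assms(2)]] unfolding forces_rel_iff[of F R] by blast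
qed

text \<open>Since \<open>D\<close> and \<open>M\<close> are elements of the transitive
  \<open>U\<close>, so are the fibre, the premise and the conclusion of each rule, and rule
  relations exist. That \<open>A\<close> is a base turns this into a family.\<close>

lemma forces_rule_family_ex:
  assumes A: "F |= is_base A" and g: "F |= is_surj g A R" and f: "F |= is_presentation f A g D"
    and M: "F |= is_union2 M R" and U: "F |= is_good U" "F |= (D \<^bold>\<in> U)" "F |= (M \<^bold>\<in> U)"
    and Q: "F |= is_subsets_in Q U Y" and Y: "F |= is_closed Y X R"
  shows "\<exists>S C. F |= is_choice S A C (rule_family f g Q)"
proof -
  let ?H = "{is_surj g A R, is_presentation f A g D, is_union2 M R, is_good U, D \<^bold>\<in> U, M \<^bold>\<in> U,
    is_subsets_in Q U Y, is_closed Y X R}"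
  have "\<exists>C. F |= is_coll C A (rule_family f g Q)"
  proof (rule forces_collection[of ?H])
    fix G \<alpha> assume *: "G ||= ?H" "G |= (\<alpha> \<^bold>\<in> A)"
    then obtain Z a b where Z: "G |= is_fibre Z f \<alpha>" "G |= (Z \<^bold>\<in> D)" "G |= is_premise_cover Z a b g \<alpha>"
      using forces_presentationD[of G f A g D \<alpha>] by auto
    have ab: "G |= rel R a b" using forces_premise_cover_rule[OF Z(3), of A R] * by simp
    have "\<exists>r. G |= is_rule_relation r Z Q a b"
      by (rule forces_rule_relation_ex[of G U Z a b Q Y X R])
        (use * Z ab forces_union2D[OF _ ab, of M] in \<open>auto intro: forces_good_trans\<close>)
    then show "\<exists>r. G |= inst2 \<alpha> r (rule_family f g Q)"
      unfolding forces_rule_family using Z by blast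
  qed (use assms in auto)
  then obtain C where C: "F |= is_coll C A (rule_family f g Q)" ..
  have "\<exists>S. F |= is_choice S A C (rule_family f g Q)"
    by (rule forces_base_choice[of "{is_coll C A (rule_family f g Q)}"])
      (use A C in \<open>auto dest: is_collD1\<close>)
  then show ?thesis by blast
qed

text \<open>If the premise lies in the union of the range of \<open>h\<close>, each of its elements
  lies in a value of \<open>h\<close>. As the fibre \<open>Z\<close> is a base, a map
  \<open>t\<close> from \<open>Z\<close> to \<open>W\<close> can be chosen such that
  \<open>h (t z)\<close> contains the premise element covered by \<open>z\<close>. Then the values
  of \<open>h\<close> after \<open>t\<close> cover the premise, and the rule relation forces the
  value of \<open>h\<close> at the corresponding \<open>sup\<close> to meet the conclusion.\<close>

lemma forces_closed_image:
  assumes g: "F |= is_surj g A R" and S: "F |= is_choice S A C (rule_family f g Q)"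
    and h: "F |= is_func h W Q" and ch: "F |= chooses h S W s f A"
    and d: "F |= is_coll d W (rel (h+2) 1 0)" and \<beta>: "F |= is_set \<beta> (BExists (Suc d) (1 \<^bold>\<in> 0))"
    and ab: "F |= rel R a b" and sub: "F |= is_subset a \<beta>"
  shows "\<exists>v. F |= (v \<^bold>\<in> b) \<and> F |= (v \<^bold>\<in> \<beta>)"
proof -
  obtain r where r: "F |= (r \<^bold>\<in> R)" "F |= is_opair r a b"
    using ab unfolding forces_rel_iff by blast
  obtain \<alpha> where \<alpha>: "F |= (\<alpha> \<^bold>\<in> A)" "F |= rel g \<alpha> r" using forces_surjD[OF g r(1)] by blast
  obtain k where k: "F |= rel S \<alpha> k"
    using forces_func_total[OF forces_choice_func[OF S] \<alpha>(1)] by blast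
  obtain Z a' b' where Z: "F |= is_fibre Z f \<alpha>" "F |= is_premise_cover Z a' b' g \<alpha>"
      "F |= is_rule_relation k Z Q a' b'"
    using forces_choiceD[OF S k] unfolding forces_rule_family by blast
  obtain r' \<pi> where r': "F |= is_base Z" "F |= is_surj \<pi> Z a'" "F |= rel g \<alpha> r'" "F |= is_opair r' a' b'"
    using Z(2) by (auto simp: is_premise_cover_def)
  \<comment> \<open>The rule is known twice, as the preimage choice for \<open>(a, b)\<close> and
    through the premise cover; functionality of \<open>g\<close> identifies the two
    readings.\<close>
  have "F |= (r' \<^bold>= r)" using forces_func_unique[OF forces_surj_func[OF g] r'(3) \<alpha>(2)] .
  then have "F |= is_opair r a' b'" using r'(4) by (meson forces_opair_cong forces_refl)
  then have eq: "F |= (a' \<^bold>= a)" "F |= (b' \<^bold>= b)" using forces_opair_inject r(2) by blast+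
  have sub': "F |= is_subset a' \<beta>"
    using forces_subst[OF forces_sym[OF eq(1)], of "is_subset 0 (Suc \<beta>)"] sub by simp
  define \<psi> where "\<psi> = Exists (Exists (rel (\<pi>+4) 3 1 \<^bold>\<and> rel (h+4) 2 0 \<^bold>\<and> 1 \<^bold>\<in> 0))"
  have \<psi>: "G |= inst2 z w \<psi> \<longleftrightarrow> (\<exists>v x. G |= rel \<pi> z v \<and> G |= rel h w x \<and> G |= (v \<^bold>\<in> x))" for G z w
    by (simp add: \<psi>_def numeral_eq_Suc)
  have "\<exists>t. F |= is_choice t Z W \<psi>"
  proof (rule forces_base_choice[of "{is_surj \<pi> Z a', is_subset a' \<beta>, is_coll d W (rel (h+2) 1 0),
        is_set \<beta> (BExists (Suc d) (1 \<^bold>\<in> 0))}"])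
    fix G z assume *: "G ||= {is_surj \<pi> Z a', is_subset a' \<beta>, is_coll d W (rel (h+2) 1 0),
        is_set \<beta> (BExists (Suc d) (1 \<^bold>\<in> 0))}" "G |= (z \<^bold>\<in> Z)"
    then obtain v where v: "G |= (v \<^bold>\<in> a')" "G |= rel \<pi> z v"
      using forces_func_total[OF forces_surj_func] by (simp, meson)
    then have "G |= (v \<^bold>\<in> \<beta>)" using * forces_subsetD by (simp, meson)
    then obtain x where x: "G |= (x \<^bold>\<in> d)" "G |= (v \<^bold>\<in> x)"
      using * forces_is_setD[of G \<beta> "BExists (Suc d) (1 \<^bold>\<in> 0)" v] by auto
    then obtain w where "G |= (w \<^bold>\<in> W)" "G |= rel h w x"
      using * is_collD2[of G d W "rel (h+2) 1 0" x] by (auto simp: numeral_eq_Suc)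
    then show "\<exists>w. G |= (w \<^bold>\<in> W) \<and> G |= inst2 z w \<psi>" unfolding \<psi> using v x by blast
  qed (use r' sub' d \<beta> in auto)
  then obtain t where t: "F |= is_choice t Z W \<psi>" ..
  have "F |= is_fibre_map t f \<alpha> W" using forces_fibre_mapI[OF Z(1) forces_choice_func[OF t]] .
  then obtain w q x k' where w: "F |= is_comp q h t" "F |= rel h w x" "F |= rel S \<alpha> k'" "F |= rel k' q x"
    using forces_choosesD[OF ch \<alpha>(1)] by blast
  \<comment> \<open>Dependent choice names its own value of the family at \<open>\<alpha>\<close>;
    it is the rule relation whose cover and rule are already known.\<close>
  have "F |= (k' \<^bold>= k)" using forces_func_unique[OF forces_choice_func[OF S] w(3) k] .
  from forces_subst[OF this, of "rel 0 (Suc q) (Suc x)"] have kqx: "F |= rel k q x" using w(4) by simp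
  have cov: "F |= covers a' q Z Q"
  proof (rule forces_coversI[of "{is_surj \<pi> Z a', is_choice t Z W \<psi>, is_comp q h t, is_func h W Q}"])
    fix G v assume *: "G ||= {is_surj \<pi> Z a', is_choice t Z W \<psi>, is_comp q h t, is_func h W Q}"
      "G |= (v \<^bold>\<in> a')"
    then have \<pi>: "G |= is_surj \<pi> Z a'" and t: "G |= is_choice t Z W \<psi>" and q: "G |= is_comp q h t"
      and h: "G |= is_func h W Q" by simp_all
    obtain z where z: "G |= (z \<^bold>\<in> Z)" "G |= rel \<pi> z v" using forces_surjD[OF \<pi> *(2)] by blast
    obtain w where w: "G |= rel t z w" using forces_func_total[OF forces_choice_func[OF t] z(1)] by blast
    obtain v' x where x: "G |= rel \<pi> z v'" "G |= rel h w x" "G |= (v' \<^bold>\<in> x)"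
      using forces_choiceD[OF t w] unfolding \<psi> by blast
    have "G |= (v' \<^bold>= v)" using forces_func_unique[OF forces_surj_func[OF \<pi>] x(1) z(2)] .
    then have "G |= (v \<^bold>\<in> x)" using x(3) by (meson forces_mem_cong forces_refl)
    then show "\<exists>z d. G |= (z \<^bold>\<in> Z) \<and> G |= (d \<^bold>\<in> Q) \<and> G |= rel q z d \<and> G |= (v \<^bold>\<in> d)"
      using z(1) forces_func_rel(2)[OF h x(2)] forces_compD[OF q w x(2)] by blast
  qed (use r' t w h in auto)
  obtain v where v: "F |= (v \<^bold>\<in> b')" "F |= (v \<^bold>\<in> x)"
    using forces_rule_relation_rel[OF Z(3) kqx cov] by blast
  \<comment> \<open>The collected \<open>d\<close> contains some value of \<open>h\<close> at
    \<open>w\<close>; functionality of \<open>h\<close> identifies it with \<open>x\<close>.\<close>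
  obtain x' where x': "F |= (x' \<^bold>\<in> d)" "F |= rel h w x'"
    using is_collD1[OF d forces_func_rel(1)[OF h w(2)]] by (auto simp: numeral_eq_Suc)
  have "F |= (x \<^bold>= x')" using forces_func_unique[OF h w(2) x'(2)] .
  then have "F |= (v \<^bold>\<in> x')" using v(2) by (meson forces_mem_cong forces_refl)
  then have "F |= (v \<^bold>\<in> \<beta>)" using forces_is_setD[OF \<beta>, of v] x'(1) by auto
  then show ?thesis using v(1) eq(2) by (meson forces_mem_cong forces_refl)
qed

section \<open>Set-generation\<close>

text \<open>\<open>is_closed\<close> quantifies over all premises and conclusions without a bound.
  With \<open>M\<close> as a bound the condition becomes restricted, and nothing is lost when
  \<open>M\<close> is the double union of \<open>R\<close>.\<close>

definition is_closed_in :: "nat \<Rightarrow> nat \<Rightarrow> nat \<Rightarrow> nat \<Rightarrow> fm" where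
  "is_closed_in M Y X R = (is_subset Y X \<^bold>\<and> BForall M (BForall (M+1)
     (rel (R+2) 1 0 \<^bold>\<longrightarrow> is_subset 1 (Y+2) \<^bold>\<longrightarrow> BExists 0 (0 \<^bold>\<in> Y+3))))"

lemma rename_closed_in [simp]:
  "rename f (is_closed_in M Y X R) = is_closed_in (f M) (f Y) (f X) (f R)"
  by (simp add: is_closed_in_def numeral_eq_Suc)

lemma restricted_closed_in: "restricted (is_closed_in M Y X R)"
  unfolding is_closed_in_def by (intro restricted_intros)

lemma forces_closed_in_iff:
  assumes M: "F |= is_union2 M R"
  shows "F |= is_closed_in M Y X R \<longleftrightarrow> F |= is_closed Y X R"
proof
  assume c: "F |= is_closed_in M Y X R"
  show "F |= is_closed Y X R"
  proof (rule forces_closedI[of "{is_closed_in M Y X R, is_union2 M R}"])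
    show "F |= is_subset Y X" using c by (simp add: is_closed_in_def)
    fix G a b
    assume *: "G ||= {is_closed_in M Y X R, is_union2 M R}" "G |= rel R a b" "G |= is_subset a Y"
    then have M: "G |= is_union2 M R" and c: "G |= BForall M (BForall (M+1)
       (rel (R+2) 1 0 \<^bold>\<longrightarrow> is_subset 1 (Y+2) \<^bold>\<longrightarrow> BExists 0 (0 \<^bold>\<in> Y+3)))"
      by (simp_all add: is_closed_in_def)
    from forces_BForallD[OF c forces_union2D(1)[OF M *(2)]]
    have "G |= BForall M (rel (R+1) (a+1) 0 \<^bold>\<longrightarrow> is_subset (a+1) (Y+1) \<^bold>\<longrightarrow> BExists 0 (0 \<^bold>\<in> Y+2))"
      by (simp add: numeral_eq_Suc)
    from forces_BForallD[OF this forces_union2D(2)[OF M *(2)]]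
    have "G |= (rel R a b \<^bold>\<longrightarrow> is_subset a Y \<^bold>\<longrightarrow> BExists b (0 \<^bold>\<in> Y+1))"
      by (simp add: numeral_eq_Suc)
    from forces_mp[OF forces_mp[OF this *(2)] *(3)]
    show "\<exists>z. G |= (z \<^bold>\<in> b) \<and> G |= (z \<^bold>\<in> Y)" by simp
  qed (use c M in auto)
next
  assume c: "F |= is_closed Y X R"
  have "F |= BForall M (BForall (M+1)
     (rel (R+2) 1 0 \<^bold>\<longrightarrow> is_subset 1 (Y+2) \<^bold>\<longrightarrow> BExists 0 (0 \<^bold>\<in> Y+3)))"
  proof (rule forces_BForallI[of "{is_closed Y X R}"])
    fix G a assume G: "G ||= {is_closed Y X R}"
    have "G |= BForall M (rel (R+1) (a+1) 0 \<^bold>\<longrightarrow> is_subset (a+1) (Y+1) \<^bold>\<longrightarrow> BExists 0 (0 \<^bold>\<in> Y+2))"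
    proof (rule forces_BForallI[OF _ G])
      fix G b assume G: "G ||= {is_closed Y X R}"
      have "G |= (rel R a b \<^bold>\<longrightarrow> is_subset a Y \<^bold>\<longrightarrow> BExists b (0 \<^bold>\<in> Y+1))"
      proof (rule forces_implI[OF _ G])
        fix G assume G: "G ||= {is_closed Y X R}" "G |= rel R a b"
        show "G |= (is_subset a Y \<^bold>\<longrightarrow> BExists b (0 \<^bold>\<in> Y+1))"
          by (rule forces_implI[of "{is_closed Y X R, rel R a b}"])
            (use G forces_closedD[of _ Y X R a b] in auto)
      qed simp
      then show "G |= inst b (rel (R+1) (a+1) 0 \<^bold>\<longrightarrow> is_subset (a+1) (Y+1) \<^bold>\<longrightarrow> BExists 0 (0 \<^bold>\<in> Y+2))"
        by (simp add: numeral_eq_Suc)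
    qed simp
    then show "G |= inst a (BForall (M+1)
       (rel (R+2) 1 0 \<^bold>\<longrightarrow> is_subset 1 (Y+2) \<^bold>\<longrightarrow> BExists 0 (0 \<^bold>\<in> Y+3)))"
      by (simp add: numeral_eq_Suc)
  qed (use c in auto)
  then show "F |= is_closed_in M Y X R"
    using forces_closed_subset[OF c] by (simp add: is_closed_in_def)
qed

text \<open>A first step towards set-generation: the closed subset found inside \<open>Y\<close> is
  not yet asked to contain a prescribed element.\<close>

definition is_minorizing :: "nat \<Rightarrow> nat \<Rightarrow> nat \<Rightarrow> fm" where
  "is_minorizing B X R = (BForall B (is_closed 0 (X+1) (R+1)) \<^bold>\<and>
     Forall (is_closed 0 (X+1) (R+1) \<^bold>\<longrightarrow> BExists (B+1) (is_subset 0 1)))"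

lemma forces_minorizingD1:
  "F |= is_minorizing B X R \<Longrightarrow> F |= (\<beta> \<^bold>\<in> B) \<Longrightarrow> F |= is_closed \<beta> X R"
  using forces_BForallD[of F B "is_closed 0 (X+1) (R+1)" \<beta>] by (simp add: is_minorizing_def)

lemma forces_minorizingD2:
  assumes "F |= is_minorizing B X R" "F |= is_closed Y X R"
  shows "\<exists>\<beta>. F |= (\<beta> \<^bold>\<in> B) \<and> F |= is_subset \<beta> Y"
proof -
  have "F |= Forall (is_closed 0 (X+1) (R+1) \<^bold>\<longrightarrow> BExists (B+1) (is_subset 0 1))"
    using assms(1) by (simp add: is_minorizing_def)
  from forces_spec[OF this, of Y]
  have "F |= (is_closed Y X R \<^bold>\<longrightarrow> BExists B (is_subset 0 (Y+1)))" by simp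
  from forces_mp[OF this assms(2)] show ?thesis by simp
qed

text \<open>
  Every closed set contains \<open>\<Union>ran h\<close> for some \<open>h : W \<rightarrow> Q\<close>, where \<open>W\<close> and \<open>Q\<close> do not depend on the
  closed set; by subset collection the ranges of these \<open>h\<close> are members of a single set.
\<close>

lemma forces_minorizing_ex:
  assumes rules: "F |= are_rules R X"
  shows "\<exists>B. F |= is_minorizing B X R"
proof -
  obtain A g B f D where f: "F |= is_base_map f B A" and g: "F |= is_surj g A R"
    and D: "F |= is_presentation f A g D"
    using forces_presentation_ex[OF rules] by blast
  have A: "F |= is_base A" using f by (simp add: is_base_map_def)
  obtain W s where W: "F |= has_DC W s f A" using forces_has_DC_ex[OF f] by blast
  obtain M where M: "F |= is_union2 M R" using forces_union2_ex by blast
  \<comment> \<open>\<open>usREA\<close> provides \<open>U\<close> with a given set as a subset;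
    applied to the pair of \<open>D\<close> and \<open>M\<close> it makes both of them elements of
    \<open>U\<close>.\<close>
  obtain DM where DM: "F |= is_upair DM D M" using forces_upair_ex by blast
  obtain U where U: "F |= is_subset DM U" "F |= is_good U" using forces_usREA by blast
  have DU: "F |= (D \<^bold>\<in> U)" and MU: "F |= (M \<^bold>\<in> U)"
    using forces_subsetD[OF U(1)] forces_upairD[OF DM] by simp_all
  \<comment> \<open>A closed \<open>Y\<close> is a subset of \<open>X\<close>, so the set
    \<open>Q\<close> belonging to \<open>Y\<close> is contained in \<open>QX\<close>, which does not
    depend on \<open>Y\<close>.\<close>
  obtain QX where QX: "F |= is_subsets_in QX U X" using forces_subsets_in_ex by blast
  \<comment> \<open>Index 2, the uniform parameter of subset collection, is the function
    \<open>h\<close>: ranges of all functions from \<open>W\<close> into \<open>QX\<close> are found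
    in \<open>c\<close>.\<close>
  obtain c where c: "F |= is_subset_coll c W QX (rel 2 1 0)" using forces_subset_collection by blast
  let ?u = "is_set 0 (BExists 2 (1 \<^bold>\<in> 0))"
  have "\<exists>V. F |= is_coll V c ?u"
    by (rule forces_collection[of "{}"]) (use forces_union_ex in \<open>simp_all add: numeral_eq_Suc\<close>)
  then obtain V where V: "F |= is_coll V c ?u" ..
  \<comment> \<open>Not every union in \<open>V\<close> is closed. Separation keeps the closed ones,
    in the bounded form that it requires.\<close>
  obtain K where K: "F |= is_set K (0 \<^bold>\<in> Suc V \<^bold>\<and> is_closed_in (M+1) 0 (X+1) (R+1))"
    using forces_separation restricted_closed_in by blast
  let ?H = "{is_base A, is_surj g A R, is_presentation f A g D, has_DC W s f A, is_union2 M R,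
    is_good U, D \<^bold>\<in> U, M \<^bold>\<in> U, is_subsets_in QX U X, is_subset_coll c W QX (rel 2 1 0), is_coll V c ?u,
    is_set K (0 \<^bold>\<in> Suc V \<^bold>\<and> is_closed_in (M+1) 0 (X+1) (R+1))}"
  have H: "F ||= ?H" using A g D W M U(2) DU MU QX c V K by simp
  have KD: "G |= (\<beta> \<^bold>\<in> K) \<longleftrightarrow> G |= (\<beta> \<^bold>\<in> V) \<and> G |= is_closed \<beta> X R" if "G ||= ?H" for G \<beta>
    using that forces_is_setD[of G K "0 \<^bold>\<in> Suc V \<^bold>\<and> is_closed_in (M+1) 0 (X+1) (R+1)" \<beta>]
      forces_closed_in_iff[of G M R \<beta> X] by simp
  have "F |= BForall K (is_closed 0 (X+1) (R+1))"
    by (rule forces_BForallI[OF _ H]) (use KD in auto)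
  moreover have "F |= Forall (is_closed 0 (X+1) (R+1) \<^bold>\<longrightarrow> BExists (K+1) (is_subset 0 1))"
  proof (rule forces_ForallI[OF _ H])
    fix G Y assume HG: "G ||= ?H"
    have "G |= (is_closed Y X R \<^bold>\<longrightarrow> BExists K (is_subset 0 (Y+1)))"
    proof (rule forces_implI[OF _ HG])
      fix G assume HG: "G ||= ?H" and Y: "G |= is_closed Y X R"
      then have g: "G |= is_surj g A R" and c: "G |= is_subset_coll c W QX (rel 2 1 0)"
        and V: "G |= is_coll V c ?u" and W: "G |= has_DC W s f A" and QX: "G |= is_subsets_in QX U X"
        by simp_all
      obtain Q where Q: "G |= is_subsets_in Q U Y" using forces_subsets_in_ex by blast
      obtain S C where S: "G |= is_choice S A C (rule_family f g Q)"
        using forces_rule_family_ex[of G A g R f D M U Q Y X] HG Q Y by auto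
      obtain h where h: "G |= is_func h W Q" "G |= chooses h S W s f A"
        using forces_has_DCD[OF W forces_rule_family_total[OF S]] by blast
      have "G |= BForall W (BExists (QX+1) (rel (h+2) 1 0))"
      proof (rule forces_BForallI[of "{is_func h W Q, is_subsets_in Q U Y, is_subsets_in QX U X, is_closed Y X R}"])
        fix G w assume *: "G ||= {is_func h W Q, is_subsets_in Q U Y, is_subsets_in QX U X, is_closed Y X R}"
          "G |= (w \<^bold>\<in> W)"
        then obtain x where x: "G |= (x \<^bold>\<in> Q)" "G |= rel h w x"
          using forces_func_total[of G h W Q w] by auto
        then have xY: "G |= (x \<^bold>\<in> U)" "G |= is_subset x Y" using * forces_subsets_inD[of G Q U Y x] by simp_all
        have "G |= is_subset x X"
          by (rule forces_subsetI[of "{is_subset x Y, is_subset Y X}"])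
            (use xY(2) * forces_closed_subset[of G Y X R] in \<open>auto intro: forces_subsetD\<close>)
        then have "G |= (x \<^bold>\<in> QX)" using * xY(1) forces_subsets_inD[of G QX U X x] by simp
        then show "G |= inst w (BExists (QX+1) (rel (h+2) 1 0))" using x(2) by (auto simp: numeral_eq_Suc)
      qed (use h Q QX Y in auto)
      then obtain d where d: "G |= (d \<^bold>\<in> c)" "G |= is_coll d W (rel (h+2) 1 0)"
        using is_subset_collD[OF c, of h] by (auto simp: numeral_eq_Suc)
      obtain \<beta> where \<beta>: "G |= (\<beta> \<^bold>\<in> V)" "G |= is_set \<beta> (BExists (Suc d) (1 \<^bold>\<in> 0))"
        using is_collD1[OF V d(1)] by (auto simp: numeral_eq_Suc)
      let ?H' = "{is_surj g A R, is_choice S A C (rule_family f g Q), is_func h W Q, chooses h S W s f A,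
        is_coll d W (rel (h+2) 1 0), is_set \<beta> (BExists (Suc d) (1 \<^bold>\<in> 0)), is_subsets_in Q U Y,
        is_closed Y X R}"
      have H': "G ||= ?H'" using g S h d(2) \<beta>(2) Q Y by simp
      have \<beta>Y: "G |= (v \<^bold>\<in> Y)" if H': "G ||= ?H'" and v: "G |= (v \<^bold>\<in> \<beta>)" for G v
      proof -
        obtain x where x: "G |= (x \<^bold>\<in> d)" "G |= (v \<^bold>\<in> x)"
          using H' v forces_is_setD[of G \<beta> "BExists (Suc d) (1 \<^bold>\<in> 0)" v] by auto
        obtain w where "G |= rel h w x"
          using H' is_collD2[of G d W "rel (h+2) 1 0" x] x(1) by (auto simp: numeral_eq_Suc)
        then have "G |= (x \<^bold>\<in> Q)" using H' forces_func_rel(2)[of G h W Q w x] by simp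
        then show ?thesis using H' x(2) forces_subsets_inD[of G Q U Y x] forces_subsetD[of G x Y v] by simp
      qed
      have sub: "G |= is_subset \<beta> Y" by (rule forces_subsetI[OF _ H']) (use \<beta>Y in auto)
      have "G |= is_closed \<beta> X R"
      proof (rule forces_closedI[OF _ H'])
        show "G |= is_subset \<beta> X"
          by (rule forces_subsetI[OF _ H'])
            (use \<beta>Y in \<open>auto intro: forces_subsetD[OF forces_closed_subset]\<close>)
        fix G a b assume "G ||= ?H'" "G |= rel R a b" "G |= is_subset a \<beta>"
        then show "\<exists>z. G |= (z \<^bold>\<in> b) \<and> G |= (z \<^bold>\<in> \<beta>)"
          using forces_closed_image[of G g A R S C f Q h W s d \<beta> a b] by simp
      qed simp
      then show "G |= BExists K (is_subset 0 (Y+1))" using \<beta>(1) sub KD[OF HG] by auto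
    qed simp
    then show "G |= inst Y (is_closed 0 (X+1) (R+1) \<^bold>\<longrightarrow> BExists (K+1) (is_subset 0 1))" by simp
  qed simp
  ultimately have "F |= is_minorizing K X R" by (simp add: is_minorizing_def)
  then show ?thesis ..
qed

definition is_generating_at :: "nat \<Rightarrow> nat \<Rightarrow> nat \<Rightarrow> nat \<Rightarrow> fm" where
  "is_generating_at B y X R = (BForall B (is_closed 0 (X+1) (R+1)) \<^bold>\<and>
     Forall (is_closed 0 (X+1) (R+1) \<^bold>\<and> (y+1) \<^bold>\<in> 0 \<^bold>\<longrightarrow> BExists (B+1) ((y+2) \<^bold>\<in> 0 \<^bold>\<and> is_subset 0 1)))"

lemma rename_generating_at [simp]:
  "rename f (is_generating_at B y X R) = is_generating_at (f B) (f y) (f X) (f R)"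
  by (simp add: is_generating_at_def)

text \<open>Adding the rule \<open>(\<emptyset>, {y})\<close> restricts the closed sets to those containing \<open>y\<close>.\<close>

lemma forces_generating_at_ex:
  assumes rules: "F |= are_rules R X" and y: "F |= (y \<^bold>\<in> X)"
  shows "\<exists>B. F |= is_generating_at B y X R"
proof -
  obtain e where e: "F |= is_empty e" using forces_empty_ex by blast
  obtain y1 where y1: "F |= is_upair y1 y y" using forces_upair_ex by blast
  obtain p where p: "F |= is_opair p e y1" using forces_opair_ex by blast
  obtain P where P: "F |= is_upair P p p" using forces_upair_ex by blast
  obtain RP where RP: "F |= is_upair RP R P" using forces_upair_ex by blast
  obtain S where S: "F |= is_set S (BExists (Suc RP) (1 \<^bold>\<in> 0))" using forces_union_ex by blast
  let ?H = "{are_rules R X, y \<^bold>\<in> X, is_empty e, is_upair y1 y y, is_opair p e y1, is_upair P p p,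
    is_upair RP R P, is_set S (BExists (Suc RP) (1 \<^bold>\<in> 0))}"
  have H: "F ||= ?H" using rules y e y1 p P RP S by simp
  have SD: "G |= (q \<^bold>\<in> S) \<longleftrightarrow> G |= (q \<^bold>\<in> R) \<or> G |= (q \<^bold>= p)" if H: "G ||= ?H" for G q
  proof -
    have "G |= (q \<^bold>\<in> S) \<longleftrightarrow> (\<exists>z. (G |= (z \<^bold>= R) \<or> G |= (z \<^bold>= P)) \<and> G |= (q \<^bold>\<in> z))"
      using H forces_is_setD[of G S "BExists (Suc RP) (1 \<^bold>\<in> 0)" q] forces_upairD[of G RP R P] by simp
    also have "\<dots> \<longleftrightarrow> G |= (q \<^bold>\<in> R) \<or> G |= (q \<^bold>\<in> P)"
      by (meson forces_mem_cong forces_refl)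
    finally show ?thesis using H forces_upairD[of G P p p q] by simp
  qed
  have "F |= are_rules S X"
  proof (rule forces_rulesI[OF _ H])
    fix G q assume *: "G ||= ?H" "G |= (q \<^bold>\<in> S)"
    have eX: "G |= is_subset e X"
      by (rule forces_subsetI[of "{is_empty e}"]) (use * in \<open>auto intro: forces_emptyD\<close>)
    have yX: "G |= is_subset y1 X"
      by (rule forces_subsetI[of "{is_upair y1 y y, y \<^bold>\<in> X}"])
        (use * in \<open>auto simp: forces_upairD intro: forces_mem_cong[OF forces_sym forces_refl]\<close>)
    consider "G |= (q \<^bold>\<in> R)" | "G |= (q \<^bold>= p)" using * SD by blast
    then show "\<exists>a b. G |= is_subset a X \<and> G |= is_subset b X \<and> G |= is_opair q a b"
    proof cases
      case 1
      then show ?thesis using * forces_rulesD[of G R X q] by simp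
    next
      case 2
      have "G |= is_opair p e y1" using * by simp
      then have "G |= is_opair q e y1" using 2 by (meson forces_opair_cong forces_refl forces_sym)
      then show ?thesis using eX yX by blast
    qed
  qed simp
  then obtain B where B: "F |= is_minorizing B X S" using forces_minorizing_ex by blast
  have iff: "G |= is_closed Y X S \<longleftrightarrow> G |= is_closed Y X R \<and> G |= (y \<^bold>\<in> Y)" if H: "G ||= ?H" for G Y
  proof
    assume Y: "G |= is_closed Y X S"
    have "G |= is_closed Y X R"
    proof (rule forces_closedI[of "insert (is_closed Y X S) ?H"])
      fix G a b assume *: "G ||= insert (is_closed Y X S) ?H" "G |= rel R a b" "G |= is_subset a Y"
      have "G |= rel S a b" using *(1,2) SD[of G] unfolding forces_rel_iff by auto
      then show "\<exists>z. G |= (z \<^bold>\<in> b) \<and> G |= (z \<^bold>\<in> Y)" using forces_closedD[of G Y X S a b] * by simp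
    qed (use H Y forces_closed_subset in auto)
    moreover have "G |= rel S e y1" using SD[OF H, of p] H unfolding forces_rel_iff by auto
    moreover have "G |= is_subset e Y"
      by (rule forces_subsetI[of "{is_empty e}"]) (use H in \<open>auto intro: forces_emptyD\<close>)
    ultimately show "G |= is_closed Y X R \<and> G |= (y \<^bold>\<in> Y)"
      using forces_closedD[OF Y] H forces_upairD[of G y1 y y]
      by (simp, meson forces_mem_cong forces_refl)
  next
    assume Y: "G |= is_closed Y X R \<and> G |= (y \<^bold>\<in> Y)"
    show "G |= is_closed Y X S"
    proof (rule forces_closedI[of "insert (is_closed Y X R) (insert (y \<^bold>\<in> Y) ?H)"])
      fix G a b assume *: "G ||= insert (is_closed Y X R) (insert (y \<^bold>\<in> Y) ?H)"
        "G |= rel S a b" "G |= is_subset a Y"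
      then obtain q where q: "G |= (q \<^bold>\<in> S)" "G |= is_opair q a b" unfolding forces_rel_iff by blast
      then consider "G |= (q \<^bold>\<in> R)" | "G |= (q \<^bold>= p)" using * SD by auto
      then show "\<exists>z. G |= (z \<^bold>\<in> b) \<and> G |= (z \<^bold>\<in> Y)"
      proof cases
        case 1
        then have "G |= rel R a b" using q(2) unfolding forces_rel_iff by blast
        then show ?thesis using forces_closedD[of G Y X R a b] * by simp
      next
        case 2
        then have "G |= is_opair p a b" using q(2) by (meson forces_opair_cong forces_refl)
        moreover have "G |= is_opair p e y1" using * by simp
        ultimately have "G |= (y1 \<^bold>= b)" using forces_opair_inject by blast
        moreover have "G |= (y \<^bold>\<in> y1)" using * forces_upairD[of G y1 y y y] by simp
        ultimately show ?thesis using * by (simp, meson forces_mem_cong forces_refl)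
      qed
    qed (use H Y forces_closed_subset in auto)
  qed
  let ?H' = "insert (is_minorizing B X S) ?H"
  have H': "F ||= ?H'" using H B by simp
  have "F |= BForall B (is_closed 0 (X+1) (R+1))"
  proof (rule forces_BForallI[OF _ H'])
    fix G \<beta> assume *: "G ||= ?H'" "G |= (\<beta> \<^bold>\<in> B)"
    then have "G |= is_closed \<beta> X S" using forces_minorizingD1[of G B X S \<beta>] by simp
    then show "G |= inst \<beta> (is_closed 0 (X+1) (R+1))" using iff[of G \<beta>] * by simp
  qed simp
  moreover have "F |= Forall (is_closed 0 (X+1) (R+1) \<^bold>\<and> (y+1) \<^bold>\<in> 0 \<^bold>\<longrightarrow>
      BExists (B+1) ((y+2) \<^bold>\<in> 0 \<^bold>\<and> is_subset 0 1))"
  proof (rule forces_ForallI[OF _ H'])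
    fix G Y assume HG: "G ||= ?H'"
    have "G |= (is_closed Y X R \<^bold>\<and> y \<^bold>\<in> Y \<^bold>\<longrightarrow> BExists B ((y+1) \<^bold>\<in> 0 \<^bold>\<and> is_subset 0 (Y+1)))"
    proof (rule forces_implI[OF _ HG])
      fix G assume *: "G ||= ?H'" "G |= (is_closed Y X R \<^bold>\<and> y \<^bold>\<in> Y)"
      then have HG: "G ||= ?H" and B: "G |= is_minorizing B X S" by simp_all
      have "G |= is_closed Y X S" using * iff[OF HG] by simp
      then obtain \<beta> where \<beta>: "G |= (\<beta> \<^bold>\<in> B)" "G |= is_subset \<beta> Y" using forces_minorizingD2[OF B] by blast
      have "G |= (y \<^bold>\<in> \<beta>)" using iff[OF HG] forces_minorizingD1[OF B \<beta>(1)] by simp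
      then show "G |= BExists B ((y+1) \<^bold>\<in> 0 \<^bold>\<and> is_subset 0 (Y+1))" using \<beta> by auto
    qed simp
    then show "G |= inst Y (is_closed 0 (X+1) (R+1) \<^bold>\<and> (y+1) \<^bold>\<in> 0 \<^bold>\<longrightarrow>
      BExists (B+1) ((y+2) \<^bold>\<in> 0 \<^bold>\<and> is_subset 0 1))" by simp
  qed simp
  ultimately have "F |= is_generating_at B y X R" by (simp add: is_generating_at_def)
  then show ?thesis ..
qed

lemma forces_generating_atD1:
  "F |= is_generating_at B y X R \<Longrightarrow> F |= (\<beta> \<^bold>\<in> B) \<Longrightarrow> F |= is_closed \<beta> X R"
  using forces_BForallD[of F B "is_closed 0 (X+1) (R+1)" \<beta>] by (simp add: is_generating_at_def)

lemma forces_generating_atD2: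
  assumes "F |= is_generating_at B y X R" "F |= is_closed Y X R" "F |= (y \<^bold>\<in> Y)"
  shows "\<exists>\<beta>. F |= (\<beta> \<^bold>\<in> B) \<and> F |= (y \<^bold>\<in> \<beta>) \<and> F |= is_subset \<beta> Y"
proof -
  have "F |= Forall (is_closed 0 (X+1) (R+1) \<^bold>\<and> (y+1) \<^bold>\<in> 0 \<^bold>\<longrightarrow>
      BExists (B+1) ((y+2) \<^bold>\<in> 0 \<^bold>\<and> is_subset 0 1))"
    using assms(1) by (simp add: is_generating_at_def)
  from forces_spec[OF this, of Y]
  have "F |= (is_closed Y X R \<^bold>\<and> y \<^bold>\<in> Y \<^bold>\<longrightarrow> BExists B ((y+1) \<^bold>\<in> 0 \<^bold>\<and> is_subset 0 (Y+1)))" by simp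
  from forces_mp[OF this] assms(2,3) show ?thesis by simp
qed

text \<open>The generating families at the single elements \<open>y\<close> of \<open>X\<close> are
  not unique, so they are gathered by strong collection; their union generates. The second half of
  collection ensures that every gathered family consists of closed sets.\<close>

lemma forces_generating_ex:
  assumes rules: "F |= are_rules R X"
  shows "\<exists>G. F |= (BForall G (is_closed 0 (X+1) (R+1)) \<^bold>\<and>
    Forall (is_closed 0 (X+1) (R+1) \<^bold>\<longrightarrow> BForall 0 (BExists (G+2) (1 \<^bold>\<in> 0 \<^bold>\<and> is_subset 0 2))))"
proof -
  let ?\<psi> = "is_generating_at 0 1 (X+2) (R+2)"
  have "\<exists>C. F |= is_coll C X ?\<psi>"
    by (rule forces_collection[of "{are_rules R X}"]) (use rules forces_generating_at_ex in auto)
  then obtain C where C: "F |= is_coll C X ?\<psi>" ..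
  obtain K where K: "F |= is_set K (BExists (Suc C) (1 \<^bold>\<in> 0))" using forces_union_ex by blast
  let ?H = "{is_coll C X ?\<psi>, is_set K (BExists (Suc C) (1 \<^bold>\<in> 0))}"
  have H: "F ||= ?H" using C K by simp
  have KD: "G |= (\<beta> \<^bold>\<in> K) \<longleftrightarrow> (\<exists>B. G |= (B \<^bold>\<in> C) \<and> G |= (\<beta> \<^bold>\<in> B))" if "G ||= ?H" for G \<beta>
    using that forces_is_setD[of G K "BExists (Suc C) (1 \<^bold>\<in> 0)" \<beta>] by simp
  have "F |= BForall K (is_closed 0 (X+1) (R+1))"
  proof (rule forces_BForallI[OF _ H])
    fix G \<beta> assume *: "G ||= ?H" "G |= (\<beta> \<^bold>\<in> K)"
    then obtain B where B: "G |= (B \<^bold>\<in> C)" "G |= (\<beta> \<^bold>\<in> B)" using KD by blast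
    obtain y where "G |= is_generating_at B y X R" using is_collD2[of G C X ?\<psi> B] B(1) * by auto
    then show "G |= inst \<beta> (is_closed 0 (X+1) (R+1))" using forces_generating_atD1 B(2) by simp
  qed simp
  moreover have "F |= Forall (is_closed 0 (X+1) (R+1) \<^bold>\<longrightarrow> BForall 0 (BExists (K+2) (1 \<^bold>\<in> 0 \<^bold>\<and> is_subset 0 2)))"
  proof (rule forces_ForallI[OF _ H])
    fix G Y assume HG: "G ||= ?H"
    have "G |= (is_closed Y X R \<^bold>\<longrightarrow> BForall Y (BExists (K+1) (1 \<^bold>\<in> 0 \<^bold>\<and> is_subset 0 (Y+2))))"
    proof (rule forces_implI[OF _ HG])
      fix G assume HG: "G ||= ?H" and Y: "G |= is_closed Y X R"
      show "G |= BForall Y (BExists (K+1) (1 \<^bold>\<in> 0 \<^bold>\<and> is_subset 0 (Y+2)))"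
      proof (rule forces_BForallI[of "insert (is_closed Y X R) ?H"])
        fix G y assume *: "G ||= insert (is_closed Y X R) ?H" "G |= (y \<^bold>\<in> Y)"
        then have HG: "G ||= ?H" and Y: "G |= is_closed Y X R" by simp_all
        have "G |= (y \<^bold>\<in> X)" using forces_subsetD[OF forces_closed_subset[OF Y] *(2)] .
        then obtain B where B: "G |= (B \<^bold>\<in> C)" "G |= is_generating_at B y X R"
          using is_collD1[of G C X ?\<psi> y] HG by auto
        then show "G |= inst y (BExists (K+1) (1 \<^bold>\<in> 0 \<^bold>\<and> is_subset 0 (Y+2)))"
          using forces_generating_atD2[OF B(2) Y *(2)] KD[OF HG] by auto
      qed (use HG Y in auto)
    qed simp
    then show "G |= inst Y (is_closed 0 (X+1) (R+1) \<^bold>\<longrightarrow>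
        BForall 0 (BExists (K+2) (1 \<^bold>\<in> 0 \<^bold>\<and> is_subset 0 2)))" by (simp add: numeral_eq_Suc)
  qed simp
  ultimately have "F |= (BForall K (is_closed 0 (X+1) (R+1)) \<^bold>\<and>
    Forall (is_closed 0 (X+1) (R+1) \<^bold>\<longrightarrow> BForall 0 (BExists (K+2) (1 \<^bold>\<in> 0 \<^bold>\<and> is_subset 0 2))))"
    by (rule forces_conj[THEN iffD2, OF HOL.conjI])
  then show ?thesis ..
qed

theorem theorem6p3:
  shows "CZF \<union> {DC_for_W_types, PA, usREA} \<turnstile> full_NID"
proof -
  have "F |= full_NID" for F
    unfolding full_NID_def
  \<comment> \<open>The empty neighbourhood admits every point: nothing is assumed beyond the
    axioms, which all points force.\<close>
  proof (rule forces_ForallI[of "{}"])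
    fix G X
    have "G |= Forall (are_rules 0 (X+1) \<^bold>\<longrightarrow> Exists (BForall 0 (is_closed 0 (X+3) 2) \<^bold>\<and>
       Forall (is_closed 0 (X+3) 2 \<^bold>\<longrightarrow> BForall 0 (BExists 2 (1 \<^bold>\<in> 0 \<^bold>\<and> is_subset 0 2)))))"
    proof (rule forces_ForallI[of "{}"])
      fix G R
      have "G |= (are_rules R X \<^bold>\<longrightarrow> Exists (BForall 0 (is_closed 0 (X+2) (R+2)) \<^bold>\<and>
         Forall (is_closed 0 (X+2) (R+2) \<^bold>\<longrightarrow> BForall 0 (BExists 2 (1 \<^bold>\<in> 0 \<^bold>\<and> is_subset 0 2)))))"
        by (rule forces_implI[of "{}"]) (use forces_generating_ex in \<open>simp_all add: numeral_eq_Suc\<close>)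
      then show "G |= inst R (are_rules 0 (X+1) \<^bold>\<longrightarrow> Exists (BForall 0 (is_closed 0 (X+3) 2) \<^bold>\<and>
         Forall (is_closed 0 (X+3) 2 \<^bold>\<longrightarrow> BForall 0 (BExists 2 (1 \<^bold>\<in> 0 \<^bold>\<and> is_subset 0 2)))))"
        by (simp add: numeral_eq_Suc)
    qed simp_all
    then show "G |= inst X (Forall (are_rules 0 1 \<^bold>\<longrightarrow> Exists (BForall 0 (is_closed 0 3 2) \<^bold>\<and>
       Forall (is_closed 0 3 2 \<^bold>\<longrightarrow> BForall 0 (BExists 2 (1 \<^bold>\<in> 0 \<^bold>\<and> is_subset 0 2))))))"
      by (simp add: numeral_eq_Suc)
  qed simp_all
  then show ?thesis using provable_iff_forces unfolding ZT_def by blast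
qed

end
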